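(* Let $\lambda$ be a partition of a natural number $n$, let $V$ be a real vector space of dimension $m$, and let $P\subseteq V$ be a convex body containing $0$. Then: (1) $\mathbb{S}_\lambda$ is a functor in the category of compact convex sets containing the origin. (2) Let $W$ be any compact convex set and let $T:P^{\oplus n}\to W$ be any multilinear map satisfying the $\lambda$-exchange axioms. There is a unique morphism of compact convex sets $t:\mathbb{S}_\lambda(P)\to W$ satisfying $t\circ h_\lambda=T$. (3) $\mathbb{S}_\lambda(P)$ is a convex body whose dimension equals the number of semistandard tableaux of shape $\lambda$ with entries in $\{1,\dots,m\}$. If $\lambda$ has more than one row, then $\mathbb{S}_\lambda(P)$ is symmetric around the origin. (4) If $E$ is the set of extreme points of $P$, then $\mathbb{S}_\lambda(P)$ equals the convex hull of $h_\lambda(E^{\oplus n})$. In particular, if $P$ is a polytope then $\mathbb{S}_\lambda(P)$ is a polytope. (5) If $m_P$ is a measure supported on $P$ (for instance the restriction of the Lebesgue measure on $V$), then $m_P$ determines an accurate approximation scheme for $\mathbb{S}_\lambda(P)$ by projections of spectrahedra.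
   Context: A convex body in a real vector space $V$ is a full-dimensional compact convex subset. Compact convex sets considered here sit in finite-dimensional real vector spaces, are full-dimensional and contain the origin; morphisms $P\to Q$ ($P\subseteq V$, $Q\subseteq V'$) are restrictions of linear maps $V\to V'$ carrying $P$ into $Q$. $P^{\oplus n}$ denotes $P\times\cdots\times P$ ($n$ factors), and likewise $E^{\oplus n}$. A multilinear map $T:P^{\oplus n}\to W$ is the restriction of a multilinear map of the ambient vector spaces sending $P^{\oplus n}$ into $W$. Schur functors: index the $n$ arguments of a map on $V^{\oplus n}$ by the boxes of the Young diagram of $\lambda$, read left to right and top to bottom. A multilinear map $\varphi:V^{\oplus n}\to F$ satisfies the $\lambda$-exchange axioms if (i) it is alternating in the entries of each column, and (ii) for every filling $v$, every pair of columns and every chosen set of boxes in the right one of the two columns, $\varphi(v)=\sum_w\varphi(w)$, the sum being over all $w$ obtained from $v$ by exchanging the chosen set of entries with a set of entries of the same size in the left column, preserving vertical order. $h_\lambda:V^{\oplus n}\to\mathbb{S}_\lambda(V)$ is the universal multilinear map satisfying these axioms, where $\mathbb{S}_\lambda(V)$ is the Schur module; it sends $(v_1,\dots,v_n)$ to the class of the tableau filled with the $v_i$. $\mathbb{S}_\lambda$ acts on linear maps as usual. For a convex body $P\subseteq V$ containing $0$, $\mathbb{S}_\lambda(P):=\mathrm{Conv}(h_\lambda(P\times\cdots\times P))\subseteq\mathbb{S}_\lambda(V)$; for a morphism $T:P\to Q$, $\mathbb{S}_\lambda(T)$ is defined as for vector spaces. A spectrahedron is a set $\{x:M_0+\sum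 x_iM_i\succeq0\}$ with $M_i$ symmetric matrices. In (5), measures are finite and "supported on $P$" means every open neighborhood of every point of $P$ has positive measure (and the measure lives on $P$). The accurate approximation scheme is the following: let $T=h_\lambda:V^{\oplus n}\to\mathbb{S}_\lambda(V)\cong\mathbb{R}^r$ with components $T_i$ and let $\mu=m_P^n$ be the product measure on $P^{\oplus n}$; set $Q_k=\{\ell\in\mathbb{R}^r:\int_{P^{\oplus n}}(1+\sum_i\ell_iT_i(x))a(x)^2d\mu(x)\ge0\text{ for all polynomials }a\text{ of degree}\le k\}$ and $Q_k^\circ=\{y:\sum_i\ell_iy_i\ge-1\ \forall\ell\in Q_k\}$. The sets $Q_k^\circ$ are projections of spectrahedra, increasing in $k$, and accuracy means $\mathbb{S}_\lambda(P)=\overline{\bigcup_kQ_k^\circ}$. *)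

theory Defs
  imports "HOL-Analysis.Analysis" "HOL-Analysis.Finite_Function_Topology"
begin

section \<open>Conventions\<close>

text \<open>
  A finite-dimensional real vector space is given by a finite-dimensional subspace \<open>V\<close> of a type of
  class \<open>real_normed_vector\<close>.  (All norms on \<open>V\<close> induce the same topology; using subspaces rather
  than whole types allows dimension zero, and makes the Schur modules below vector spaces in the
  same sense.)  The elements of \<open>V\<^sup>n\<close> are extensional functions on \<open>{..<n}\<close>.
\<close>

abbreviation tuples :: "nat \<Rightarrow> 'v set \<Rightarrow> (nat \<Rightarrow> 'v) set" where
  "tuples n V \<equiv> {..<n} \<rightarrow>\<^sub>E V"

definition fin_dim :: "'v::real_vector set \<Rightarrow> bool" where
  "fin_dim V \<longleftrightarrow> (\<exists>B. finite B \<and> V = span B)"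

definition basis_of :: "nat \<Rightarrow> (nat \<Rightarrow> 'v::real_vector) \<Rightarrow> 'v set \<Rightarrow> bool" where
  "basis_of r b V \<longleftrightarrow> inj_on b {..<r} \<and> independent (b ` {..<r}) \<and> span (b ` {..<r}) = V"


section \<open>Convex bodies and their morphisms\<close>

definition convex_body :: "'v::real_normed_vector set \<Rightarrow> 'v set \<Rightarrow> bool" where
  "convex_body V P \<longleftrightarrow>
     subspace V \<and> fin_dim V \<and> P \<subseteq> V \<and> compact P \<and> convex P \<and> affine hull P = V"

text \<open>The objects of the category of compact convex sets.\<close>

definition cc_object :: "'v::real_normed_vector set \<Rightarrow> 'v set \<Rightarrow> bool" where
  "cc_object V P \<longleftrightarrow> convex_body V P \<and> 0 \<in> P"

text \<open>
  A linear map \<open>V \<rightarrow> F\<close> is represented by a linear map of the ambient types carrying \<open>V\<close> into \<open>F\<close>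
  (linear maps on a subspace always extend).  Morphisms are restrictions to \<open>P\<close>, as extensional
  functions, so that equality of morphisms is equality on \<open>P\<close>.
\<close>

definition cc_hom ::
  "'v::real_normed_vector set \<Rightarrow> 'v set \<Rightarrow> 'w::real_normed_vector set \<Rightarrow> 'w set \<Rightarrow> ('v \<Rightarrow> 'w) set"
  where
  "cc_hom V P F W = {restrict f P | f. linear f \<and> f ` V \<subseteq> F \<and> f ` P \<subseteq> W}"


section \<open>Young diagrams and exchange axioms\<close>

definition number_partition :: "nat list \<Rightarrow> nat \<Rightarrow> bool" where
  "number_partition lam n \<longleftrightarrow> sorted_wrt (\<ge>) lam \<and> 0 \<notin> set lam \<and> sum_list lam = n"

text \<open>
  The box in row \<open>i\<close> and column \<open>j\<close> (both counted from 0) is represented by its position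
  \<open>sum_list (take i lam) + j\<close> in the reading order, left to right and top to bottom.  In particular
  the vertical order within a column is the order of natural numbers.
\<close>

definition diagram_row :: "nat list \<Rightarrow> nat \<Rightarrow> nat set" where
  "diagram_row lam i = {sum_list (take i lam) + j | j. i < length lam \<and> j < lam ! i}"

definition diagram_column :: "nat list \<Rightarrow> nat \<Rightarrow> nat set" where
  "diagram_column lam j = {sum_list (take i lam) + j | i. i < length lam \<and> j < lam ! i}"

definition semistandard_tableaux :: "nat list \<Rightarrow> nat \<Rightarrow> (nat \<Rightarrow> nat) set" where
  "semistandard_tableaux lam m =
     {t \<in> {..<sum_list lam} \<rightarrow>\<^sub>E {1..m}.
        (\<forall>i. \<forall>k\<in>diagram_row lam i. \<forall>k'\<in>diagram_row lam i. k < k' \<longrightarrow> t k \<le> t k') \<and>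
        (\<forall>j. \<forall>k\<in>diagram_column lam j. \<forall>k'\<in>diagram_column lam j. k < k' \<longrightarrow> t k < t k')}"

text \<open>The element of \<open>Y\<close> having the same rank in \<open>Y\<close> as \<open>k\<close> has in \<open>X\<close>.\<close>

definition order_match :: "nat set \<Rightarrow> nat set \<Rightarrow> nat \<Rightarrow> nat" where
  "order_match X Y k = sorted_list_of_set Y ! card {x \<in> X. x < k}"

definition exchange :: "nat set \<Rightarrow> nat set \<Rightarrow> (nat \<Rightarrow> 'v) \<Rightarrow> nat \<Rightarrow> 'v" where
  "exchange X Y v = (\<lambda>k. if k \<in> X then v (order_match X Y k)
                          else if k \<in> Y then v (order_match Y X k) else v k)"

definition exchanges :: "nat list \<Rightarrow> nat \<Rightarrow> nat set \<Rightarrow> nat set set" where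
  "exchanges lam j Y = {X. X \<subseteq> diagram_column lam j \<and> card X = card Y}"

definition multilinear_on ::
  "nat \<Rightarrow> 'v::real_vector set \<Rightarrow> 'f::real_vector set \<Rightarrow> ((nat \<Rightarrow> 'v) \<Rightarrow> 'f) \<Rightarrow> bool" where
  "multilinear_on n V F \<phi> \<longleftrightarrow>
     (\<forall>v\<in>tuples n V. \<phi> v \<in> F) \<and>
     (\<forall>v\<in>tuples n V. \<forall>i<n. \<forall>x\<in>V. \<forall>y\<in>V. \<phi> (v(i := x + y)) = \<phi> (v(i := x)) + \<phi> (v(i := y))) \<and>
     (\<forall>v\<in>tuples n V. \<forall>i<n. \<forall>c. \<forall>x\<in>V. \<phi> (v(i := c *\<^sub>R x)) = c *\<^sub>R \<phi> (v(i := x)))"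

definition exchange_axioms ::
  "nat list \<Rightarrow> 'v set \<Rightarrow> ((nat \<Rightarrow> 'v) \<Rightarrow> 'f::real_vector) \<Rightarrow> bool" where
  "exchange_axioms lam V \<phi> \<longleftrightarrow>
     (\<forall>v\<in>tuples (sum_list lam) V. \<forall>j. \<forall>k\<in>diagram_column lam j. \<forall>k'\<in>diagram_column lam j.
        k \<noteq> k' \<longrightarrow> v k = v k' \<longrightarrow> \<phi> v = 0) \<and>
     (\<forall>v\<in>tuples (sum_list lam) V. \<forall>j j'. j < j' \<longrightarrow> (\<forall>Y\<subseteq>diagram_column lam j'.
        \<phi> v = (\<Sum>X\<in>exchanges lam j Y. \<phi> (exchange X Y v))))"


section \<open>Schur modules\<close>

text \<open>
  The Schur module of \<open>V\<close> is the quotient of the real vector space with basis \<open>V\<^sup>n\<close> by the subspace spanned by the relations expressing multilinearity and the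
  exchange axioms.
\<close>

type_synonym 'v formal_sum = "(nat \<Rightarrow> 'v, real) poly_mapping"

abbreviation tab :: "(nat \<Rightarrow> 'v) \<Rightarrow> 'v formal_sum" where
  "tab v \<equiv> Poly_Mapping.single v 1"

definition schur_relations ::
  "nat list \<Rightarrow> 'v::real_vector set \<Rightarrow> 'v formal_sum set" where
  "schur_relations lam V = span (
     {tab (v(i := x + y)) - tab (v(i := x)) - tab (v(i := y)) | v i x y.
        v \<in> tuples (sum_list lam) V \<and> i < sum_list lam \<and> x \<in> V \<and> y \<in> V} \<union>
     {tab (v(i := c *\<^sub>R x)) - c *\<^sub>R tab (v(i := x)) | v i c x.
        v \<in> tuples (sum_list lam) V \<and> i < sum_list lam \<and> x \<in> V} \<union>
     {tab v | v j k k'.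
        v \<in> tuples (sum_list lam) V \<and> k \<in> diagram_column lam j \<and> k' \<in> diagram_column lam j \<and> k \<noteq> k' \<and> v k = v k'} \<union>
     {tab v - (\<Sum>X\<in>exchanges lam j Y. tab (exchange X Y v)) | v j j' Y.
        v \<in> tuples (sum_list lam) V \<and> j < j' \<and> Y \<subseteq> diagram_column lam j'})"

text \<open>
  The quotient by a subspace \<open>R\<close> is realised without introducing a type of cosets (which would have
  to depend on \<open>lam\<close> and \<open>V\<close>): \<open>quot_map R\<close> sends \<open>x\<close> to a representative of \<open>x + R\<close> that depends only
  on the coset, and linearly so.
\<close>

definition quot_map :: "'a::real_vector set \<Rightarrow> 'a \<Rightarrow> 'a" where
  "quot_map R = (SOME p. linear p \<and> (\<forall>x. p x - x \<in> R) \<and> (\<forall>x\<in>R. p x = 0))"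

definition schur_module ::
  "nat list \<Rightarrow> 'v::real_vector set \<Rightarrow> 'v formal_sum set" where
  "schur_module lam V = quot_map (schur_relations lam V) ` span (tab ` tuples (sum_list lam) V)"

text \<open>The universal map \<open>h\<close>.\<close>

definition schur_map ::
  "nat list \<Rightarrow> 'v::real_vector set \<Rightarrow> (nat \<Rightarrow> 'v) \<Rightarrow> 'v formal_sum" where
  "schur_map lam V v = quot_map (schur_relations lam V) (tab v)"

definition lin_extend :: "('k \<Rightarrow> 'f::real_vector) \<Rightarrow> ('k, real) poly_mapping \<Rightarrow> 'f" where
  "lin_extend G x = (\<Sum>k\<in>Poly_Mapping.keys x. Poly_Mapping.lookup x k *\<^sub>R G k)"

text \<open>
  The action on a linear map \<open>f : V \<rightarrow> F\<close>: the map induced on the quotients by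
  \<open>tab (v\<^sub>1, \<dots>, v\<^sub>n) \<mapsto> tab (f v\<^sub>1, \<dots>, f v\<^sub>n)\<close>.
\<close>

definition schur_linear ::
  "nat list \<Rightarrow> 'w::real_vector set \<Rightarrow> ('v \<Rightarrow> 'w) \<Rightarrow>
     'v formal_sum \<Rightarrow> 'w formal_sum" where
  "schur_linear lam F f x =
     quot_map (schur_relations lam F)
       (lin_extend (\<lambda>v. tab (restrict (f \<circ> v) {..<sum_list lam})) x)"

definition schur_body ::
  "nat list \<Rightarrow> 'v::real_vector set \<Rightarrow> 'v set \<Rightarrow> 'v formal_sum set" where
  "schur_body lam V P = convex hull (schur_map lam V ` tuples (sum_list lam) P)"

text \<open>
  The action on a morphism \<open>T : P \<rightarrow> Q\<close>, \<open>Q \<subseteq> F\<close>.  As \<open>P\<close> spans its ambient space \<open>V\<close>, the linear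
  extension of \<open>T\<close> is unique on \<open>V\<close>.
\<close>

definition schur_morphism ::
  "nat list \<Rightarrow> 'v::real_vector set \<Rightarrow> 'v set \<Rightarrow> 'w::real_vector set \<Rightarrow> ('v \<Rightarrow> 'w) \<Rightarrow>
     'v formal_sum \<Rightarrow> 'w formal_sum" where
  "schur_morphism lam V P F T =
     restrict (schur_linear lam F (SOME f. linear f \<and> restrict f P = T)) (schur_body lam V P)"

text \<open>
  Multilinear maps \<open>P\<^sup>n \<rightarrow> W\<close> satisfying the exchange axioms (\<open>W \<subseteq> F\<close>).
\<close>

definition exchange_map_into ::
  "nat list \<Rightarrow> 'v::real_vector set \<Rightarrow> 'v set \<Rightarrow> 'w::real_vector set \<Rightarrow> 'w set \<Rightarrow>
     ((nat \<Rightarrow> 'v) \<Rightarrow> 'w) \<Rightarrow> bool" where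
  "exchange_map_into lam V P F W T \<longleftrightarrow>
     (\<exists>\<phi>. multilinear_on (sum_list lam) V F \<phi> \<and> exchange_axioms lam V \<phi> \<and>
          (\<forall>v\<in>tuples (sum_list lam) P. T v = \<phi> v)) \<and>
     (\<forall>v\<in>tuples (sum_list lam) P. T v \<in> W)"


subsection \<open>The universal property\<close>

lemma quot_map:
  assumes R: "subspace (R :: 'a::real_vector set)"
  shows linear_quot_map: "linear (quot_map R)"
    and quot_map_diff: "quot_map R x - x \<in> R"
    and quot_map_zero: "x \<in> R \<Longrightarrow> quot_map R x = 0"
proof -
  obtain B where B: "B \<subseteq> R" "independent B" "R \<subseteq> span B"
    using real_vector.maximal_independent_subset by blast
  define C where "C = real_vector.extend_basis B"
  have C: "B \<subseteq> C" "independent C" "span C = UNIV"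
    using real_vector.extend_basis_superset[OF B(2)] real_vector.independent_extend_basis[OF B(2)]
      real_vector.span_extend_basis[OF B(2)] by (auto simp: C_def)
  obtain g where g: "linear g" "\<And>x. x \<in> C \<Longrightarrow> g x = (if x \<in> B then x else 0)"
    using linear_independent_extend[OF C(2), of "\<lambda>x. if x \<in> B then x else 0"] by blast
  have sp: "span B = R" using B R by (simp add: span_minimal subset_antisym)
  have gR: "g x \<in> R" for x
  proof -
    have "x \<in> span C" using C by simp
    then show ?thesis
    proof (induction rule: span_induct_alt)
      case base then show ?case using g(1) R by (simp add: linear_0 subspace_0)
    next
      case (step c x y)
      then have "g (c *\<^sub>R x + y) = c *\<^sub>R (if x \<in> B then x else 0) + g y"
        using g by (simp add: linear_add linear_scale)
      moreover have "(if x \<in> B then x else 0) \<in> R" using B R by (auto simp: subspace_0)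
      ultimately show ?case using step R by (simp add: subspace_add subspace_scale)
    qed
  qed
  have gid: "g x = x" if "x \<in> R" for x
  proof -
    have "x \<in> span B" using that sp by simp
    then show ?thesis
      by (rule linear_eq_on[OF g(1) linear_id, of _ B, unfolded id_def])
        (use g C in auto)
  qed
  have "linear (\<lambda>x. x - g x)"
    using g(1) linear_id by (auto simp: id_def intro: linear_compose_sub)
  moreover have "x - g x - x \<in> R" for x using subspace_neg[OF R gR[of x]] by simp
  ultimately have "\<exists>p. linear p \<and> (\<forall>x. p x - x \<in> R) \<and> (\<forall>x\<in>R. p x = 0)"
    using gid by (intro exI[of _ "\<lambda>x. x - g x"]) auto
  then have "linear (quot_map R) \<and> (\<forall>x. quot_map R x - x \<in> R) \<and> (\<forall>x\<in>R. quot_map R x = 0)"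
    unfolding quot_map_def by (rule someI_ex)
  then show "linear (quot_map R)" "quot_map R x - x \<in> R" "x \<in> R \<Longrightarrow> quot_map R x = 0" by auto
qed

lemma quot_map_eq_iff:
  assumes "subspace R"
  shows "quot_map R x = quot_map R y \<longleftrightarrow> x - y \<in> R"
proof
  assume "quot_map R x = quot_map R y"
  then have "x - y = (quot_map R y - y) - (quot_map R x - x)" by simp
  then show "x - y \<in> R"
    using subspace_diff[OF assms quot_map_diff[OF assms, of y] quot_map_diff[OF assms, of x]] by simp
next
  assume "x - y \<in> R"
  then show "quot_map R x = quot_map R y"
    using quot_map_zero[OF assms, of "x - y"] by (simp add: linear_diff[OF linear_quot_map[OF assms]])
qed

lemma subspace_schur_relations: "subspace (schur_relations lam V)"
  by (simp add: schur_relations_def)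

lemma diagram_column_subset: "diagram_column lam j \<subseteq> {..<sum_list lam}"
proof
  fix k assume "k \<in> diagram_column lam j"
  then obtain i where i: "k = sum_list (take i lam) + j" "i < length lam" "j < lam ! i"
    by (auto simp: diagram_column_def)
  have "sum_list lam = sum_list (take i lam) + sum_list (drop i lam)"
    by (metis append_take_drop_id sum_list_append)
  moreover have "sum_list (drop i lam) = lam ! i + sum_list (drop (Suc i) lam)"
    using i(2) by (simp add: Cons_nth_drop_Suc[symmetric])
  ultimately show "k \<in> {..<sum_list lam}" using i by simp
qed

lemma order_match_in:
  assumes "k \<in> A" "finite A" "finite B" "card A = card B"
  shows "order_match A B k \<in> B"
proof -
  have "card {x \<in> A. x < k} < card A"
    by (rule psubset_card_mono) (use assms in auto)
  then have "sorted_list_of_set B ! card {x \<in> A. x < k} \<in> set (sorted_list_of_set B)"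
    using assms by (intro nth_mem) simp
  then show ?thesis using assms by (simp add: order_match_def)
qed

lemma lookup_scaleR_poly_mapping:
  "Poly_Mapping.lookup (c *\<^sub>R x) k = c *\<^sub>R Poly_Mapping.lookup x k"
proof -
  have "{k. c *\<^sub>R Poly_Mapping.lookup x k \<noteq> 0} \<subseteq> {k. Poly_Mapping.lookup x k \<noteq> 0}" by auto
  then have "finite {k. c *\<^sub>R Poly_Mapping.lookup x k \<noteq> 0}"
    using finite_lookup finite_subset by blast
  then show ?thesis by (simp add: scaleR_poly_mapping_def)
qed

lemma linear_lin_extend: "linear (lin_extend G)"
proof -
  have eq: "lin_extend G x = (\<Sum>k\<in>A. Poly_Mapping.lookup x k *\<^sub>R G k)"
    if "finite A" "Poly_Mapping.keys x \<subseteq> A" for x A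
    unfolding lin_extend_def
    by (rule sum.mono_neutral_left) (use that in \<open>auto simp: in_keys_iff\<close>)
  show ?thesis
  proof (rule linearI)
    fix x y :: "('a, real) poly_mapping" and c :: real
    let ?A = "Poly_Mapping.keys x \<union> Poly_Mapping.keys y"
    have "Poly_Mapping.keys (x + y) \<subseteq> ?A" by (rule Poly_Mapping.keys_add)
    then show "lin_extend G (x + y) = lin_extend G x + lin_extend G y"
      using eq[of ?A x] eq[of ?A y] eq[of ?A "x + y"]
      by (simp add: lookup_add scaleR_add_left sum.distrib)
    have "Poly_Mapping.keys (c *\<^sub>R x) \<subseteq> Poly_Mapping.keys x"
      by (auto simp: in_keys_iff lookup_scaleR_poly_mapping)
    then show "lin_extend G (c *\<^sub>R x) = c *\<^sub>R lin_extend G x"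
      using eq[of "Poly_Mapping.keys x" "c *\<^sub>R x"] eq[of "Poly_Mapping.keys x" x]
      by (simp add: scaleR_sum_right lookup_scaleR_poly_mapping)
  qed
qed

lemma lin_extend_tab [simp]: "lin_extend G (Poly_Mapping.single k 1) = G k"
  by (simp add: lin_extend_def)

lemma span_schur_map: "span (schur_map lam V ` tuples (sum_list lam) V) = schur_module lam V"
  unfolding schur_module_def schur_map_def
  using linear_span_image[OF linear_quot_map[OF subspace_schur_relations],
      of lam V "tab ` tuples (sum_list lam) V"]
  by (simp add: image_image)

theorem schur_map_exchange:
  assumes "subspace V"
  shows "multilinear_on (sum_list lam) V (schur_module lam V) (schur_map lam V)"
    and "exchange_axioms lam V (schur_map lam V)"
proof -
  let ?R = "schur_relations lam V" and ?p = "quot_map (schur_relations lam V)"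
  note sR = subspace_schur_relations[of lam V]
  note lin = linear_quot_map[OF sR] and z = quot_map_zero[OF sR]
  show "multilinear_on (sum_list lam) V (schur_module lam V) (schur_map lam V)"
    unfolding multilinear_on_def
  proof (intro conjI ballI allI impI)
    fix v assume "v \<in> tuples (sum_list lam) V"
    then show "schur_map lam V v \<in> schur_module lam V"
      by (auto simp flip: span_schur_map intro: span_base)
  next
    fix v i x y assume "v \<in> tuples (sum_list lam) V" "i < sum_list lam" "x \<in> V" "y \<in> V"
    then have "tab (v(i := x + y)) - tab (v(i := x)) - tab (v(i := y)) \<in> ?R"
      unfolding schur_relations_def by (intro span_base) blast
    from z[OF this] show "schur_map lam V (v(i := x + y)) =
        schur_map lam V (v(i := x)) + schur_map lam V (v(i := y))"
      by (simp add: schur_map_def linear_diff[OF lin] diff_eq_eq add.commute)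
  next
    fix v i c x assume "v \<in> tuples (sum_list lam) V" "i < sum_list lam" "x \<in> V"
    then have "tab (v(i := c *\<^sub>R x)) - c *\<^sub>R tab (v(i := x)) \<in> ?R"
      unfolding schur_relations_def by (intro span_base) blast
    from z[OF this] show "schur_map lam V (v(i := c *\<^sub>R x)) = c *\<^sub>R schur_map lam V (v(i := x))"
      by (simp add: schur_map_def linear_diff[OF lin] linear_scale[OF lin])
  qed
  show "exchange_axioms lam V (schur_map lam V)"
    unfolding exchange_axioms_def
  proof (intro conjI ballI allI impI)
    fix v j k k' assume "v \<in> tuples (sum_list lam) V" "k \<in> diagram_column lam j" "k' \<in> diagram_column lam j"
      "k \<noteq> k'" "v k = v k'"
    then have "tab v \<in> ?R"
      unfolding schur_relations_def by (intro span_base) blast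
    from z[OF this] show "schur_map lam V v = 0" by (simp add: schur_map_def)
  next
    fix v and j j' :: nat and Y
    assume "v \<in> tuples (sum_list lam) V" "j < j'" "Y \<subseteq> diagram_column lam j'"
    then have "tab v - (\<Sum>X\<in>exchanges lam j Y. tab (exchange X Y v)) \<in> ?R"
      unfolding schur_relations_def by (intro span_base) blast
    from z[OF this] show "schur_map lam V v =
        (\<Sum>X\<in>exchanges lam j Y. schur_map lam V (exchange X Y v))"
      by (simp add: schur_map_def linear_diff[OF lin] linear_sum[OF lin])
  qed
qed

lemma lin_extend_relations:
  assumes m: "multilinear_on (sum_list lam) V F \<phi>" and e: "exchange_axioms lam V \<phi>"
    and x: "x \<in> schur_relations lam V"
  shows "lin_extend \<phi> x = 0"
proof (rule linear_eq_0_on_span[OF linear_lin_extend _ x[unfolded schur_relations_def]])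
  note lin = linear_lin_extend[of \<phi>]
  fix y assume "y \<in>
     {tab (v(i := x + y)) - tab (v(i := x)) - tab (v(i := y)) | v i x y.
        v \<in> tuples (sum_list lam) V \<and> i < sum_list lam \<and> x \<in> V \<and> y \<in> V} \<union>
     {tab (v(i := c *\<^sub>R x)) - c *\<^sub>R tab (v(i := x)) | v i c x.
        v \<in> tuples (sum_list lam) V \<and> i < sum_list lam \<and> x \<in> V} \<union>
     {tab v | v j k k'.
        v \<in> tuples (sum_list lam) V \<and> k \<in> diagram_column lam j \<and> k' \<in> diagram_column lam j \<and> k \<noteq> k' \<and> v k = v k'} \<union>
     {tab v - (\<Sum>X\<in>exchanges lam j Y. tab (exchange X Y v)) | v j j' Y.
        v \<in> tuples (sum_list lam) V \<and> j < j' \<and> Y \<subseteq> diagram_column lam j'}" (is "_ \<in> ?A \<union> ?B \<union> ?C \<union> ?D")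
  then consider "y \<in> ?A" | "y \<in> ?B" | "y \<in> ?C" | "y \<in> ?D" by blast
  then show "lin_extend \<phi> y = 0"
  proof cases
    case 1 then show ?thesis
      using m by (auto simp: multilinear_on_def linear_diff[OF lin])
  next
    case 2 then show ?thesis
      using m by (auto simp: multilinear_on_def linear_diff[OF lin] linear_scale[OF lin])
  next
    case 3
    then obtain v j k k' where *: "y = tab v" "v \<in> tuples (sum_list lam) V"
      "k \<in> diagram_column lam j" "k' \<in> diagram_column lam j" "k \<noteq> k'" "v k = v k'" by blast
    then have "\<phi> v = 0" using e unfolding exchange_axioms_def by blast
    then show ?thesis using * by simp
  next
    case 4
    then obtain v j j' Y where *: "y = tab v - (\<Sum>X\<in>exchanges lam j Y. tab (exchange X Y v))"
      "v \<in> tuples (sum_list lam) V" "j < j'" "Y \<subseteq> diagram_column lam j'" by blast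
    then have "\<phi> v = (\<Sum>X\<in>exchanges lam j Y. \<phi> (exchange X Y v))"
      using e unfolding exchange_axioms_def by blast
    then show ?thesis using * by (simp add: linear_diff[OF lin] linear_sum[OF lin])
  qed
qed

lemma lin_extend_schur_map:
  assumes "multilinear_on (sum_list lam) V F \<phi>" "exchange_axioms lam V \<phi>"
  shows "lin_extend \<phi> (schur_map lam V v) = \<phi> v"
proof -
  have "lin_extend \<phi> (schur_map lam V v - tab v) = 0"
    unfolding schur_map_def
    by (rule lin_extend_relations[OF assms quot_map_diff[OF subspace_schur_relations]])
  then show ?thesis by (simp add: linear_diff[OF linear_lin_extend])
qed

theorem schur_map_universal:
  assumes "multilinear_on (sum_list lam) V F \<phi>" "exchange_axioms lam V \<phi>"
  shows "\<exists>t. linear t \<and> (\<forall>v\<in>tuples (sum_list lam) V. t (schur_map lam V v) = \<phi> v)"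
    and "\<lbrakk>linear t; linear t'; \<forall>v\<in>tuples (sum_list lam) V. t (schur_map lam V v) = \<phi> v;
          \<forall>v\<in>tuples (sum_list lam) V. t' (schur_map lam V v) = \<phi> v; x \<in> schur_module lam V\<rbrakk>
          \<Longrightarrow> t x = t' x"
proof -
  show "\<exists>t. linear t \<and> (\<forall>v\<in>tuples (sum_list lam) V. t (schur_map lam V v) = \<phi> v)"
    using linear_lin_extend lin_extend_schur_map[OF assms] by blast
  assume *: "linear t" "linear t'" "\<forall>v\<in>tuples (sum_list lam) V. t (schur_map lam V v) = \<phi> v"
    "\<forall>v\<in>tuples (sum_list lam) V. t' (schur_map lam V v) = \<phi> v" "x \<in> schur_module lam V"
  show "t x = t' x"
    by (rule linear_eq_on[OF *(1,2), of _ "schur_map lam V ` tuples (sum_list lam) V"])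
      (use * in \<open>auto simp: span_schur_map\<close>)
qed

theorem schur_linear_schur_map:
  assumes lam: "number_partition lam n" and V: "subspace V" and F: "subspace F"
    and f: "linear f" "f ` V \<subseteq> F" and v: "v \<in> tuples n V"
  shows "schur_linear lam F f (schur_map lam V v) = schur_map lam F (restrict (f \<circ> v) {..<n})"
proof -
  have n: "sum_list lam = n" using lam by (simp add: number_partition_def)
  let ?r = "\<lambda>v. restrict (f \<circ> v) {..<n}"
  let ?G = "\<lambda>v. schur_map lam F (?r v)"
  have r: "?r v \<in> tuples n F" if "v \<in> tuples n V" for v
    using that f(2) by (intro PiE_I) (auto simp: image_subset_iff)
  have upd: "?r (v(i := x)) = (?r v)(i := f x)" if "i < n" for v i x
    using that by (auto simp: fun_eq_iff)
  have M: "multilinear_on n F (schur_module lam F) (schur_map lam F)"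
    using schur_map_exchange(1)[OF F, of lam] by (simp only: n)
  have M1: "schur_map lam F w \<in> schur_module lam F" if "w \<in> tuples n F" for w
    using M that by (simp only: multilinear_on_def)
  have M2: "schur_map lam F (w(i := x + y)) = schur_map lam F (w(i := x)) + schur_map lam F (w(i := y))"
    if "w \<in> tuples n F" "i < n" "x \<in> F" "y \<in> F" for w i x y
    using M that by (simp only: multilinear_on_def)
  have M3: "schur_map lam F (w(i := c *\<^sub>R x)) = c *\<^sub>R schur_map lam F (w(i := x))"
    if "w \<in> tuples n F" "i < n" "x \<in> F" for w i c x
    using M that by (simp only: multilinear_on_def)
  have E: "exchange_axioms lam F (schur_map lam F)" by (rule schur_map_exchange(2)[OF F])
  have E1: "schur_map lam F w = 0"
    if "w \<in> tuples n F" "k \<in> diagram_column lam j" "k' \<in> diagram_column lam j" "k \<noteq> k'" "w k = w k'"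
    for w j k k'
    using E that unfolding exchange_axioms_def n by blast
  have E2: "schur_map lam F w = (\<Sum>X\<in>exchanges lam j Y. schur_map lam F (exchange X Y w))"
    if "w \<in> tuples n F" "j < j'" "Y \<subseteq> diagram_column lam j'" for w j j' Y
    using E that unfolding exchange_axioms_def n by blast
  have m: "multilinear_on (sum_list lam) V (schur_module lam F) ?G"
    unfolding multilinear_on_def n
  proof (intro conjI ballI allI impI)
    fix v assume "v \<in> tuples n V"
    then show "?G v \<in> schur_module lam F" by (intro M1 r)
  next
    fix v i x y assume *: "v \<in> tuples n V" "i < n" "x \<in> V" "y \<in> V"
    then have "f x \<in> F" "f y \<in> F" using f(2) by auto
    then have "schur_map lam F ((?r v)(i := f x + f y)) =
        schur_map lam F ((?r v)(i := f x)) + schur_map lam F ((?r v)(i := f y))"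
      by (rule M2[OF r[OF *(1)] *(2)])
    then show "?G (v(i := x + y)) = ?G (v(i := x)) + ?G (v(i := y))"
      by (simp only: upd[OF *(2)] linear_add[OF f(1)])
  next
    fix v i c x assume *: "v \<in> tuples n V" "i < n" "x \<in> V"
    then have "f x \<in> F" using f(2) by auto
    then have "schur_map lam F ((?r v)(i := c *\<^sub>R f x)) = c *\<^sub>R schur_map lam F ((?r v)(i := f x))"
      by (rule M3[OF r[OF *(1)] *(2)])
    then show "?G (v(i := c *\<^sub>R x)) = c *\<^sub>R ?G (v(i := x))"
      by (simp only: upd[OF *(2)] linear_scale[OF f(1)])
  qed
  have col: "diagram_column lam j \<subseteq> {..<n}" for j
    using diagram_column_subset[of lam j] n by simp
  note om = order_match_in
  have ex: "?r (exchange X Y v) = exchange X Y (?r v)"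
    if Y: "Y \<subseteq> diagram_column lam j'" and X: "X \<in> exchanges lam j Y" for v X Y j j'
  proof -
    have XY: "X \<subseteq> {..<n}" "Y \<subseteq> {..<n}" "card X = card Y"
      using X Y col[of j] col[of j'] by (auto simp: exchanges_def)
    then have fin: "finite X" "finite Y" by (auto intro: finite_subset)
    have "order_match X Y k < n" if "k \<in> X" for k using om[OF that fin] XY by auto
    moreover have "order_match Y X k < n" if "k \<in> Y" for k using om[OF that fin(2,1)] XY by auto
    ultimately show ?thesis using XY by (auto simp: exchange_def fun_eq_iff)
  qed
  have e: "exchange_axioms lam V ?G"
    unfolding exchange_axioms_def n
  proof (intro conjI ballI allI impI)
    fix v j k k' assume *: "v \<in> tuples n V" "k \<in> diagram_column lam j" "k' \<in> diagram_column lam j" "k \<noteq> k'" "v k = v k'"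
    then have "?r v k = ?r v k'" using col[of j] by auto
    then show "?G v = 0" by (rule E1[OF r[OF *(1)] *(2-4)])
  next
    fix v and j j' :: nat and Y assume *: "v \<in> tuples n V" "j < j'" "Y \<subseteq> diagram_column lam j'"
    have "?G v = (\<Sum>X\<in>exchanges lam j Y. schur_map lam F (exchange X Y (?r v)))"
      by (rule E2[OF r[OF *(1)] *(2,3)])
    then show "?G v = (\<Sum>X\<in>exchanges lam j Y. ?G (exchange X Y v))"
      using ex[OF *(3)] by simp
  qed
  have "lin_extend ?G x = quot_map (schur_relations lam F) (lin_extend (\<lambda>v. tab (?r v)) x)" for x
    using linear_quot_map[OF subspace_schur_relations, of lam F]
    by (simp add: lin_extend_def schur_map_def linear_sum linear_scale)
  then show ?thesis
    using lin_extend_schur_map[OF m e, of v] by (simp add: schur_linear_def n)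
qed


section \<open>Approximation by projections of spectrahedra\<close>

text \<open>\<open>\<real>\<^sup>N\<close> is \<open>tuples N UNIV\<close>; only the entries of a matrix with indices below \<open>d\<close> matter.\<close>

definition psd_matrix :: "nat \<Rightarrow> (nat \<Rightarrow> nat \<Rightarrow> real) \<Rightarrow> bool" where
  "psd_matrix d M \<longleftrightarrow> (\<forall>i<d. \<forall>j<d. M i j = M j i) \<and>
     (\<forall>u. 0 \<le> (\<Sum>i<d. \<Sum>j<d. u i * M i j * u j))"

definition spectrahedron :: "nat \<Rightarrow> (nat \<Rightarrow> real) set \<Rightarrow> bool" where
  "spectrahedron N S \<longleftrightarrow>
     (\<exists>d (M0 :: nat \<Rightarrow> nat \<Rightarrow> real) (M :: nat \<Rightarrow> nat \<Rightarrow> nat \<Rightarrow> real).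
        (\<forall>i<d. \<forall>j<d. M0 i j = M0 j i) \<and> (\<forall>l<N. \<forall>i<d. \<forall>j<d. M l i j = M l j i) \<and>
        S = {x \<in> tuples N UNIV. psd_matrix d (\<lambda>i j. M0 i j + (\<Sum>l<N. x l * M l i j))})"

definition projected_spectrahedron :: "nat \<Rightarrow> (nat \<Rightarrow> real) set \<Rightarrow> bool" where
  "projected_spectrahedron r A \<longleftrightarrow>
     (\<exists>s S. spectrahedron (r + s) S \<and> A = (\<lambda>x. restrict x {..<r}) ` S)"

text \<open>\<open>poly_function n k a\<close>: \<open>a\<close> is a polynomial on \<open>V\<^sup>n\<close> of degree at most \<open>k\<close>.\<close>

inductive poly_function :: "nat \<Rightarrow> nat \<Rightarrow> ((nat \<Rightarrow> 'v::real_vector) \<Rightarrow> real) \<Rightarrow> bool"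
  for n :: nat where
  const: "poly_function n k (\<lambda>_. c)"
| coord: "linear f \<Longrightarrow> i < n \<Longrightarrow> poly_function n (Suc k) (\<lambda>v. f (v i))"
| add: "poly_function n k p \<Longrightarrow> poly_function n k q \<Longrightarrow> poly_function n k (\<lambda>v. p v + q v)"
| mult: "poly_function n j p \<Longrightarrow> poly_function n k q \<Longrightarrow>
           poly_function n (j + k) (\<lambda>v. p v * q v)"

text \<open>
  The measures on \<open>P\<close> supported on \<open>P\<close>.  The underlying space is \<open>P\<close> itself, so that integrals over
  the product measure are integrals over \<open>P\<^sup>n\<close>.
\<close>

definition supported_measure :: "'v::real_normed_vector set \<Rightarrow> 'v measure \<Rightarrow> bool" where
  "supported_measure P mP \<longleftrightarrow> sets mP = sets (restrict_space borel P) \<and> finite_measure mP \<and>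
     (\<forall>x\<in>P. \<forall>U. open U \<and> x \<in> U \<longrightarrow> emeasure mP (U \<inter> P) > 0)"

text \<open>Lebesgue measure on the space with basis \<open>b 0, \<dots>, b (m - 1)\<close>, restricted to \<open>P\<close>.\<close>

definition lebesgue_restricted ::
  "nat \<Rightarrow> (nat \<Rightarrow> 'v::real_normed_vector) \<Rightarrow> 'v set \<Rightarrow> 'v measure" where
  "lebesgue_restricted m b P =
     restrict_space (distr (PiM {..<m} (\<lambda>_. lborel)) borel (\<lambda>c. \<Sum>i<m. c i *\<^sub>R b i)) P"

definition approx_Q ::
  "nat \<Rightarrow> nat \<Rightarrow> (nat \<Rightarrow> (nat \<Rightarrow> 'v::real_vector) \<Rightarrow> real) \<Rightarrow> 'v measure \<Rightarrow> nat \<Rightarrow> (nat \<Rightarrow> real) set" where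
  "approx_Q n r T mP k =
     {l \<in> tuples r UNIV. \<forall>a. poly_function n k a \<longrightarrow>
        0 \<le> (\<integral>x. (1 + (\<Sum>i<r. l i * T i x)) * (a x)\<^sup>2 \<partial>(PiM {..<n} (\<lambda>_. mP)))}"

definition polar :: "nat \<Rightarrow> (nat \<Rightarrow> real) set \<Rightarrow> (nat \<Rightarrow> real) set" where
  "polar r Q = {y \<in> tuples r UNIV. \<forall>l\<in>Q. (\<Sum>i<r. l i * y i) \<ge> -1}"

text \<open>
  A basis \<open>b\<close> of the Schur module provides the identification with \<open>\<real>\<^sup>r\<close>; the components of
  \<open>schur_map lam V\<close> are its coefficients with respect to \<open>b\<close>.
\<close>

definition accurate_scheme ::
  "nat list \<Rightarrow> 'v::real_normed_vector set \<Rightarrow> 'v set \<Rightarrow> 'v measure \<Rightarrow>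
     nat \<Rightarrow> (nat \<Rightarrow> 'v formal_sum) \<Rightarrow> bool" where
  "accurate_scheme lam V P mP r b \<longleftrightarrow>
     (let T = (\<lambda>i v. representation (b ` {..<r}) (schur_map lam V v) (b i));
          Qp = (\<lambda>k. polar r (approx_Q (sum_list lam) r T mP k))
      in (\<forall>k. projected_spectrahedron r (Qp k)) \<and> incseq Qp \<and>
         schur_body lam V P = closure (\<Union>k. (\<lambda>y. \<Sum>i<r. y i *\<^sub>R b i) ` Qp k))"

end

theory Submission
  imports Defs
begin

text \<open>
  Write \<open>h\<close> for the universal map \<open>schur_map lam V\<close>, \<open>M\<close> for the Schur module and \<open>S\<close> for
  the Schur body.

  Parts (1), (2) and (4) are consequences of the universal property: \<open>S\<close> is the convex hull of the image of
  \<open>P\<^sup>n\<close> under \<open>h\<close>, so a linear map of Schur modules sends bodies to bodies as soon as it does so on generators,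
  and it is determined by its values there.  For (4), \<open>P\<close> is the convex hull of its extreme points by Minkowski's
  theorem (\<open>minkowski_fin_dim\<close>), and a multilinear map can be expanded in one entry after the other
  (\<open>multilinear_convex_hull\<close>).  Symmetry in (3) holds because swapping two boxes of the first column changes the sign
  of \<open>h\<close>.  Compactness of \<open>S\<close> is continuity of \<open>h\<close> on a finite-dimensional space together with Caratheodory's
  theorem (\<open>compact_convex_hull_fin_dim\<close>).

  The dimension in (3) is the classical basis theorem for Schur modules.  The semistandard tableaux span \<open>M\<close> by
  straightening (\<open>straightening\<close>): a filling with a descent in a row is rewritten by exchanging the top part of the
  right column, which pushes large entries to the right.  They are independent (\<open>tableaux_independent\<close>), because the
  products of minors of a matrix \<open>z\<close>, one for each column of the diagram, satisfy the exchange axioms.  For the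
  exchange of one box this is Cramer's rule, and the exchange of several boxes follows by induction from alternation in
  the columns (\<open>sum_swap_along\<close>).  Substituting suitable powers of one variable for the entries of \<open>z\<close>, one
  obtains for each semistandard tableau a polynomial whose degree determines the tableau.

  Part (5) rests on the facts that the components of \<open>h\<close> are polynomials and that non-empty open subsets of
  the compact set \<open>P\<^sup>n\<close> have positive measure.  The Gram matrix of a basis of the polynomials of degree at most \<open>k\<close> on
  \<open>P\<^sup>n\<close> is then positive definite, so that the moment vectors of normalised squares form a compact set, whose convex
  hull is a linear image of positive semidefinite matrices of bounded trace.  By separation this is the polar of
  \<open>approx_Q\<close> (\<open>polar_projected_spectrahedron\<close>).  Accuracy (\<open>body_eq_closure\<close>) amounts to the fact that a polynomial \<open>g\<close>
  whose integrals against all squares are non-negative is itself non-negative on \<open>P\<^sup>n\<close>: otherwise the squares of high powers of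
  \<open>c - g\<close>, for a large constant \<open>c\<close>, would give a negative integral.
\<close>

section \<open>Finite-dimensional subspaces of normed spaces\<close>

lemma compact_tuples:
  assumes "compact (P :: 'v::topological_space set)"
  shows "compact (tuples n P)"
proof -
  let ?S = "\<lambda>i. if i < n then P else {undefined}"
  have "tuples n P = PiE UNIV ?S"
  proof (intro set_eqI iffI)
    fix v assume "v \<in> PiE UNIV ?S"
    then have "v i \<in> ?S i" for i by (rule PiE_mem) simp
    then have v: "(i < n \<longrightarrow> v i \<in> P) \<and> (\<not> i < n \<longrightarrow> v i = undefined)" for i
      by (cases "i < n") (metis (full_types), metis (full_types) singletonD)
    show "v \<in> tuples n P" using v by (intro PiE_I) auto
  qed (auto simp: PiE_iff extensional_def)
  moreover have "compactin (product_topology (\<lambda>i. euclidean) UNIV) (PiE UNIV ?S)"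
    by (subst compactin_PiE) (use assms in auto)
  ultimately show ?thesis by (simp add: euclidean_product_topology)
qed

lemma continuous_on_coordinate [continuous_intros]:
  "continuous_on S (\<lambda>c. c i :: 'b::topological_space)"
  by (rule continuous_on_subset[OF continuous_on_product_coordinates]) simp

lemma basis_of_dual:
  assumes "basis_of r b V"
  obtains f :: "nat \<Rightarrow> 'v::real_vector \<Rightarrow> real"
  where "\<And>i. linear (f i)"
    and "\<And>i j. i < r \<Longrightarrow> j < r \<Longrightarrow> f i (b j) = (if i = j then 1 else 0)"
    and "\<And>x. x \<in> V \<Longrightarrow> (\<Sum>i<r. f i x *\<^sub>R b i) = x"
    and "\<And>i x. i < r \<Longrightarrow> x \<in> V \<Longrightarrow> representation (b ` {..<r}) x (b i) = f i x"
proof -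
  have inj: "inj_on b {..<r}" and ind: "independent (b ` {..<r})" and sp: "span (b ` {..<r}) = V"
    using assms by (auto simp: basis_of_def)
  have "\<exists>g :: 'v \<Rightarrow> real. linear g \<and> (\<forall>x\<in>b ` {..<r}. g x = (if x = b i then 1 else 0))" for i
    by (rule linear_independent_extend[OF ind])
  then obtain f :: "nat \<Rightarrow> 'v \<Rightarrow> real" where f: "\<And>i. linear (f i)"
    "\<And>i x. x \<in> b ` {..<r} \<Longrightarrow> f i x = (if x = b i then 1 else 0)"
    by metis
  have del: "f i (b j) = (if i = j then 1 else 0)" if "i < r" "j < r" for i j
    using that f(2)[of "b j" i] inj by (auto simp: inj_on_def)
  have rep: "representation (b ` {..<r}) x (b i) = f i x" if "i < r" "x \<in> V" for i x
  proof -
    have "x = (\<Sum>y\<in>b ` {..<r}. representation (b ` {..<r}) x y *\<^sub>R y)"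
      using sum_representation_eq[OF ind, of x "b ` {..<r}"] that sp by simp
    also have "\<dots> = (\<Sum>j<r. representation (b ` {..<r}) x (b j) *\<^sub>R b j)"
      using inj by (simp add: sum.reindex)
    finally have "f i x = f i (\<Sum>j<r. representation (b ` {..<r}) x (b j) *\<^sub>R b j)" by simp
    also have "\<dots> = (\<Sum>j<r. representation (b ` {..<r}) x (b j) * f i (b j))"
      using f(1)[of i] by (simp add: linear_sum linear_scale)
    also have "\<dots> = (\<Sum>j<r. if j = i then representation (b ` {..<r}) x (b j) else 0)"
      using that del by (intro sum.cong) auto
    finally show ?thesis using that by simp
  qed
  have "(\<Sum>i<r. f i x *\<^sub>R b i) = x" if "x \<in> V" for x
  proof -
    have "x = (\<Sum>y\<in>b ` {..<r}. representation (b ` {..<r}) x y *\<^sub>R y)"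
      using sum_representation_eq[OF ind, of x "b ` {..<r}"] that sp by simp
    also have "\<dots> = (\<Sum>j<r. representation (b ` {..<r}) x (b j) *\<^sub>R b j)"
      using inj by (simp add: sum.reindex)
    finally show ?thesis using rep[OF _ that] by simp
  qed
  then show thesis using that f(1) del rep by blast
qed

lemma dual_sum:
  fixes r :: nat
  assumes "\<And>i. linear (f i)" "\<And>i j. i < r \<Longrightarrow> j < r \<Longrightarrow> f i (b j) = (if i = j then 1 else 0 :: real)" "i < r"
  shows "f i (\<Sum>j<r. c j *\<^sub>R b j) = c i"
proof -
  have "f i (\<Sum>j<r. c j *\<^sub>R b j) = (\<Sum>j<r. c j * f i (b j))"
    by (simp add: linear_sum[OF assms(1)] linear_scale[OF assms(1)])
  also have "\<dots> = (\<Sum>j<r. if j = i then c j else 0)"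
    by (rule sum.cong) (auto simp: assms(2)[OF assms(3)])
  finally show ?thesis using \<open>i < r\<close> by simp
qed

lemma basis_of_sum_in: "basis_of r b V \<Longrightarrow> (\<Sum>i<r. c i *\<^sub>R b i) \<in> V"
  unfolding basis_of_def by (metis (no_types, lifting) imageI span_base span_scale span_sum)

lemma basis_of_exists_in:
  assumes V: "fin_dim (V :: 'v::real_vector set)" and P: "span P = V"
  obtains b where "basis_of (dim V) b V" "\<And>i. i < dim V \<Longrightarrow> b i \<in> P"
proof -
  obtain F where F: "finite F" "V = span F" using V by (auto simp: fin_dim_def)
  obtain B where B: "B \<subseteq> P" "independent B" "P \<subseteq> span B"
    using real_vector.maximal_independent_subset by blast
  have BV: "B \<subseteq> V" using B(1) P span_superset by blast
  then have "finite B" using independent_span_bound[OF F(1) B(2)] F(2) by simp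
  have "span P \<subseteq> span B" using B(3) by (simp add: span_minimal)
  then have sp: "span B = V" using P BV F(2) by (metis span_minimal subspace_span subset_antisym)
  then have "card B = dim V" using B(2) by (metis dim_eq_card dim_span)
  then obtain b where b: "bij_betw b {..<dim V} B"
    using ex_bij_betw_nat_finite[OF \<open>finite B\<close>] by (auto simp: atLeast0LessThan)
  have bas: "basis_of (dim V) b V" using b B(2) sp by (auto simp: basis_of_def bij_betw_def)
  have "b i \<in> P" if "i < dim V" for i using b B(1) that by (auto simp: bij_betw_def)
  then show thesis by (rule that[OF bas])
qed

lemma basis_of_exists:
  assumes "fin_dim V"
  obtains b where "basis_of (dim V) b V"
proof -
  have "span V = V" using assms by (auto simp: fin_dim_def)
  then show thesis using basis_of_exists_in[OF assms] that by metis
qed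

lemma basis_of_fin_dim: "basis_of r b V \<Longrightarrow> fin_dim V"
  unfolding basis_of_def fin_dim_def by (metis finite_imageI finite_lessThan)

lemma fin_dim_subspace: "fin_dim V \<Longrightarrow> subspace V"
  by (auto simp: fin_dim_def)

text \<open>A continuous positive homogeneous function is bounded below on the (compact) unit sphere of
  the maximum norm, hence everywhere.\<close>

lemma homogeneous_lower_bound:
  fixes N :: "(nat \<Rightarrow> real) \<Rightarrow> real"
  assumes cont: "continuous_on (tuples r UNIV) N"
    and hom: "\<And>c t. c \<in> tuples r UNIV \<Longrightarrow> N (\<lambda>i\<in>{..<r}. t * c i) = \<bar>t\<bar> ^ p * N c"
    and pos: "\<And>c i. c \<in> tuples r UNIV \<Longrightarrow> i < r \<Longrightarrow> c i \<noteq> 0 \<Longrightarrow> N c > 0"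
    and p: "p > 0"
  obtains \<delta> where "\<delta> > 0" "\<And>c i. c \<in> tuples r UNIV \<Longrightarrow> i < r \<Longrightarrow> \<delta> * \<bar>c i\<bar> ^ p \<le> N c"
proof (cases "r = 0")
  case True then show thesis using that[of 1] by simp
next
  case False
  define S where "S = (\<Union>i<r. tuples r {-1..1} \<inter> {c. \<bar>c i\<bar> = (1::real)})"
  have "closed {c :: nat \<Rightarrow> real. \<bar>c i\<bar> = 1}" for i
    by (intro closed_Collect_eq continuous_intros)
  then have S: "compact S" unfolding S_def
    by (intro compact_UN compact_Int_closed compact_tuples) auto
  have sub: "S \<subseteq> tuples r UNIV" by (auto simp: S_def PiE_iff)
  have "(\<lambda>i\<in>{..<r}. 1) \<in> S" using False by (auto simp: S_def)
  then have "S \<noteq> {}" by auto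
  then obtain c0 where c0: "c0 \<in> S" "\<And>c. c \<in> S \<Longrightarrow> N c0 \<le> N c"
    using continuous_attains_inf[OF S _ continuous_on_subset[OF cont sub]] by blast
  obtain i0 where "i0 < r" "c0 i0 \<noteq> 0" using c0(1) by (auto simp: S_def)
  then have "N c0 > 0" using pos c0(1) sub by blast
  moreover have "N c0 * \<bar>c i\<bar> ^ p \<le> N c" if c: "c \<in> tuples r UNIV" and i: "i < r" for c i
  proof -
    define M where "M = Max ((\<lambda>i. \<bar>c i\<bar>) ` {..<r})"
    have "M \<in> (\<lambda>i. \<bar>c i\<bar>) ` {..<r}" unfolding M_def using False by (intro Max_in) auto
    then obtain i1 where i1: "i1 < r" "M = \<bar>c i1\<bar>" by auto
    have M: "\<bar>c j\<bar> \<le> M" if "j < r" for j unfolding M_def using that by (intro Max_ge) auto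
    show ?thesis
    proof (cases "M = 0")
      case True
      have "c = (\<lambda>i\<in>{..<r}. 0 * c i)" using M c True by (auto simp: fun_eq_iff PiE_iff extensional_def)
      then have "N c = 0" using hom[OF c, of 0] p by (simp add: zero_power)
      moreover have "c i = 0" using M[OF i] True by simp
      ultimately show ?thesis using p by (simp add: zero_power)
    next
      case False
      then have M0: "M > 0" using i1 by simp
      let ?c = "\<lambda>i\<in>{..<r}. inverse M * c i"
      have "\<bar>inverse M * c j\<bar> \<le> 1" if "j < r" for j
        using M[OF that] M0 by (simp add: abs_mult field_simps)
      then have "-1 \<le> inverse M * c j \<and> inverse M * c j \<le> 1" if "j < r" for j
        using that by (simp add: abs_le_iff) 
      moreover have "\<bar>inverse M * c i1\<bar> = 1" using i1 M0 by (simp add: abs_mult field_simps)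
      ultimately have "?c \<in> S" using i1(1) unfolding S_def
        by (intro UN_I[of i1]) auto
      then have "N c0 \<le> N ?c" by (rule c0(2))
      also have "N ?c = inverse M ^ p * N c" using hom[OF c, of "inverse M"] M0 by simp
      finally have "N c0 * M ^ p \<le> N c" using M0 by (simp add: field_simps power_inverse)
      moreover have "N c0 * \<bar>c i\<bar> ^ p \<le> N c0 * M ^ p"
        using \<open>N c0 > 0\<close> M[OF i] by (intro mult_left_mono power_mono) auto
      ultimately show ?thesis by simp
    qed
  qed
  ultimately show thesis using that by blast
qed

lemma linear_bounded_on_fin_dim:
  fixes f :: "'v::real_normed_vector \<Rightarrow> 'w::real_normed_vector"
  assumes V: "fin_dim V" and f: "linear f"
  obtains C where "C \<ge> 0" "\<And>x. x \<in> V \<Longrightarrow> norm (f x) \<le> C * norm x"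
proof -
  obtain b where b: "basis_of (dim V) b V" using basis_of_exists[OF V] .
  define r where "r = dim V"
  have b: "basis_of r b V" using b by (simp add: r_def)
  obtain g where g: "\<And>i. linear (g i)"
    "\<And>i j. i < r \<Longrightarrow> j < r \<Longrightarrow> g i (b j) = (if i = j then 1 else 0)"
    "\<And>x. x \<in> V \<Longrightarrow> (\<Sum>i<r. g i x *\<^sub>R b i) = x"
    by (rule basis_of_dual[OF b]) (rule that)
  define N where "N = (\<lambda>c. norm (\<Sum>i<r. c i *\<^sub>R b i))"
  have N1: "continuous_on (tuples r UNIV) N" unfolding N_def by (intro continuous_intros)
  have N2: "N (\<lambda>i\<in>{..<r}. t * c i) = \<bar>t\<bar> ^ 1 * N c" for c t
  proof -
    have "(\<Sum>i<r. (\<lambda>i\<in>{..<r}. t * c i) i *\<^sub>R b i) = t *\<^sub>R (\<Sum>i<r. c i *\<^sub>R b i)"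
      by (simp add: scaleR_sum_right)
    then show ?thesis by (simp add: N_def)
  qed
  have N3: "N c > 0" if "i < r" "c i \<noteq> 0" for c i
  proof -
    have "g i (\<Sum>i<r. c i *\<^sub>R b i) \<noteq> 0" using dual_sum[of g r b i c] g that by simp
    then show ?thesis using linear_0[OF g(1)[of i]] by (auto simp: N_def)
  qed
  obtain \<delta> where \<delta>: "\<delta> > 0" "\<And>c i. c \<in> tuples r UNIV \<Longrightarrow> i < r \<Longrightarrow> \<delta> * \<bar>c i\<bar> ^ 1 \<le> N c"
    by (rule homogeneous_lower_bound[OF N1 N2 N3 zero_less_one]) auto
  have bd: "\<bar>g i x\<bar> \<le> norm x / \<delta>" if "i < r" "x \<in> V" for i x
  proof -
    have "\<delta> * \<bar>(\<lambda>i\<in>{..<r}. g i x) i\<bar> \<le> N (\<lambda>i\<in>{..<r}. g i x)" using \<delta>(2)[of "\<lambda>i\<in>{..<r}. g i x" i] that by simp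
    also have "N (\<lambda>i\<in>{..<r}. g i x) = norm x" using g(3)[OF that(2)] by (simp add: N_def)
    finally show ?thesis using that \<delta>(1) by (simp add: field_simps)
  qed
  show thesis
  proof (rule that)
    show "(\<Sum>i<r. norm (f (b i)) / \<delta>) \<ge> 0" using \<delta> by (intro sum_nonneg) auto
    fix x assume x: "x \<in> V"
    have "f x = f (\<Sum>i<r. g i x *\<^sub>R b i)" using g(3)[OF x] by simp
    also have "\<dots> = (\<Sum>i<r. g i x *\<^sub>R f (b i))" using f by (simp add: linear_sum linear_scale)
    finally have "norm (f x) \<le> (\<Sum>i<r. \<bar>g i x\<bar> * norm (f (b i)))"
      using norm_sum[of "\<lambda>i. g i x *\<^sub>R f (b i)" "{..<r}"] by simp
    also have "\<dots> \<le> (\<Sum>i<r. norm x / \<delta> * norm (f (b i)))"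
      using bd x by (intro sum_mono mult_right_mono) auto
    also have "\<dots> = (\<Sum>i<r. norm (f (b i)) / \<delta>) * norm x" by (simp add: sum_distrib_left sum_distrib_right mult_ac)
    finally show "norm (f x) \<le> (\<Sum>i<r. norm (f (b i)) / \<delta>) * norm x" .
  qed
qed

lemma linear_continuous_on_fin_dim:
  fixes f :: "'v::real_normed_vector \<Rightarrow> 'w::real_normed_vector"
  assumes V: "fin_dim V" and f: "linear f"
  shows "continuous_on V f"
proof -
  obtain C where C: "C \<ge> 0" "\<And>x. x \<in> V \<Longrightarrow> norm (f x) \<le> C * norm x"
    using linear_bounded_on_fin_dim[OF assms] by metis
  have "C-lipschitz_on V f"
  proof (rule lipschitz_onI)
    fix x y assume "x \<in> V" "y \<in> V"
    then have "x - y \<in> V" using fin_dim_subspace[OF V] by (simp add: subspace_diff)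
    from C(2)[OF this] show "dist (f x) (f y) \<le> C * dist x y"
      by (simp add: dist_norm linear_diff[OF f])
  qed (use C in auto)
  then show ?thesis by (rule lipschitz_on_continuous_on)
qed

lemma independent_card_le_fin_dim:
  assumes "fin_dim V" "independent B" "B \<subseteq> V"
  shows "finite B" "card B \<le> dim V"
proof -
  obtain b where b: "basis_of (dim V) b V" using basis_of_exists[OF assms(1)] .
  then have "B \<subseteq> span (b ` {..<dim V})" "card (b ` {..<dim V}) = dim V"
    using assms by (auto simp: basis_of_def card_image)
  with independent_span_bound[OF _ assms(2), of "b ` {..<dim V}"]
  show "finite B" "card B \<le> dim V" by auto
qed

text \<open>Caratheodory's theorem.  A convex combination of more than \<open>dim V + 1\<close> points involves an affine dependency, along which one of the
  coefficients can be moved to zero.\<close>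

lemma caratheodory_fin_dim:
  assumes V: "fin_dim (V :: 'v::real_vector set)" and K: "K \<subseteq> V" and y: "y \<in> convex hull K"
  obtains S where "finite S" "S \<subseteq> K" "card S \<le> dim V + 1" "y \<in> convex hull S"
proof -
  define P where "P = (\<lambda>n. \<exists>S. finite S \<and> S \<subseteq> K \<and> card S = n \<and> y \<in> convex hull S)"
  have "\<exists>n. P n"
  proof -
    obtain S u where "finite S" "S \<subseteq> K" "\<forall>x\<in>S. 0 \<le> u x" "sum u S = 1" "(\<Sum>v\<in>S. u v *\<^sub>R v) = y"
      using y unfolding convex_hull_explicit by auto
    then have "y \<in> convex hull S" by (auto simp: convex_hull_finite)
    then show ?thesis unfolding P_def using \<open>finite S\<close> \<open>S \<subseteq> K\<close> by blast
  qed
  define n where "n = (LEAST n. P n)"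
  have Pn: "P n" unfolding n_def using \<open>\<exists>n. P n\<close> by (rule LeastI_ex)
  have small: "\<not> P k" if "k < n" for k using that unfolding n_def by (rule not_less_Least)
  obtain S where S: "finite S" "S \<subseteq> K" "card S = n" "y \<in> convex hull S"
    using Pn by (auto simp: P_def)
  have "card S \<le> dim V + 1"
  proof (rule ccontr)
    assume big: "\<not> card S \<le> dim V + 1"
    then obtain s0 where s0: "s0 \<in> S" by fastforce
    have sV: "subspace V" using V by (rule fin_dim_subspace)
    have "affine_dependent S"
    proof (rule ccontr)
      assume "\<not> affine_dependent S"
      then have "independent ((\<lambda>x. -s0 + x) ` (S - {s0}))"
        using affine_dependent_iff_dependent2[OF s0] by simp
      moreover have "(\<lambda>x. -s0 + x) ` (S - {s0}) \<subseteq> V"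
      proof (rule image_subsetI)
        fix x assume "x \<in> S - {s0}"
        then have "x - s0 \<in> V" using s0 S(2) K by (intro subspace_diff[OF sV]) auto
        then show "- s0 + x \<in> V" by simp
      qed
      ultimately have "card ((\<lambda>x. -s0 + x) ` (S - {s0})) \<le> dim V"
        using independent_card_le_fin_dim[OF V] by blast
      then have "card (S - {s0}) \<le> dim V" by (subst (asm) card_image) auto
      then show False using big s0 S(1) by (simp add: card_Diff_singleton)
    qed
    then obtain w v where wv: "sum w S = 0" "v \<in> S" "w v \<noteq> 0" "(\<Sum>v\<in>S. w v *\<^sub>R v) = 0"
      using affine_dependent_explicit_finite[OF S(1)] by auto
    obtain u where u: "\<forall>x\<in>S. 0 \<le> u x" "sum u S = 1" "(\<Sum>v\<in>S. u v *\<^sub>R v) = y"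
      using S(4) by (auto simp: convex_hull_finite[OF S(1)])
    have neg: "{v\<in>S. w v < 0} \<noteq> {}"
      using sum_pos2[OF S(1) wv(2), of w] wv by force
    obtain a where a: "a \<in> S" "w a < 0" "\<And>v. v \<in> S \<Longrightarrow> w v < 0 \<Longrightarrow> u a / (- w a) \<le> u v / (- w v)"
    proof -
      have "finite {v\<in>S. w v < 0}" using S(1) by simp
      from arg_min_if_finite[OF this neg, of "\<lambda>v. u v / (- w v)"] that show ?thesis
        by (metis (mono_tags, lifting) mem_Collect_eq not_less)
    qed
    define t where "t = u a / (- w a)"
    have t0: "t \<ge> 0" using u(1) a(1,2) by (auto simp: t_def divide_le_0_iff)
    have nonneg: "0 \<le> u v + t * w v" if v: "v \<in> S" for v
    proof (cases "w v < 0")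
      case True
      then have "t \<le> u v / (- w v)" using a(3)[OF v] by (simp add: t_def)
      then show ?thesis using True by (simp add: field_simps)
    qed (use t0 u v in auto)
    have az: "u a + t * w a = 0" using a(2) by (simp add: t_def)
    have "sum (\<lambda>v. u v + t * w v) (S - {a}) = 1"
      using sum.remove[OF S(1) a(1), of "\<lambda>v. u v + t * w v"] az u(2) wv(1)
      by (simp add: sum.distrib sum_distrib_left[symmetric])
    moreover have "(\<Sum>v\<in>S - {a}. (u v + t * w v) *\<^sub>R v) = y"
    proof -
      have "(\<Sum>v\<in>S. (u v + t * w v) *\<^sub>R v) = (\<Sum>v\<in>S. u v *\<^sub>R v) + t *\<^sub>R (\<Sum>v\<in>S. w v *\<^sub>R v)"
        by (simp add: scaleR_left_distrib sum.distrib scaleR_sum_right)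
      then show ?thesis
        using sum.remove[OF S(1) a(1), of "\<lambda>v. (u v + t * w v) *\<^sub>R v"] az u(3) wv(4) by simp
    qed
    ultimately have "y \<in> convex hull (S - {a})"
      unfolding convex_hull_finite[OF finite_Diff[OF S(1)]]
      using nonneg by (intro CollectI exI[of _ "\<lambda>v. u v + t * w v"]) auto
    then have "P (card (S - {a}))" unfolding P_def using S by blast
    moreover have "card (S - {a}) < n" using S(1,3) a(1) by (metis card_Diff1_less)
    ultimately show False using small by blast
  qed
  then show thesis using that S by blast
qed

text \<open>By Caratheodory's theorem the convex hull is reached after finitely many steps, in each of which a compact
  set is joined to \<open>K\<close> by segments.\<close>

lemma compact_convex_hull_fin_dim:
  fixes K :: "'v::real_normed_vector set"
  assumes V: "fin_dim V" and K: "K \<subseteq> V" "compact K"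
  shows "compact (convex hull K)"
proof -
  define C where "C = rec_nat K (\<lambda>_ A. {(1 - u) *\<^sub>R x + u *\<^sub>R y | x y u. 0 \<le> u \<and> u \<le> 1 \<and> x \<in> K \<and> y \<in> A})"
  have C0: "C 0 = K" by (simp add: C_def)
  have CS: "C (Suc k) = {(1 - u) *\<^sub>R x + u *\<^sub>R y | x y u. 0 \<le> u \<and> u \<le> 1 \<and> x \<in> K \<and> y \<in> C k}" for k
    by (simp add: C_def)
  have comp: "compact (C k)" for k
  proof (induction k)
    case (Suc k)
    show ?case unfolding CS by (rule compact_convex_combinations[OF K(2) Suc])
  qed (simp add: C0 K)
  have sub: "C k \<subseteq> convex hull K" for k
  proof (induction k)
    case (Suc k)
    show ?case unfolding CS
    proof safe
      fix u :: real and x y assume "0 \<le> u" "u \<le> 1" "x \<in> K" "y \<in> C k"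
      then show "(1 - u) *\<^sub>R x + u *\<^sub>R y \<in> convex hull K"
        using Suc hull_inc[of x K] by (intro convexD[OF convex_convex_hull]) auto
    qed
  qed (simp add: C0 hull_subset)
  have mono: "C k \<subseteq> C (Suc k)" for k
  proof (cases "K = {}")
    case True
    have "C k = {}" using sub[of k] True by simp
    then show ?thesis by simp
  next
    case False
    then obtain x where "x \<in> K" by auto
    then show ?thesis unfolding CS by (fastforce intro: exI[of _ 1])
  qed
  then have mono: "C i \<subseteq> C j" if "i \<le> j" for i j using that lift_Suc_mono_le[of C] by blast
  have sup: "convex hull S \<subseteq> C k" if "finite S" "S \<subseteq> K" "card S \<le> Suc k" for S k
    using that
  proof (induction S arbitrary: k rule: finite_induct)
    case empty then show ?case by simp
  next
    case (insert a S)
    show ?case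
    proof (cases "S = {}")
      case True
      then have "convex hull insert a S \<subseteq> C 0" using insert by (simp add: C0)
      then show ?thesis using mono[of 0 k] by auto
    next
      case False
      then obtain l where l: "k = Suc l" using insert by (cases k) auto
      have hl: "convex hull S \<subseteq> C l" using insert l by auto
      have aK: "a \<in> K" using insert.prems by auto
      show ?thesis
      proof
        fix x assume "x \<in> convex hull insert a S"
        then obtain u v b where x: "u \<ge> 0" "v \<ge> 0" "u + v = 1" "b \<in> convex hull S" "x = u *\<^sub>R a + v *\<^sub>R b"
          unfolding convex_hull_insert[OF False] by auto
        then have "x = (1 - v) *\<^sub>R a + v *\<^sub>R b" "v \<le> 1" by (auto simp: eq_diff_eq[symmetric])
        then show "x \<in> C k" unfolding l CS using x hl aK by blast
      qed
    qed
  qed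
  have "convex hull K = C (dim V)"
  proof
    show "convex hull K \<subseteq> C (dim V)"
    proof
      fix y assume "y \<in> convex hull K"
      then obtain S where "finite S" "S \<subseteq> K" "card S \<le> dim V + 1" "y \<in> convex hull S"
        using caratheodory_fin_dim[OF V K(1)] by metis
      then show "y \<in> C (dim V)" using sup[of S "dim V"] by auto
    qed
  qed (rule sub)
  then show ?thesis using comp by simp
qed

text \<open>Minkowski's theorem, by induction on the dimension of the smallest face containing a point \<open>x\<close>.  The directions
  of this face are those in which \<open>x\<close> can be moved both ways inside \<open>P\<close>.  A line through \<open>x\<close> in such a
  direction leaves \<open>P\<close> in two points with smaller faces, and \<open>x\<close> lies between them.\<close>

lemma minkowski_fin_dim:
  fixes P :: "'v::real_normed_vector set"
  assumes V: "fin_dim V" and P: "P \<subseteq> V" "compact P" "convex P"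
  shows "P = convex hull {x. x extreme_point_of P}"
proof
  let ?E = "{x. x extreme_point_of P}"
  have sV: "subspace V" using V by (rule fin_dim_subspace)
  show "convex hull ?E \<subseteq> P"
    using P(3) by (intro hull_minimal) (auto simp: extreme_point_of_def)
  define L where "L x = {d. \<exists>\<epsilon>>0. x + \<epsilon> *\<^sub>R d \<in> P \<and> x - \<epsilon> *\<^sub>R d \<in> P}" for x
  have Lsmall: "x + s *\<^sub>R d \<in> P" if "x + \<epsilon> *\<^sub>R d \<in> P" "x - \<epsilon> *\<^sub>R d \<in> P" "\<bar>s\<bar> \<le> \<epsilon>" "\<epsilon> > 0" for x d \<epsilon> s
  proof -
    have "x + s *\<^sub>R d = ((1 + s/\<epsilon>)/2) *\<^sub>R (x + \<epsilon> *\<^sub>R d) + ((1 - s/\<epsilon>)/2) *\<^sub>R (x - \<epsilon> *\<^sub>R d)"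
    proof -
      have "((1 + s/\<epsilon>)/2) *\<^sub>R (x + \<epsilon> *\<^sub>R d) + ((1 - s/\<epsilon>)/2) *\<^sub>R (x - \<epsilon> *\<^sub>R d) =
        ((1 + s/\<epsilon>)/2 + (1 - s/\<epsilon>)/2) *\<^sub>R x + (((1 + s/\<epsilon>)/2) * \<epsilon> - ((1 - s/\<epsilon>)/2) * \<epsilon>) *\<^sub>R d"
        by (simp only: scaleR_add_right scaleR_diff_right scaleR_add_left scaleR_diff_left scaleR_scaleR) simp
      also have "(1 + s/\<epsilon>)/2 + (1 - s/\<epsilon>)/2 = 1" by (simp add: field_simps)
      also have "((1 + s/\<epsilon>)/2) * \<epsilon> - ((1 - s/\<epsilon>)/2) * \<epsilon> = s" using that by (simp add: field_simps)
      finally show ?thesis by simp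
    qed
    moreover have "0 \<le> (1 + s/\<epsilon>)/2" "0 \<le> (1 - s/\<epsilon>)/2" "(1 + s/\<epsilon>)/2 + (1 - s/\<epsilon>)/2 = 1"
      using that by (auto simp: field_simps abs_le_iff)
    ultimately show ?thesis using convexD[OF P(3) that(1,2)] by simp
  qed
  have Lspace: "subspace (L x)" if x: "x \<in> P" for x
  proof (rule subspaceI)
    show "0 \<in> L x" using x by (auto simp: L_def intro: exI[of _ 1])
  next
    fix d e assume "d \<in> L x" "e \<in> L x"
    then obtain p q where p: "p > 0" "x + p *\<^sub>R d \<in> P" "x - p *\<^sub>R d \<in> P"
      and q: "q > 0" "x + q *\<^sub>R e \<in> P" "x - q *\<^sub>R e \<in> P" by (auto simp: L_def)
    define s where "s = min p q"
    have s: "s > 0" "s \<le> p" "s \<le> q" using p q by (auto simp: s_def)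
    have d: "x + s *\<^sub>R d \<in> P" "x - s *\<^sub>R d \<in> P"
      using Lsmall[OF p(2,3), of s] Lsmall[OF p(2,3), of "-s"] s p by auto
    have e: "x + s *\<^sub>R e \<in> P" "x - s *\<^sub>R e \<in> P"
      using Lsmall[OF q(2,3), of s] Lsmall[OF q(2,3), of "-s"] s q by auto
    have h: "(1/2) *\<^sub>R a + (1/2) *\<^sub>R b \<in> P" if "a \<in> P" "b \<in> P" for a b
      using convexD[OF P(3) that, of "1/2" "1/2"] by simp
    have hx: "(1/2) *\<^sub>R x + (1/2) *\<^sub>R x = x" by (metis real_scaleR_def scaleR_left_distrib field_sum_of_halves scaleR_one)
    have "x + (s/2) *\<^sub>R (d + e) = (1/2) *\<^sub>R (x + s *\<^sub>R d) + (1/2) *\<^sub>R (x + s *\<^sub>R e)"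
      "x - (s/2) *\<^sub>R (d + e) = (1/2) *\<^sub>R (x - s *\<^sub>R d) + (1/2) *\<^sub>R (x - s *\<^sub>R e)"
      by (subst (1) hx[symmetric], simp add: scaleR_add_right scaleR_diff_right algebra_simps)+
    then have "x + (s/2) *\<^sub>R (d + e) \<in> P" "x - (s/2) *\<^sub>R (d + e) \<in> P"
      using h[OF d(1) e(1)] h[OF d(2) e(2)] by auto
    then show "d + e \<in> L x" using s by (auto simp: L_def intro!: exI[of _ "s/2"])
  next
    fix c d assume "d \<in> L x"
    then obtain p where p: "p > 0" "x + p *\<^sub>R d \<in> P" "x - p *\<^sub>R d \<in> P" by (auto simp: L_def)
    define s where "s = p / (\<bar>c\<bar> + 1)"
    have s: "s > 0" using p by (simp add: s_def)
    have "\<bar>s * c\<bar> = p * (\<bar>c\<bar> / (\<bar>c\<bar> + 1))" using p by (simp add: s_def abs_mult)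
    also have "\<dots> \<le> p * 1" using p by (intro mult_left_mono) auto
    finally have "x + (s * c) *\<^sub>R d \<in> P" "x + (- (s * c)) *\<^sub>R d \<in> P"
      using Lsmall[OF p(2,3), of "s * c"] Lsmall[OF p(2,3), of "- (s * c)"] p(1) by auto
    then show "c *\<^sub>R d \<in> L x" using s by (auto simp: L_def intro!: exI[of _ s])
  qed
  have LV: "L x \<subseteq> V" if x: "x \<in> P" for x
  proof
    fix d assume "d \<in> L x"
    then obtain p where p: "p > 0" "x + p *\<^sub>R d \<in> P" by (auto simp: L_def)
    then have "(1/p) *\<^sub>R ((x + p *\<^sub>R d) - x) \<in> V"
      using x P(1) sV by (intro subspace_scale subspace_diff) auto
    then show "d \<in> V" using p by simp
  qed
  have dimless: "dim A < dim B" if "subspace A" "subspace B" "A \<subset> B" "B \<subseteq> V" for A B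
  proof -
    obtain S where S: "S \<subseteq> A" "independent S" "A \<subseteq> span S" "card S = dim A" using basis_exists by blast
    obtain y where y: "y \<in> B" "y \<notin> A" using \<open>A \<subset> B\<close> by blast
    have "span S \<subseteq> A" using S that by (simp add: span_minimal)
    then have ind: "independent (insert y S)" "y \<notin> S" using S y by (auto simp: independent_insert)
    have sub: "insert y S \<subseteq> B" using S y that by auto
    have fB: "fin_dim B"
    proof -
      obtain D where D: "D \<subseteq> B" "independent D" "B \<subseteq> span D" "card D = dim B"
        by (rule basis_exists[of B])
      then have "finite D" using independent_card_le_fin_dim(1)[OF V D(2)] \<open>B \<subseteq> V\<close> by simp
      moreover have "span D = B" using D \<open>subspace B\<close> by (simp add: span_minimal subset_antisym)
      ultimately show ?thesis by (auto simp: fin_dim_def)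
    qed
    have "finite (insert y S)" "card (insert y S) \<le> dim B"
      using independent_card_le_fin_dim[OF fB ind(1) sub] by auto
    then show ?thesis using S ind by simp
  qed
  have "x \<in> convex hull ?E" if "x \<in> P" for x
    using that
  proof (induction "dim (L x)" arbitrary: x rule: less_induct)
    case less
    note xP = less.prems
    show ?case
    proof (cases "x extreme_point_of P")
      case True then show ?thesis by (simp add: hull_inc)
    next
      case False
      then obtain a b where ab: "a \<in> P" "b \<in> P" "x \<in> open_segment a b"
        using xP by (auto simp: extreme_point_of_def)
      then obtain u where u: "0 < u" "u < 1" "x = (1 - u) *\<^sub>R a + u *\<^sub>R b" and "a \<noteq> b"
        by (auto simp: in_segment)
      define d where "d = b - a"
      have d0: "d \<noteq> 0" using \<open>a \<noteq> b\<close> by (simp add: d_def)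
      have dL: "d \<in> L x"
      proof -
        define \<epsilon> where "\<epsilon> = min u (1 - u)"
        have eps: "\<epsilon> > 0" "\<epsilon> \<le> u" "\<epsilon> \<le> 1 - u" using u by (auto simp: \<epsilon>_def)
        have "x + \<epsilon> *\<^sub>R d = (1 - (u + \<epsilon>)) *\<^sub>R a + (u + \<epsilon>) *\<^sub>R b"
          "x - \<epsilon> *\<^sub>R d = (1 - (u - \<epsilon>)) *\<^sub>R a + (u - \<epsilon>) *\<^sub>R b"
          unfolding u(3) d_def by (simp_all add: algebra_simps)
        then have "x + \<epsilon> *\<^sub>R d \<in> P" "x - \<epsilon> *\<^sub>R d \<in> P"
          using convexD_alt[OF P(3) ab(1,2)] eps u by auto
        then show ?thesis using eps by (auto simp: L_def)
      qed
      \<comment> \<open>The point where the ray from \<open>x\<close> in a direction of its face leaves \<open>P\<close>.\<close>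
      have exit: "\<exists>t>0. x + t *\<^sub>R e \<in> P \<and> e \<notin> L (x + t *\<^sub>R e)" if e: "e \<in> L x" "e \<noteq> 0" for e
      proof -
        obtain \<epsilon> where eps: "\<epsilon> > 0" "x + \<epsilon> *\<^sub>R e \<in> P" using e by (auto simp: L_def)
        have "compact P" by (rule P)
        then obtain R where R: "\<And>y. y \<in> P \<Longrightarrow> norm y \<le> R" using compact_imp_bounded bounded_iff by metis
        define I where "I = {t. t \<ge> 0 \<and> x + t *\<^sub>R e \<in> P}"
        have "I = {0..} \<inter> (\<lambda>t. x + t *\<^sub>R e) -` P" by (auto simp: I_def)
        moreover have "closed ((\<lambda>t. x + t *\<^sub>R e) -` P)"
          by (rule continuous_closed_vimage[OF compact_imp_closed[OF P(2)]]) (intro continuous_intros)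
        ultimately have "closed I" by (simp add: closed_Int)
        have bd: "t \<le> (R + norm x) / norm e" if "t \<in> I" for t
        proof -
          have "t * norm e = norm ((x + t *\<^sub>R e) - x)" using that by (simp add: I_def)
          also have "\<dots> \<le> R + norm x" using norm_triangle_ineq4[of "x + t *\<^sub>R e" x] R[of "x + t *\<^sub>R e"] that
            by (simp add: I_def)
          finally show ?thesis using e(2) by (simp add: field_simps)
        qed
        have bdd: "bdd_above I" using bd by (auto simp: bdd_above_def)
        have epsI: "\<epsilon> \<in> I" using eps by (simp add: I_def)
        have tI: "Sup I \<in> I" using closed_contains_Sup[OF _ bdd \<open>closed I\<close>] epsI by auto
        have "Sup I \<ge> \<epsilon>" using cSup_upper[OF epsI bdd] .
        moreover have "e \<notin> L (x + Sup I *\<^sub>R e)"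
        proof
          assume "e \<in> L (x + Sup I *\<^sub>R e)"
          then obtain s where "s > 0" "x + Sup I *\<^sub>R e + s *\<^sub>R e \<in> P" by (auto simp: L_def)
          then have "Sup I + s \<in> I" using tI by (simp add: I_def algebra_simps)
          then show False using cSup_upper[OF _ bdd, of "Sup I + s"] \<open>s > 0\<close> by simp
        qed
        ultimately show ?thesis using tI eps by (intro exI[of _ "Sup I"]) (auto simp: I_def)
      qed
      have "- d \<in> L x" using subspace_neg[OF Lspace[OF xP] dL] .
      then obtain t1 t2 where t: "t1 > 0" "x + t1 *\<^sub>R d \<in> P" "d \<notin> L (x + t1 *\<^sub>R d)"
        "t2 > 0" "x + t2 *\<^sub>R (- d) \<in> P" "- d \<notin> L (x + t2 *\<^sub>R (- d))"
        using exit[OF dL d0] exit[of "- d"] d0 by auto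
      define y z where "y = x + t1 *\<^sub>R d" and "z = x + t2 *\<^sub>R (- d)"
      have yz: "y \<in> P" "z \<in> P" using t by (auto simp: y_def z_def)
      define s where "s = t1 / (t1 + t2)"
      have s: "0 < s" "s < 1" using t by (auto simp: s_def)
      have xs: "x = (1 - s) *\<^sub>R y + s *\<^sub>R z"
      proof -
        have "(1 - s) * t1 = s * t2" using t by (simp add: s_def field_simps)
        moreover have "(1 - s) *\<^sub>R y + s *\<^sub>R z = x + ((1 - s) * t1 - s * t2) *\<^sub>R d"
          unfolding y_def z_def by (simp add: algebra_simps)
        ultimately show ?thesis by simp
      qed
      have face: "L y \<subseteq> L x" if "y \<in> P" "z \<in> P" "0 < s" "s < 1" "x = (1 - s) *\<^sub>R y + s *\<^sub>R z" for y z s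
      proof
        fix e assume "e \<in> L y"
        then obtain \<epsilon> where eps: "\<epsilon> > 0" "y + \<epsilon> *\<^sub>R e \<in> P" "y - \<epsilon> *\<^sub>R e \<in> P" by (auto simp: L_def)
        have "x + ((1 - s) * \<epsilon>) *\<^sub>R e = (1 - s) *\<^sub>R (y + \<epsilon> *\<^sub>R e) + s *\<^sub>R z"
          "x - ((1 - s) * \<epsilon>) *\<^sub>R e = (1 - s) *\<^sub>R (y - \<epsilon> *\<^sub>R e) + s *\<^sub>R z"
          unfolding that(5) by (simp_all add: algebra_simps)
        moreover have "0 \<le> s" "s \<le> 1" using that by auto
        ultimately have "x + ((1 - s) * \<epsilon>) *\<^sub>R e \<in> P" "x - ((1 - s) * \<epsilon>) *\<^sub>R e \<in> P"
          using convexD_alt[OF P(3) eps(2) that(2), of s] convexD_alt[OF P(3) eps(3) that(2), of s]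
          by simp_all
        then show "e \<in> L x" using eps that by (auto simp: L_def intro!: exI[of _ "(1 - s) * \<epsilon>"])
      qed
      have "L y \<subseteq> L x" by (rule face[OF yz s xs])
      moreover have "L z \<subseteq> L x" by (rule face[OF yz(2,1), of "1 - s"]) (use s xs in \<open>auto simp: add.commute\<close>)
      moreover have "- d \<in> L x" "d \<notin> L y" "- d \<notin> L z" using t \<open>- d \<in> L x\<close> by (auto simp: y_def z_def)
      ultimately have "L y \<subset> L x" "L z \<subset> L x" using dL by auto
      then have "dim (L y) < dim (L x)" "dim (L z) < dim (L x)"
        using Lspace yz xP LV[OF xP] by (auto intro!: dimless)
      then have "y \<in> convex hull ?E" "z \<in> convex hull ?E" using less.hyps yz by auto
      then show ?thesis unfolding xs using s by (intro convexD[OF convex_convex_hull]) auto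
    qed
  qed
  then show "P \<subseteq> convex hull ?E" by blast
qed

text \<open>The separating functional is the difference between \<open>y\<close> and its nearest point in \<open>K\<close>, for the inner
  product given by the coordinates.\<close>

lemma separation_in_coordinates:
  fixes K :: "'v::real_normed_vector set" and f :: "nat \<Rightarrow> 'v \<Rightarrow> real"
  assumes V: "fin_dim V" and f: "\<And>i. linear (f i)"
    and inj: "\<And>x. x \<in> V \<Longrightarrow> (\<forall>i<r. f i x = 0) \<Longrightarrow> x = 0"
    and K: "compact K" "convex K" "0 \<in> K" "K \<subseteq> V" and y: "y \<in> V" "y \<notin> K"
  obtains l where "l \<in> tuples r UNIV" "(\<Sum>i<r. l i * f i y) < -1"
    "\<And>z. z \<in> K \<Longrightarrow> (\<Sum>i<r. l i * f i z) \<ge> -1"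
proof -
  note fs = linear_diff[OF f] linear_add[OF f] linear_scale[OF f] linear_0[OF f]
  have sV: "subspace V" using V by (rule fin_dim_subspace)
  define q where "q x = (\<Sum>i<r. (f i x)\<^sup>2)" for x
  have "continuous_on K (f i)" for i
    by (rule continuous_on_subset[OF linear_continuous_on_fin_dim[OF V f]]) (use K in auto)
  then have "continuous_on K (\<lambda>z. q (z - y))"
    unfolding q_def fs by (intro continuous_intros)
  then obtain k where k: "k \<in> K" "\<And>z. z \<in> K \<Longrightarrow> q (k - y) \<le> q (z - y)"
    using continuous_attains_inf[OF K(1)] K(3) by blast
  have pos: "q (k - y) > 0"
  proof -
    have "k - y \<noteq> 0" "k - y \<in> V" using k y K sV by (auto simp: subspace_diff)
    then obtain i where "i < r" "f i (k - y) \<noteq> 0" using inj by blast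
    then show ?thesis unfolding q_def by (intro sum_pos2[of _ i]) auto
  qed
  define B where "B z = (\<Sum>i<r. f i (k - y) * f i z)" for z
  have Bd: "B (z - w) = B z - B w" for z w
    unfolding B_def fs(1)[of _ z w] by (simp add: right_diff_distrib sum_subtractf)
  have var: "B (z - k) \<ge> 0" if z: "z \<in> K" for z
  proof (rule ccontr)
    assume neg: "\<not> B (z - k) \<ge> 0"
    have exp: "q (k + t *\<^sub>R (z - k) - y) = q (k - y) + t * (2 * B (z - k) + t * q (z - k))" for t
    proof -
      have "k + t *\<^sub>R (z - k) - y = (k - y) + t *\<^sub>R (z - k)" by simp
      moreover have "(\<Sum>i<r. (a i + t * b i)\<^sup>2) = (\<Sum>i<r. (a i)\<^sup>2) + t * (2 * (\<Sum>i<r. a i * b i) + t * (\<Sum>i<r. (b i)\<^sup>2))"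
        for a b :: "nat \<Rightarrow> real"
        by (simp add: power2_eq_square algebra_simps sum.distrib sum_distrib_left)
      ultimately show ?thesis unfolding q_def B_def
        by (simp only: fs(2,3) real_scaleR_def)
    qed
    have q0: "q (z - k) \<ge> 0" unfolding q_def by (intro sum_nonneg) auto
    define t where "t = min 1 (- B (z - k) / (q (z - k) + 1))"
    have t: "0 < t" "t \<le> 1" using neg q0 divide_pos_pos[of "- B (z - k)" "q (z - k) + 1"] by (simp_all add: t_def)
    have "t * q (z - k) \<le> t * (q (z - k) + 1)" using t by simp
    also have "\<dots> \<le> - B (z - k)"
    proof -
      have "t \<le> - B (z - k) / (q (z - k) + 1)" by (simp add: t_def)
      then show ?thesis using q0 by (simp add: field_simps)
    qed
    finally have "2 * B (z - k) + t * q (z - k) < 0" using neg by simp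
    then have "q (k + t *\<^sub>R (z - k) - y) < q (k - y)"
      unfolding exp using t by (simp add: mult_pos_neg)
    moreover have "k + t *\<^sub>R (z - k) \<in> K"
      using convexD_alt[OF K(2) k(1) z, of t] t by (simp add: algebra_simps)
    ultimately show False using k(2) by force
  qed
  have "B 0 = 0" by (simp add: B_def fs(4))
  then have Bk: "B k \<le> 0" using var[OF K(3)] Bd[of 0 k] by simp
  have "q (k - y) = B (k - y)" by (simp add: q_def B_def power2_eq_square)
  then have By: "B y < B k" using pos Bd[of k y] by simp
  define c where "c = (if B k = 0 then - B y / 2 else - ((B k + B y) / 2))"
  have c: "c > 0" "B y < - c" "- c \<le> B k" using Bk By by (auto simp: c_def field_simps)
  define l where "l = (\<lambda>i\<in>{..<r}. f i (k - y) / c)"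
  have lB: "(\<Sum>i<r. l i * f i z) = B z / c" for z
    by (simp add: l_def B_def sum_divide_distrib)
  show thesis
  proof (rule that)
    show "l \<in> tuples r UNIV" by (simp add: l_def)
    show "(\<Sum>i<r. l i * f i y) < -1" unfolding lB using c by (simp add: field_simps)
    fix z assume "z \<in> K"
    then have "B z \<ge> - c" using var[of z] c Bd[of z k] by simp
    then show "(\<Sum>i<r. l i * f i z) \<ge> -1" unfolding lB using c by (simp add: field_simps)
  qed
qed

section \<open>Multilinear maps\<close>

lemma multilinear_on_in: "multilinear_on n V F \<phi> \<Longrightarrow> v \<in> tuples n V \<Longrightarrow> \<phi> v \<in> F"
  by (simp add: multilinear_on_def)

lemma multilinear_on_add:
  "multilinear_on n V F \<phi> \<Longrightarrow> v \<in> tuples n V \<Longrightarrow> i < n \<Longrightarrow> x \<in> V \<Longrightarrow> y \<in> V \<Longrightarrow>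
     \<phi> (v(i := x + y)) = \<phi> (v(i := x)) + \<phi> (v(i := y))"
  unfolding multilinear_on_def by blast

lemma multilinear_on_scale:
  "multilinear_on n V F \<phi> \<Longrightarrow> v \<in> tuples n V \<Longrightarrow> i < n \<Longrightarrow> x \<in> V \<Longrightarrow>
     \<phi> (v(i := c *\<^sub>R x)) = c *\<^sub>R \<phi> (v(i := x))"
  unfolding multilinear_on_def by blast

lemma multilinear_on_sum:
  assumes m: "multilinear_on n V F \<phi>" and V: "subspace V" and v: "v \<in> tuples n V" "i < n"
    and A: "finite A" "\<And>a. a \<in> A \<Longrightarrow> x a \<in> V"
  shows "\<phi> (v(i := (\<Sum>a\<in>A. c a *\<^sub>R x a))) = (\<Sum>a\<in>A. c a *\<^sub>R \<phi> (v(i := x a)))"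
  using A
proof (induction rule: finite_induct)
  case empty
  have "\<phi> (v(i := 0 *\<^sub>R 0)) = 0"
    using multilinear_on_scale[OF m v subspace_0[OF V], of 0] by simp
  then show ?case by (simp only: sum.empty scaleR_zero_left)
next
  case (insert a A)
  have "(\<Sum>a\<in>A. c a *\<^sub>R x a) \<in> V" "c a *\<^sub>R x a \<in> V"
    using insert.prems V by (auto intro!: subspace_sum subspace_scale)
  then show ?case
    using insert multilinear_on_add[OF m v, of "c a *\<^sub>R x a"] multilinear_on_scale[OF m v, of "x a"]
    by (simp del: fun_upd_apply)
qed

lemma tuples_upd: "v \<in> tuples n V \<Longrightarrow> i < n \<Longrightarrow> x \<in> V \<Longrightarrow> v(i := x) \<in> tuples n V"
  by (auto simp: PiE_iff extensional_def)

text \<open>One entry is expanded at a time; the sum on the right is over all choices of a basis vector for each entry.\<close>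

lemma multilinear_expansion:
  fixes f :: "'k \<Rightarrow> 'v::real_vector \<Rightarrow> real"
  assumes m: "multilinear_on n V F \<phi>" and V: "subspace V" and A: "finite A"
    and e: "\<And>a. a \<in> A \<Longrightarrow> e a \<in> V" and f: "\<And>x. x \<in> V \<Longrightarrow> (\<Sum>a\<in>A. f a x *\<^sub>R e a) = x"
    and v: "v \<in> tuples n V"
  shows "\<phi> v = (\<Sum>J\<in>tuples n A. (\<Prod>i<n. f (J i) (v i)) *\<^sub>R \<phi> (\<lambda>i\<in>{..<n}. e (J i)))"
proof -
  have "\<phi> v = (\<Sum>J\<in>tuples k A. (\<Prod>i<k. f (J i) (v i)) *\<^sub>R \<phi> (\<lambda>i. if i < k then e (J i) else v i))"
    if "k \<le> n" for k
    using that
  proof (induction k)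
    case 0 then show ?case by simp
  next
    case (Suc k)
    have step: "\<phi> (\<lambda>i. if i < k then e (J i) else v i) =
        (\<Sum>a\<in>A. f a (v k) *\<^sub>R \<phi> (\<lambda>i. if i < Suc k then e ((J(k := a)) i) else v i))"
      if J: "J \<in> tuples k A" for J
    proof -
      let ?w = "\<lambda>i. if i < k then e (J i) else v i"
      have Je: "J i \<in> A" if "i < k" for i using J that by auto
      have kn: "k < n" using Suc.prems by simp
      have w: "?w \<in> tuples n V"
      proof (rule PiE_I)
        fix i assume "i \<in> {..<n}"
        then show "?w i \<in> V" using PiE_mem[OF v, of i] e[OF Je, of i] by simp
      next
        fix i assume "i \<notin> {..<n}"
        then show "?w i = undefined" using PiE_arb[OF v, of i] kn by simp
      qed
      have vk: "v k \<in> V" using PiE_mem[OF v, of k] kn by simp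
      have "?w = ?w(k := (\<Sum>a\<in>A. f a (v k) *\<^sub>R e a))" using f[OF vk] by auto
      then have "\<phi> ?w = \<phi> (?w(k := (\<Sum>a\<in>A. f a (v k) *\<^sub>R e a)))" by simp
      also have "\<dots> = (\<Sum>a\<in>A. f a (v k) *\<^sub>R \<phi> (?w(k := e a)))"
        by (rule multilinear_on_sum[OF m V w kn A e])
      also have "\<dots> = (\<Sum>a\<in>A. f a (v k) *\<^sub>R \<phi> (\<lambda>i. if i < Suc k then e ((J(k := a)) i) else v i))"
        by (intro sum.cong refl arg_cong2[where f = scaleR] arg_cong[where f = \<phi>])
          (auto simp: fun_eq_iff less_Suc_eq)
      finally show ?thesis .
    qed
    let ?t = "\<lambda>k J. (\<Prod>i<k. f (J i) (v i)) *\<^sub>R \<phi> (\<lambda>i. if i < k then e (J i) else v i)"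
    have bij: "bij_betw (\<lambda>(a, J). J(k := a)) (A \<times> tuples k A) (tuples (Suc k) A)"
    proof -
      have "inj_on (\<lambda>(a, J). J(k := a)) (A \<times> tuples k A)"
        using inj_combinator[of k "{..<k}" "\<lambda>_. A"] by simp
      then show ?thesis
        by (simp add: bij_betw_def lessThan_Suc PiE_insert_eq)
    qed
    have "\<phi> v = (\<Sum>J\<in>tuples k A. ?t k J)" using Suc by simp
    also have "\<dots> = (\<Sum>J\<in>tuples k A. \<Sum>a\<in>A. ?t (Suc k) (J(k := a)))"
    proof (rule sum.cong[OF refl])
      fix J assume J: "J \<in> tuples k A"
      have "(\<Prod>i<Suc k. f ((J(k := a)) i) (v i)) = (\<Prod>i<k. f (J i) (v i)) * f a (v k)" for a
        by simp
      then show "?t k J = (\<Sum>a\<in>A. ?t (Suc k) (J(k := a)))"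
        by (simp only: step[OF J] scaleR_sum_right scaleR_scaleR)
    qed
    also have "\<dots> = (\<Sum>(a, J)\<in>A \<times> tuples k A. ?t (Suc k) (J(k := a)))"
      by (subst sum.swap) (simp add: sum.cartesian_product)
    also have "\<dots> = (\<Sum>J\<in>tuples (Suc k) A. ?t (Suc k) J)"
      by (subst sum.reindex_bij_betw[OF bij, symmetric]) (auto intro: sum.cong)
    finally show ?case .
  qed
  from this[of n] have "\<phi> v = (\<Sum>J\<in>tuples n A. (\<Prod>i<n. f (J i) (v i)) *\<^sub>R \<phi> (\<lambda>i. if i < n then e (J i) else v i))"
    by simp
  moreover have "(\<lambda>i. if i < n then e (J i) else v i) = (\<lambda>i\<in>{..<n}. e (J i))" for J
    using v by (auto simp: fun_eq_iff PiE_iff extensional_def)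
  ultimately show ?thesis by simp
qed

lemma alternating_swap:
  assumes m: "multilinear_on n V F \<phi>" and V: "subspace V"
    and k: "k < n" "k' < n" "k \<noteq> k'"
    and z: "\<And>w. w \<in> tuples n V \<Longrightarrow> w k = w k' \<Longrightarrow> \<phi> w = 0"
    and v: "v \<in> tuples n V"
  shows "\<phi> (v \<circ> Transposition.transpose k k') = - \<phi> v"
proof -
  let ?u = "\<lambda>x y. v(k := x, k' := y)"
  have u: "?u x y \<in> tuples n V" if "x \<in> V" "y \<in> V" for x y
    using that v k by (intro tuples_upd)
  have vV: "v k \<in> V" "v k' \<in> V" "v k + v k' \<in> V" using v k V by (auto intro: subspace_add)
  let ?s = "v k + v k'"
  have 1: "\<phi> (?u x ?s) = \<phi> (?u x (v k)) + \<phi> (?u x (v k'))" if "x \<in> V" for x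
    using multilinear_on_add[OF m _ k(2) vV(1,2), of "v(k := x)"] tuples_upd[OF v k(1) that] by simp
  have 2: "\<phi> (?u ?s y) = \<phi> (?u (v k) y) + \<phi> (?u (v k') y)" if "y \<in> V" for y
    using multilinear_on_add[OF m tuples_upd[OF v k(2) that] k(1) vV(1,2)]
    by (simp only: fun_upd_twist[OF k(3)])
  have "0 = \<phi> (?u ?s ?s)" using z[OF u] vV k(3) by simp
  also have "\<dots> = \<phi> (?u (v k) (v k)) + \<phi> (?u (v k') (v k)) + (\<phi> (?u (v k) (v k')) + \<phi> (?u (v k') (v k')))"
    using 1[OF vV(3)] 2[OF vV(1)] 2[OF vV(2)] by simp
  also have "\<phi> (?u (v k) (v k)) = 0" by (rule z[OF u]) (use vV in auto)
  also have "\<phi> (?u (v k') (v k')) = 0" by (rule z[OF u]) (use vV in auto)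
  also have "?u (v k) (v k') = v" by simp
  also have "?u (v k') (v k) = v \<circ> Transposition.transpose k k'"
    by (auto simp: fun_eq_iff Transposition.transpose_def)
  finally show ?thesis by (simp add: eq_neg_iff_add_eq_0 del: o_apply)
qed

text \<open>The entries of a tuple can be replaced by points of \<open>E\<close> one after the other, because the map is affine in each
  entry.\<close>

lemma multilinear_convex_hull:
  assumes m: "multilinear_on n V F \<phi>" and V: "subspace V" and E: "E \<subseteq> V"
  shows "convex hull (\<phi> ` tuples n (convex hull E)) = convex hull (\<phi> ` tuples n E)"
proof
  have hV: "convex hull E \<subseteq> V" using E V by (simp add: hull_minimal subspace_imp_convex)
  let ?C = "convex hull (\<phi> ` tuples n E)"
  have *: "\<phi> v \<in> ?C"
    if "k \<le> n" "v \<in> tuples n V" "\<And>i. i < k \<Longrightarrow> v i \<in> convex hull E" "\<And>i. k \<le> i \<Longrightarrow> i < n \<Longrightarrow> v i \<in> E" for k v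
    using that
  proof (induction k arbitrary: v)
    case 0
    then have "v \<in> tuples n E" by (auto simp: PiE_iff)
    then show ?case by (simp add: hull_inc)
  next
    case (Suc k)
    let ?D = "{x \<in> V. \<phi> (v(k := x)) \<in> ?C}"
    have kn: "k < n" using Suc.prems by simp
    have "convex ?D"
    proof (rule convexI)
      fix x y and s t :: real
      assume *: "x \<in> ?D" "y \<in> ?D" "0 \<le> s" "0 \<le> t" "s + t = 1"
      then have V': "s *\<^sub>R x \<in> V" "t *\<^sub>R y \<in> V" using V by (auto intro: subspace_scale)
      have "\<phi> (v(k := s *\<^sub>R x + t *\<^sub>R y)) = s *\<^sub>R \<phi> (v(k := x)) + t *\<^sub>R \<phi> (v(k := y))"
        using multilinear_on_add[OF m Suc.prems(2) kn V'] multilinear_on_scale[OF m Suc.prems(2) kn] * by simp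
      then show "s *\<^sub>R x + t *\<^sub>R y \<in> ?D"
        using * convexD[OF convex_convex_hull _ _ *(3-5), of _ "\<phi> ` tuples n E"] subspace_add[OF V V'] by simp
    qed
    moreover have "E \<subseteq> ?D"
    proof
      fix x assume x: "x \<in> E"
      have "\<phi> (v(k := x)) \<in> ?C"
        using Suc.prems x E by (intro Suc.IH tuples_upd) auto
      then show "x \<in> ?D" using x E by auto
    qed
    ultimately have "convex hull E \<subseteq> ?D" by (simp add: hull_minimal)
    then have "v k \<in> ?D" using Suc.prems(3)[of k] by auto
    then show ?case by simp
  qed
  have "\<phi> v \<in> ?C" if "v \<in> tuples n (convex hull E)" for v
    using that hV by (intro *[of n]) (auto simp: PiE_iff)
  then show "convex hull (\<phi> ` tuples n (convex hull E)) \<subseteq> ?C"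
    by (intro hull_minimal) auto
  show "?C \<subseteq> convex hull (\<phi> ` tuples n (convex hull E))"
    by (intro hull_mono image_mono PiE_mono hull_subset)
qed

section \<open>The boxes of a Young diagram\<close>

definition box_row :: "nat list \<Rightarrow> nat \<Rightarrow> nat" where
  "box_row lam k = (LEAST i. k < sum_list (take (Suc i) lam))"

definition box_column :: "nat list \<Rightarrow> nat \<Rightarrow> nat" where
  "box_column lam k = k - sum_list (take (box_row lam k) lam)"

lemma sum_list_take_Suc: "i < length lam \<Longrightarrow> sum_list (take (Suc i) lam) = sum_list (take i lam) + lam ! i"
  for lam :: "nat list"
  by (simp add: take_Suc_conv_app_nth)

lemma sum_list_take_mono: "i \<le> j \<Longrightarrow> sum_list (take i lam) \<le> sum_list (take j lam)" for lam :: "nat list"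
proof -
  assume "i \<le> j"
  then have "take j lam = take i lam @ take (j - i) (drop i lam)" by (metis le_add_diff_inverse take_add)
  then show ?thesis by simp
qed

lemma box_coordinates:
  assumes "k < sum_list lam"
  shows "box_row lam k < length lam" "box_column lam k < lam ! box_row lam k"
    "k = sum_list (take (box_row lam k) lam) + box_column lam k"
proof -
  let ?i = "box_row lam k"
  have ex: "k < sum_list (take (Suc (length lam - 1)) lam)" using assms by (cases lam) auto
  have 1: "k < sum_list (take (Suc ?i) lam)" unfolding box_row_def by (rule LeastI) (rule ex)
  have "?i \<le> length lam - 1" unfolding box_row_def by (rule Least_le) (rule ex)
  moreover have "lam \<noteq> []" using assms by auto
  ultimately show i: "?i < length lam" by (cases lam) auto
  have 2: "sum_list (take ?i lam) \<le> k"
  proof (cases ?i)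
    case (Suc l)
    then have "\<not> k < sum_list (take (Suc l) lam)" unfolding box_row_def by (intro not_less_Least) simp
    then show ?thesis using Suc by simp
  qed simp
  then show "k = sum_list (take ?i lam) + box_column lam k" by (simp add: box_column_def)
  then show "box_column lam k < lam ! ?i" using 1 sum_list_take_Suc[OF i] by linarith
qed

lemma box_unique:
  assumes "i < length lam" "j < lam ! i"
  shows "sum_list (take i lam) + j < sum_list lam"
    and "box_row lam (sum_list (take i lam) + j) = i"
    and "box_column lam (sum_list (take i lam) + j) = j"
proof -
  have le: "sum_list (take i lam) + j < sum_list (take (Suc i) lam)"
    using assms sum_list_take_Suc by simp
  then show "sum_list (take i lam) + j < sum_list lam"
    using sum_list_take_mono[of "Suc i" "max (Suc i) (length lam)" lam] by simp
  show r: "box_row lam (sum_list (take i lam) + j) = i"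
    unfolding box_row_def
  proof (rule Least_equality)
    show "sum_list (take i lam) + j < sum_list (take (Suc i) lam)" by (rule le)
  next
    fix l assume "sum_list (take i lam) + j < sum_list (take (Suc l) lam)"
    then show "i \<le> l" using sum_list_take_mono[of "Suc l" i lam] by force
  qed
  show "box_column lam (sum_list (take i lam) + j) = j" by (simp add: box_column_def r)
qed

lemma diagram_column_eq: "diagram_column lam j = {k. k < sum_list lam \<and> box_column lam k = j}"
  unfolding diagram_column_def using box_coordinates box_unique by (auto; metis)

lemma diagram_row_eq: "diagram_row lam i = {k. k < sum_list lam \<and> box_row lam k = i}"
  unfolding diagram_row_def using box_coordinates box_unique by (auto; metis)

lemma box_row_mono: "k \<le> k' \<Longrightarrow> k' < sum_list lam \<Longrightarrow> box_row lam k \<le> box_row lam k'"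
proof (rule ccontr)
  assume *: "k \<le> k'" "k' < sum_list lam" "\<not> box_row lam k \<le> box_row lam k'"
  have "k' < sum_list (take (Suc (box_row lam k')) lam)"
    using box_coordinates[OF *(2)] sum_list_take_Suc by simp
  also have "\<dots> \<le> sum_list (take (box_row lam k) lam)" using * by (intro sum_list_take_mono) simp
  also have "\<dots> \<le> k" using box_coordinates(3)[of k lam] * by linarith
  finally show False using * by simp
qed

lemma box_eqI:
  "k < sum_list lam \<Longrightarrow> k' < sum_list lam \<Longrightarrow> box_row lam k = box_row lam k' \<Longrightarrow>
     box_column lam k = box_column lam k' \<Longrightarrow> k = k'"
  using box_coordinates(3) by metis

lemma box_row_less:
  "k < k' \<Longrightarrow> k' < sum_list lam \<Longrightarrow> box_column lam k = box_column lam k' \<Longrightarrow> box_row lam k < box_row lam k'"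
  using box_row_mono[of k k' lam] box_eqI[of k lam k'] by force

lemma box_column_less:
  "k < k' \<Longrightarrow> k' < sum_list lam \<Longrightarrow> box_row lam k = box_row lam k' \<Longrightarrow> box_column lam k < box_column lam k'"
  using box_coordinates(3)[of k lam] box_coordinates(3)[of k' lam] by (simp add: box_column_def)

lemma box_row_less_iff:
  "k < sum_list lam \<Longrightarrow> k' < sum_list lam \<Longrightarrow> box_column lam k = box_column lam k' \<Longrightarrow>
    k < k' \<longleftrightarrow> box_row lam k < box_row lam k'"
  using box_row_less[of k k' lam] box_row_mono[of k' k lam] by force

lemma semistandard_iff:
  "t \<in> semistandard_tableaux lam m \<longleftrightarrow> t \<in> tuples (sum_list lam) {1..m} \<and>
     (\<forall>k k'. k < k' \<longrightarrow> k' < sum_list lam \<longrightarrow>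
        (box_row lam k = box_row lam k' \<longrightarrow> t k \<le> t k') \<and> (box_column lam k = box_column lam k' \<longrightarrow> t k < t k'))"
  unfolding semistandard_tableaux_def diagram_row_eq diagram_column_eq
  by (auto 0 3 dest: less_trans)

text \<open>Columns have no gaps, because the rows of a partition are weakly decreasing.\<close>

lemma box_above:
  assumes "number_partition lam n" and k: "k < n" and i: "i \<le> box_row lam k"
  shows "\<exists>k'<n. box_row lam k' = i \<and> box_column lam k' = box_column lam k"
proof -
  have n: "n = sum_list lam" using assms by (simp add: number_partition_def)
  note bc = box_coordinates[of k lam]
  have "lam ! box_row lam k \<le> lam ! i"
    using assms bc i n unfolding number_partition_def
    by (cases "i = box_row lam k") (auto simp: sorted_wrt_iff_nth_less)
  then have "i < length lam" "box_column lam k < lam ! i" using bc i k n by auto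
  from box_unique[OF this] show ?thesis using n by blast
qed

section \<open>Straightening\<close>

lemma sorted_list_rank:
  assumes "finite (Y :: nat set)" "r < card Y"
  shows "card {y \<in> Y. y < sorted_list_of_set Y ! r} = r"
proof -
  let ?l = "sorted_list_of_set Y"
  have l: "length ?l = card Y" "set ?l = Y" "sorted_wrt (<) ?l" "distinct ?l"
    using assms by auto
  have "{y \<in> Y. y < ?l ! r} = (!) ?l ` {..<r}"
  proof (intro set_eqI iffI)
    fix y assume y: "y \<in> {y \<in> Y. y < ?l ! r}"
    then have "y \<in> set ?l" using l(2) by auto
    then obtain s where s: "s < card Y" "y = ?l ! s" using l(1) by (metis in_set_conv_nth)
    have "s < r"
    proof (rule ccontr)
      assume "\<not> s < r"
      then have "?l ! r \<le> ?l ! s" using s l(1,3) sorted_wrt_nth_less[OF l(3), of r s] by (cases "s = r") auto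
      then show False using y s by simp
    qed
    then show "y \<in> (!) ?l ` {..<r}" using s by blast
  next
    fix y assume "y \<in> (!) ?l ` {..<r}"
    then obtain s where s: "s < r" "y = ?l ! s" by auto
    then show "y \<in> {y \<in> Y. y < ?l ! r}"
      using sorted_wrt_nth_less[OF l(3), of s r] assms l nth_mem[of s ?l] by auto
  qed
  moreover have "inj_on ((!) ?l) {..<r}" using l assms(2) by (auto simp: inj_on_def nth_eq_iff_index_eq)
  ultimately show ?thesis by (simp add: card_image)
qed

lemma order_match_inverse:
  assumes "k \<in> X" "finite X" "finite Y" "card X = card Y"
  shows "order_match Y X (order_match X Y k) = k"
proof -
  have "k \<in> set (sorted_list_of_set X)" using assms by simp
  then obtain r where r: "r < card X" "k = sorted_list_of_set X ! r"
    using assms(2) by (metis in_set_conv_nth length_sorted_list_of_set)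
  then have "card {x \<in> X. x < k} = r" using sorted_list_rank[OF assms(2)] by simp
  moreover have "card {y \<in> Y. y < sorted_list_of_set Y ! r} = r"
    using sorted_list_rank[OF assms(3)] r assms(4) by simp
  ultimately show ?thesis using r by (simp add: order_match_def)
qed

lemma order_match_bij:
  assumes "finite X" "finite Y" "card X = card Y"
  shows "bij_betw (order_match X Y) X Y"
  using assms order_match_in[of _ X Y] order_match_in[of _ Y X] order_match_inverse[of _ X Y]
    order_match_inverse[of _ Y X]
  by (intro bij_betwI[of _ _ _ "order_match Y X"]) auto

lemma exchanges_finite:
  assumes "X \<in> exchanges lam j Y" "Y \<subseteq> diagram_column lam j'"
  shows "finite X" "finite Y" "card X = card Y" "X \<subseteq> {..<sum_list lam}" "Y \<subseteq> {..<sum_list lam}"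
proof -
  have X: "X \<subseteq> {..<sum_list lam}" "card X = card Y" and Y: "Y \<subseteq> {..<sum_list lam}"
    using assms diagram_column_subset[of lam j] diagram_column_subset[of lam j']
    by (auto simp: exchanges_def)
  then show "finite X" "finite Y" "card X = card Y" "X \<subseteq> {..<sum_list lam}" "Y \<subseteq> {..<sum_list lam}"
    using finite_subset[OF X(1)] finite_subset[OF Y] by auto
qed

lemma exchange_in_tuples:
  assumes X: "X \<in> exchanges lam j Y" and Y: "Y \<subseteq> diagram_column lam j'"
    and v: "v \<in> tuples (sum_list lam) A"
  shows "exchange X Y v \<in> tuples (sum_list lam) A"
proof (rule PiE_I)
  note f = exchanges_finite[OF X Y]
  fix k assume k: "k \<in> {..<sum_list lam}"
  show "exchange X Y v k \<in> A"
    using order_match_in[OF _ f(1,2,3)] order_match_in[OF _ f(2,1) f(3)[symmetric]] f(4,5) k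
    unfolding exchange_def by (simp add: PiE_mem[OF v] subset_iff)
next
  note f = exchanges_finite[OF X Y]
  fix k assume "k \<notin> {..<sum_list lam}"
  then have "k \<notin> X" "k \<notin> Y" using f(4,5) by auto
  then show "exchange X Y v k = undefined" using \<open>k \<notin> {..<sum_list lam}\<close> by (simp add: exchange_def PiE_arb[OF v])
qed

lemma exchange_comp:
  assumes X: "X \<in> exchanges lam j Y" and Y: "Y \<subseteq> diagram_column lam j'" and n: "n = sum_list lam"
  shows "exchange X Y (\<lambda>i\<in>{..<n}. e (t i)) = (\<lambda>i\<in>{..<n}. e (exchange X Y t i))"
proof
  note f = exchanges_finite[OF X Y]
  fix k
  show "exchange X Y (\<lambda>i\<in>{..<n}. e (t i)) k = (\<lambda>i\<in>{..<n}. e (exchange X Y t i)) k"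
    using order_match_in[of k X Y] order_match_in[of k Y X] f n unfolding exchange_def by auto
qed

lemma exchange_axioms_alternating:
  assumes "exchange_axioms lam V \<phi>" "k < sum_list lam" "k' < sum_list lam" "k \<noteq> k'"
    "box_column lam k = box_column lam k'" "v \<in> tuples (sum_list lam) V" "v k = v k'"
  shows "\<phi> v = 0"
  using assms unfolding exchange_axioms_def diagram_column_eq by blast

lemma sum_extract_two:
  fixes g :: "nat \<Rightarrow> 'a::comm_monoid_add"
  assumes "k < n" "k' < n" "k \<noteq> k'"
  shows "(\<Sum>i<n. g i) = g k + g k' + (\<Sum>i\<in>{..<n} - {k, k'}. g i)"
proof -
  have "(\<Sum>i<n. g i) = g k + (\<Sum>i\<in>{..<n} - {k}. g i)" using assms by (simp add: sum.remove)
  also have "(\<Sum>i\<in>{..<n} - {k}. g i) = g k' + (\<Sum>i\<in>{..<n} - {k} - {k'}. g i)"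
    using assms by (intro sum.remove) auto
  also have "{..<n} - {k} - {k'} = {..<n} - {k, k'}" by auto
  finally show ?thesis by (simp add: add.assoc)
qed

lemma sum_two_powers_less:
  fixes T :: "'i \<Rightarrow> nat"
  assumes "finite Y" "inj_on T Y" "\<And>y. y \<in> Y \<Longrightarrow> T y < b"
  shows "(\<Sum>y\<in>Y. 2 ^ T y) < (2 ^ b :: nat)"
proof -
  have "(\<Sum>y\<in>Y. 2 ^ T y) = (\<Sum>a\<in>T ` Y. 2 ^ a :: nat)" using assms by (simp add: sum.reindex)
  also have "\<dots> \<le> (\<Sum>a<b. 2 ^ a)" using assms by (intro sum_mono2) auto
  also have "\<dots> < 2 ^ b" by (induction b) auto
  finally show ?thesis .
qed

text \<open>Exchanging the boxes of the right column down to a descent of a row moves weight to the right,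
  where an entry \<open>a\<close> has weight \<open>2 ^ a\<close>: the entries which move to the left are distinct and smaller than
  one of those which move to the right.\<close>

lemma exchange_increases_weight:
  assumes lam: "number_partition lam n"
    and col: "\<And>k k'. k < k' \<Longrightarrow> k' < n \<Longrightarrow> box_column lam k = box_column lam k' \<Longrightarrow> T k < (T k' :: nat)"
    and k: "k < k'" "k' < n" "box_row lam k = box_row lam k'" "T k' < T k"
    and Y: "Y = {y. y < n \<and> box_column lam y = box_column lam k' \<and> box_row lam y \<le> box_row lam k'}"
    and X: "X \<in> exchanges lam (box_column lam k) Y"
  shows "(\<Sum>i<n. box_column lam i * 2 ^ T i) < (\<Sum>i<n. box_column lam i * 2 ^ exchange X Y T i)"
proof -
  have n: "n = sum_list lam" using lam by (simp add: number_partition_def)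
  let ?c = "box_column lam" and ?r = "box_row lam"
  have Yc: "Y \<subseteq> diagram_column lam (?c k')" by (auto simp: Y n diagram_column_eq)
  note f = exchanges_finite[OF X Yc]
  have Xc: "x < n" "?c x = ?c k" if "x \<in> X" for x
    using that X by (auto simp: exchanges_def diagram_column_eq n)
  have jj: "?c k < ?c k'" using box_column_less[OF k(1)] k n by simp
  then have disj: "X \<inter> Y = {}" using Xc by (auto simp: Y)
  have T_le: "x \<le> y \<Longrightarrow> y < n \<Longrightarrow> ?c x = ?c y \<Longrightarrow> T x \<le> T y" for x y
    using col[of x y] by (cases "x = y") auto
  have row_le: "x \<le> y" if "x < n" "y < n" "?c x = ?c y" "?r x \<le> ?r y" for x y
    using box_row_less_iff[of y lam x] that n by force
  define A where "A = (\<Sum>x\<in>X. 2 ^ T x :: nat)"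
  define B where "B = (\<Sum>y\<in>Y. 2 ^ T y :: nat)"
  have "B < 2 ^ T k" unfolding B_def
  proof (rule sum_two_powers_less[OF f(2)])
    show "inj_on T Y"
    proof (rule inj_onI)
      fix x y assume "x \<in> Y" "y \<in> Y" "T x = T y"
      then show "x = y" using col[of x y] col[of y x] by (cases x y rule: linorder_cases) (auto simp: Y)
    qed
    fix y assume "y \<in> Y"
    then have "T y \<le> T k'" using row_le[of y k'] T_le[of y k'] k by (auto simp: Y)
    then show "T y < T k" using k by simp
  qed
  also have "2 ^ T k \<le> A"
  proof -
    have "\<exists>x\<in>X. ?r k \<le> ?r x"
    proof (rule ccontr)
      assume "\<not> ?thesis"
      then have "?r ` X \<subseteq> {..<?r k}" by auto
      moreover have "inj_on ?r X"
      proof (rule inj_onI)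
        fix x y assume xy: "x \<in> X" "y \<in> X" "?r x = ?r y"
        show "x = y" by (rule box_eqI[of _ lam]) (use Xc xy n in auto)
      qed
      ultimately have "card X \<le> ?r k" by (metis card_image card_lessThan card_mono finite_lessThan)
      moreover have "{..?r k'} \<subseteq> ?r ` Y"
      proof
        fix i assume "i \<in> {..?r k'}"
        then obtain y where "y < n" "?r y = i" "?c y = ?c k'"
          using box_above[OF lam k(2), of i] by auto
        then show "i \<in> ?r ` Y" using \<open>i \<in> _\<close> by (auto simp: Y)
      qed
      then have "card {..?r k'} \<le> card (?r ` Y)" using f(2) by (intro card_mono) auto
      then have "card {..?r k'} \<le> card Y" using card_image_le[OF f(2), of ?r] by simp
      ultimately show False using f(3) k by simp
    qed
    then obtain x where x: "x \<in> X" "?r k \<le> ?r x" by auto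
    then have "T k \<le> T x" using row_le[of k x] T_le[of k x] Xc[of x] k by auto
    then have "2 ^ T k \<le> (2 ^ T x :: nat)" by (simp add: power_increasing)
    also have "\<dots> \<le> A" unfolding A_def using x f(1) by (intro member_le_sum) auto
    finally show ?thesis .
  qed
  finally have "B < A" .
  have split: "(\<Sum>i<n. ?c i * g i) = ?c k * (\<Sum>x\<in>X. g x) + ?c k' * (\<Sum>y\<in>Y. g y) + (\<Sum>i\<in>{..<n} - (X \<union> Y). ?c i * g i)"
    for g :: "nat \<Rightarrow> nat"
  proof -
    have "{..<n} = (X \<union> Y) \<union> ({..<n} - (X \<union> Y))" using Xc by (auto simp: Y)
    then have "(\<Sum>i<n. ?c i * g i) = (\<Sum>i\<in>(X \<union> Y) \<union> ({..<n} - (X \<union> Y)). ?c i * g i)" by simp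
    also have "\<dots> = (\<Sum>i\<in>X \<union> Y. ?c i * g i) + (\<Sum>i\<in>{..<n} - (X \<union> Y). ?c i * g i)"
      using f by (intro sum.union_disjoint) auto
    also have "(\<Sum>i\<in>X \<union> Y. ?c i * g i) = (\<Sum>i\<in>X. ?c i * g i) + (\<Sum>i\<in>Y. ?c i * g i)"
      using f disj by (intro sum.union_disjoint) auto
    also have "(\<Sum>i\<in>X. ?c i * g i) = ?c k * (\<Sum>x\<in>X. g x)"
      using Xc by (simp add: sum_distrib_left)
    also have "(\<Sum>i\<in>Y. ?c i * g i) = ?c k' * (\<Sum>x\<in>Y. g x)"
      unfolding sum_distrib_left by (intro sum.cong) (auto simp: Y)
    finally show ?thesis .
  qed
  define R where "R = (\<Sum>i\<in>{..<n} - (X \<union> Y). ?c i * 2 ^ T i)"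
  have "(\<Sum>i<n. ?c i * 2 ^ T i) = ?c k * A + ?c k' * B + R"
    unfolding split A_def B_def R_def ..
  also have "\<dots> < ?c k * B + ?c k' * A + R"
  proof -
    obtain d where d: "?c k' = ?c k + d" "d > 0" using jj less_imp_add_positive by metis
    obtain c where c: "A = B + c" "c > 0" using \<open>B < A\<close> less_imp_add_positive by metis
    show ?thesis using c d by (simp add: algebra_simps)
  qed
  also have "\<dots> = (\<Sum>i<n. ?c i * 2 ^ exchange X Y T i)"
  proof -
    have "(\<Sum>x\<in>X. 2 ^ exchange X Y T x) = (\<Sum>x\<in>X. 2 ^ T (order_match X Y x) :: nat)"
      by (intro sum.cong) (auto simp: exchange_def)
    also have "\<dots> = B" unfolding B_def
      by (rule sum.reindex_bij_betw[OF order_match_bij[OF f(1,2,3)]])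
    finally have 1: "(\<Sum>x\<in>X. 2 ^ exchange X Y T x) = B" .
    have "(\<Sum>x\<in>Y. 2 ^ exchange X Y T x) = (\<Sum>x\<in>Y. 2 ^ T (order_match Y X x) :: nat)"
      using disj by (intro sum.cong) (auto simp: exchange_def)
    also have "\<dots> = A" unfolding A_def
      by (rule sum.reindex_bij_betw[OF order_match_bij[OF f(2,1) f(3)[symmetric]]])
    finally have 2: "(\<Sum>x\<in>Y. 2 ^ exchange X Y T x) = A" .
    have 3: "(\<Sum>i\<in>{..<n} - (X \<union> Y). ?c i * 2 ^ exchange X Y T i) = R"
      unfolding R_def by (intro sum.cong) (auto simp: exchange_def)
    show ?thesis unfolding split 1 2 3 ..
  qed
  finally show ?thesis .
qed

text \<open>The weight \<open>\<Phi>\<close> does not depend on the order of the entries in a column and grows when an exchange removes a descent in a row.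
  With the entries of each column fixed, \<open>\<Psi>\<close> grows when a descent in a column is removed by a swap.  Both are bounded, so the
  rewriting ends with semistandard tableaux.\<close>

lemma straightening:
  assumes lam: "number_partition lam n" and V: "subspace V"
    and m: "multilinear_on n V F \<phi>" and ex: "exchange_axioms lam V \<phi>"
    and e: "\<And>a. a \<in> {1..N} \<Longrightarrow> e a \<in> V"
    and T: "T \<in> tuples n {1..N}"
  shows "\<phi> (\<lambda>i\<in>{..<n}. e (T i)) \<in>
    span ((\<lambda>t. \<phi> (\<lambda>i\<in>{..<n}. e (t i))) ` semistandard_tableaux lam N)"
proof -
  have n: "n = sum_list lam" using lam by (simp add: number_partition_def)
  let ?c = "box_column lam" and ?r = "box_row lam"
  let ?e = "\<lambda>T. (\<lambda>i\<in>{..<n}. e (T i))"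
  let ?S = "span ((\<lambda>t. \<phi> (?e t)) ` semistandard_tableaux lam N)"
  define \<Phi> where "\<Phi> T = (\<Sum>i<n. ?c i * 2 ^ T i)" for T :: "nat \<Rightarrow> nat"
  define \<Psi> where "\<Psi> T = (\<Sum>i<n. i * T i)" for T :: "nat \<Rightarrow> nat"
  define MP where "MP = (\<Sum>i<n. ?c i * 2 ^ N)"
  define MQ where "MQ = (\<Sum>i<n. i * N)"
  have bd: "\<Phi> T \<le> MP" "\<Psi> T \<le> MQ" if "T \<in> tuples n {1..N}" for T
    using PiE_mem[OF that] unfolding \<Phi>_def \<Psi>_def MP_def MQ_def
    by (auto intro!: sum_mono power_increasing)
  define \<mu> where "\<mu> T = (MP - \<Phi> T) * (MQ + 1) + (MQ - \<Psi> T)" for T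
  have lex: "\<mu> T' < \<mu> T" if TT: "T \<in> tuples n {1..N}" "T' \<in> tuples n {1..N}"
    "\<Phi> T < \<Phi> T' \<or> \<Phi> T = \<Phi> T' \<and> \<Psi> T < \<Psi> T'" for T T'
  proof (cases "\<Phi> T < \<Phi> T'")
    case True
    then have "MP - \<Phi> T = Suc (MP - \<Phi> T' + (\<Phi> T' - \<Phi> T - 1))" using bd(1)[OF TT(2)] by simp
    then obtain d where d: "MP - \<Phi> T = Suc (MP - \<Phi> T' + d)" by blast
    have "\<mu> T' \<le> (MP - \<Phi> T') * (MQ + 1) + MQ" by (simp add: \<mu>_def)
    also have "\<dots> < Suc (MP - \<Phi> T' + d) * (MQ + 1)" by (simp add: algebra_simps)
    also have "\<dots> \<le> \<mu> T" unfolding \<mu>_def d by simp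
    finally show ?thesis .
  next
    case False
    then show ?thesis using TT(3) bd(2)[OF TT(2)] by (auto simp: \<mu>_def)
  qed
  have eV: "?e T \<in> tuples n V" if "T \<in> tuples n {1..N}" for T
    using PiE_mem[OF that] e by auto
  have alt: "\<phi> w = 0"
    if "w \<in> tuples n V" "k < n" "k' < n" "k \<noteq> k'" "?c k = ?c k'" "w k = w k'" for w k k'
    using exchange_axioms_alternating[OF ex] that n by blast
  show ?thesis using T
  proof (induction "\<mu> T" arbitrary: T rule: less_induct)
    case less
    note T = less.prems
    have Tn: "T i \<in> {1..N}" if "i < n" for i using PiE_mem[OF T, of i] that by simp
    consider (eq) k k' where "k < k'" "k' < n" "?c k = ?c k'" "T k = T k'"
      | (gr) k k' where "k < k'" "k' < n" "?c k = ?c k'" "T k' < T k"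
      | (ss) "T \<in> semistandard_tableaux lam N"
      | (row) k k' where "\<And>k k'. k < k' \<Longrightarrow> k' < n \<Longrightarrow> ?c k = ?c k' \<Longrightarrow> T k < T k'"
        "k < k'" "k' < n" "?r k = ?r k'" "T k' < T k"
    proof (cases "\<forall>k k'. k < k' \<longrightarrow> k' < n \<longrightarrow> ?c k = ?c k' \<longrightarrow> T k < T k'")
      case True
      then show ?thesis
      proof (cases "\<forall>k k'. k < k' \<longrightarrow> k' < n \<longrightarrow> ?r k = ?r k' \<longrightarrow> T k \<le> T k'")
        case rows: True
        have "T \<in> semistandard_tableaux lam N" unfolding semistandard_iff
          using True rows T n by blast
        then show ?thesis by (rule ss)
      next
        case False
        then show ?thesis using row True by (metis not_le)
      qed
    next
      case False
      then show ?thesis using eq gr by (metis linorder_neqE_nat)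
    qed
    then show ?case
    proof cases
      case eq
      then have "\<phi> (?e T) = 0" by (intro alt[OF eV[OF T], of k k']) auto
      then show ?thesis by (simp add: span_zero)
    next
      case gr
      let ?\<tau> = "Transposition.transpose k k'"
      let ?T = "T \<circ> ?\<tau>"
      have kn: "k < n" "k' < n" "k \<noteq> k'" using gr by auto
      have T': "?T \<in> tuples n {1..N}"
      proof (rule PiE_I)
        fix i assume "i \<in> {..<n}"
        then have "?\<tau> i < n" using kn by (auto simp: Transposition.transpose_def)
        then show "?T i \<in> {1..N}" using Tn by simp
      next
        fix i assume "i \<notin> {..<n}"
        then show "?T i = undefined" using kn PiE_arb[OF T, of i] by (auto simp: Transposition.transpose_def)
      qed
      have "\<phi> (?e ?T) = - \<phi> (?e T)"
      proof -
        have "?e ?T = ?e T \<circ> ?\<tau>" using kn by (auto simp: fun_eq_iff Transposition.transpose_def)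
        then show ?thesis
          using alternating_swap[OF m V kn _ eV[OF T]] alt kn gr(3) by metis
      qed
      moreover have "\<phi> (?e ?T) \<in> ?S"
      proof (rule less.hyps[OF lex[OF T T'] T'])
        have rest: "(\<Sum>i\<in>{..<n} - {k, k'}. g i (?T i)) = (\<Sum>i\<in>{..<n} - {k, k'}. g i (T i))"
          for g :: "nat \<Rightarrow> nat \<Rightarrow> nat"
          by (intro sum.cong) (auto simp: Transposition.transpose_def)
        have "\<Phi> T = \<Phi> ?T"
          unfolding \<Phi>_def using rest[of "\<lambda>i a. ?c i * 2 ^ a"] gr(3) by (simp add: sum_extract_two[OF kn])
        moreover have "\<Psi> T < \<Psi> ?T"
        proof -
          obtain d where d: "k' = k + d" "d > 0" using gr(1) less_imp_add_positive by metis
          obtain c where c: "T k = T k' + c" "c > 0" using gr(4) less_imp_add_positive by metis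
          have "k * T k + k' * T k' < k * T k' + k' * T k"
            unfolding c using d c(2) by (simp add: algebra_simps)
          then show ?thesis
            unfolding \<Psi>_def using rest[of "\<lambda>i a. i * a"] by (simp add: sum_extract_two[OF kn])
        qed
        ultimately show "\<Phi> T < \<Phi> ?T \<or> \<Phi> T = \<Phi> ?T \<and> \<Psi> T < \<Psi> ?T" by blast
      qed
      ultimately show ?thesis using span_neg[of "\<phi> (?e ?T)"] by simp
    next
      case ss
      then show ?thesis by (intro span_base) auto
    next
      case row
      define Y where "Y = {y. y < n \<and> ?c y = ?c k' \<and> ?r y \<le> ?r k'}"
      have Y: "Y \<subseteq> diagram_column lam (?c k')" by (auto simp: Y_def n diagram_column_eq)
      have jj: "?c k < ?c k'" using box_column_less[OF row(2)] row n by simp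
      have "\<phi> (?e T) = (\<Sum>X\<in>exchanges lam (?c k) Y. \<phi> (exchange X Y (?e T)))"
        using ex eV[OF T] jj Y unfolding exchange_axioms_def n by blast
      also have "\<dots> \<in> ?S"
      proof (rule span_sum)
        fix X assume X: "X \<in> exchanges lam (?c k) Y"
        have T': "exchange X Y T \<in> tuples n {1..N}" using exchange_in_tuples[OF X Y] T n by simp
        have "\<Phi> T < \<Phi> (exchange X Y T)" unfolding \<Phi>_def
          by (rule exchange_increases_weight[OF lam row(1) row(2-5) Y_def X])
        then have "\<phi> (?e (exchange X Y T)) \<in> ?S" by (intro less.hyps[OF lex[OF T T'] T']) simp
        then show "\<phi> (exchange X Y (?e T)) \<in> ?S" by (simp only: exchange_comp[OF X Y n, of e T])
      qed
      finally show ?thesis .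
    qed
  qed
qed

section \<open>Determinants indexed by boxes\<close>

text \<open>The determinant of a matrix whose rows and columns are indexed by the same finite set of numbers, in the
  application the boxes of a column of the diagram.\<close>

definition leibniz :: "nat set \<Rightarrow> (nat \<Rightarrow> nat \<Rightarrow> 'a::comm_ring_1) \<Rightarrow> 'a" where
  "leibniz C A = (\<Sum>\<pi> | \<pi> permutes C. of_int (sign \<pi>) * (\<Prod>k\<in>C. A (\<pi> k) k))"

lemma leibniz_cong:
  "(\<And>a k. a \<in> C \<Longrightarrow> k \<in> C \<Longrightarrow> A a k = B a k) \<Longrightarrow> leibniz C A = leibniz C B"
  unfolding leibniz_def by (intro sum.cong prod.cong arg_cong2[where f = "(*)"]) (auto simp: permutes_in_image)

lemma leibniz_column_linear:
  fixes A :: "nat \<Rightarrow> nat \<Rightarrow> real"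
  assumes C: "finite C" and k: "k \<in> C"
  obtains c where "\<And>x. leibniz C (\<lambda>a i. if i = k then x a else A a i) = (\<Sum>a\<in>C. x a * c a)"
proof -
  let ?P = "{\<pi>. \<pi> permutes C}"
  define c where "c a = (\<Sum>\<pi>\<in>{\<pi> \<in> ?P. \<pi> k = a}. of_int (sign \<pi>) * (\<Prod>i\<in>C - {k}. A (\<pi> i) i))" for a
  have "leibniz C (\<lambda>a i. if i = k then x a else A a i) = (\<Sum>a\<in>C. x a * c a)" for x
  proof -
    have "(\<Prod>i\<in>C. if i = k then x (\<pi> i) else A (\<pi> i) i) = x (\<pi> k) * (\<Prod>i\<in>C - {k}. A (\<pi> i) i)" for \<pi>
    proof -
      have "(\<Prod>i\<in>C - {k}. if i = k then x (\<pi> i) else A (\<pi> i) i) = (\<Prod>i\<in>C - {k}. A (\<pi> i) i)"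
        by (rule prod.cong) auto
      then show ?thesis by (simp add: prod.remove[OF C k])
    qed
    then have "leibniz C (\<lambda>a i. if i = k then x a else A a i) =
        (\<Sum>\<pi>\<in>?P. x (\<pi> k) * (of_int (sign \<pi>) * (\<Prod>i\<in>C - {k}. A (\<pi> i) i)))"
      unfolding leibniz_def by (intro sum.cong refl) (simp only: mult.left_commute)
    also have "\<dots> = (\<Sum>a\<in>C. \<Sum>\<pi>\<in>{\<pi> \<in> ?P. \<pi> k = a}. x (\<pi> k) * (of_int (sign \<pi>) * (\<Prod>i\<in>C - {k}. A (\<pi> i) i)))"
      by (rule sum.group[symmetric]) (auto simp: C k finite_permutations permutes_in_image)
    also have "\<dots> = (\<Sum>a\<in>C. x a * c a)"
      unfolding c_def sum_distrib_left by (rule sum.cong[OF refl], rule sum.cong[OF refl]) simp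
    finally show ?thesis .
  qed
  then show thesis by (rule that)
qed

lemma leibniz_transpose: "finite C \<Longrightarrow> leibniz C (\<lambda>a k. A k a) = leibniz C A"
proof -
  assume C: "finite C"
  have "leibniz C (\<lambda>a k. A k a) = (\<Sum>\<pi> | \<pi> permutes C. of_int (sign (inv \<pi>)) * (\<Prod>k\<in>C. A k (inv \<pi> k)))"
    unfolding leibniz_def by (rule sum_permutations_inverse)
  also have "\<dots> = leibniz C A" unfolding leibniz_def
  proof (rule sum.cong[OF refl])
    fix \<pi> assume "\<pi> \<in> {\<pi>. \<pi> permutes C}"
    then have p: "\<pi> permutes C" by simp
    have "(\<Prod>k\<in>C. A k (inv \<pi> k)) = (\<Prod>k\<in>C. A (\<pi> k) (inv \<pi> (\<pi> k)))"
      by (rule prod.permute[OF p, unfolded o_def])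
    then show "of_int (sign (inv \<pi>)) * (\<Prod>k\<in>C. A k (inv \<pi> k)) = of_int (sign \<pi>) * (\<Prod>k\<in>C. A (\<pi> k) k)"
      using p C by (simp add: permutes_inverses sign_inverse permutes_imp_permutation)
  qed
  finally show ?thesis .
qed

lemma leibniz_equal_columns:
  fixes A :: "nat \<Rightarrow> nat \<Rightarrow> real"
  assumes C: "finite C" and k: "k \<in> C" "k' \<in> C" "k \<noteq> k'" and eq: "\<And>a. a \<in> C \<Longrightarrow> A a k = A a k'"
  shows "leibniz C A = 0"
proof -
  let ?\<tau> = "Transposition.transpose k k'"
  have \<tau>: "?\<tau> permutes C" using k by (simp add: permutes_swap_id)
  let ?t = "\<lambda>\<pi>. of_int (sign \<pi>) * (\<Prod>i\<in>C. A (\<pi> i) i)"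
  have "leibniz C A = (\<Sum>\<pi> | \<pi> permutes C. ?t (\<pi> \<circ> ?\<tau>))"
    unfolding leibniz_def by (rule sum_permutations_compose_right[OF \<tau>])
  also have "\<dots> = (\<Sum>\<pi> | \<pi> permutes C. - ?t \<pi>)"
  proof (rule sum.cong[OF refl])
    fix \<pi> assume "\<pi> \<in> {\<pi>. \<pi> permutes C}"
    then have p: "\<pi> permutes C" by simp
    have "sign (\<pi> \<circ> ?\<tau>) = - sign \<pi>"
      using p C k(3) permutes_imp_permutation[OF C p] permutes_imp_permutation[OF C \<tau>]
      by (simp add: sign_compose sign_swap_id)
    moreover have "(\<Prod>i\<in>C. A ((\<pi> \<circ> ?\<tau>) i) i) = (\<Prod>i\<in>C. A (\<pi> i) i)"
    proof -
      have "(\<Prod>i\<in>C. A ((\<pi> \<circ> ?\<tau>) i) i) = (\<Prod>i\<in>C. A ((\<pi> \<circ> ?\<tau>) (?\<tau> i)) (?\<tau> i))"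
        by (rule prod.permute[OF \<tau>, unfolded o_def])
      also have "\<dots> = (\<Prod>i\<in>C. A (\<pi> i) i)"
        using eq p by (intro prod.cong) (auto simp: Transposition.transpose_def permutes_in_image)
      finally show ?thesis .
    qed
    ultimately show "?t (\<pi> \<circ> ?\<tau>) = - ?t \<pi>" by simp
  qed
  also have "\<dots> = - leibniz C A" unfolding leibniz_def by (simp add: sum_negf)
  finally show ?thesis by simp
qed

lemma leibniz_insert:
  assumes C: "finite C" and y: "y \<notin> C"
  shows "leibniz (insert y C) A =
    A y y * leibniz C A - (\<Sum>b\<in>C. A b y * leibniz C (\<lambda>a k. A (if a = b then y else a) k))"
proof -
  let ?t = "\<lambda>\<pi>. of_int (sign \<pi>) * (\<Prod>i\<in>insert y C. A (\<pi> i) i)"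
  have inner: "(\<Sum>q | q permutes C. ?t (Transposition.transpose y b \<circ> q)) =
      (if b = y then A y y * leibniz C A else - (A b y * leibniz C (\<lambda>a k. A (if a = b then y else a) k)))"
    if b: "b \<in> insert y C" for b
  proof -
    have "?t (Transposition.transpose y b \<circ> q) = (if b = y then 1 else -1) * A b y *
        (of_int (sign q) * (\<Prod>i\<in>C. A (if q i = b then y else q i) i))" if q: "q permutes C" for q
    proof -
      have "q y = y" using q y by (simp add: permutes_not_in)
      moreover have "Transposition.transpose y b (q i) = (if q i = b then y else q i)" if "i \<in> C" for i
      proof -
        have "q i \<in> C" using that permutes_in_image[OF q, of i] by simp
        then show ?thesis using y by (auto simp: Transposition.transpose_def)
      qed
      ultimately have "(\<Prod>i\<in>insert y C. A ((Transposition.transpose y b \<circ> q) i) i) =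
          A b y * (\<Prod>i\<in>C. A (if q i = b then y else q i) i)"
        using C y by (simp cong: prod.cong)
      moreover have "sign (Transposition.transpose y b \<circ> q) = (if b = y then 1 else -1) * sign q"
        using permutes_imp_permutation[OF C q]
        by (auto simp: sign_compose permutation_swap_id sign_swap_id)
      ultimately show ?thesis by simp
    qed
    then have "(\<Sum>q | q permutes C. ?t (Transposition.transpose y b \<circ> q)) =
        (if b = y then 1 else -1) * A b y * leibniz C (\<lambda>a k. A (if a = b then y else a) k)"
      unfolding leibniz_def sum_distrib_left by (intro sum.cong) auto
    moreover have "leibniz C (\<lambda>a k. A (if a = y then y else a) k) = leibniz C A"
      by (rule leibniz_cong) auto
    ultimately show ?thesis by auto
  qed
  have "leibniz (insert y C) A = (\<Sum>b\<in>insert y C. \<Sum>q | q permutes C. ?t (Transposition.transpose y b \<circ> q))"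
    unfolding leibniz_def by (rule sum_over_permutations_insert[OF C y])
  also have "\<dots> = A y y * leibniz C A + (\<Sum>b\<in>C. - (A b y * leibniz C (\<lambda>a k. A (if a = b then y else a) k)))"
  proof -
    have "(\<Sum>b\<in>C. \<Sum>q | q permutes C. ?t (Transposition.transpose y b \<circ> q)) =
        (\<Sum>b\<in>C. - (A b y * leibniz C (\<lambda>a k. A (if a = b then y else a) k)))"
      using y inner by (intro sum.cong) auto
    then show ?thesis unfolding sum.insert[OF C y] using inner[of y] by simp
  qed
  finally show ?thesis by (simp add: sum_negf)
qed

text \<open>Cramer's rule, as the expansion of a determinant with two equal rows along one of them.\<close>

lemma leibniz_cramer:
  fixes A :: "nat \<Rightarrow> nat \<Rightarrow> real"
  assumes C: "finite C" and y: "y \<notin> C" and a: "a \<in> C"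
  shows "(\<Sum>i\<in>C. A a i * leibniz C (\<lambda>b k. A b (if k = i then y else k))) = A a y * leibniz C A"
proof -
  define M where "M b k = A (if b = y then a else b) k" for b k
  have "leibniz (insert y C) (\<lambda>k b. M b k) = 0"
    by (rule leibniz_equal_columns[of _ a y]) (use C y a in \<open>auto simp: M_def\<close>)
  moreover have "leibniz (insert y C) (\<lambda>k b. M b k) =
      M y y * leibniz C (\<lambda>k b. M b k) - (\<Sum>i\<in>C. M y i * leibniz C (\<lambda>k b. M b (if k = i then y else k)))"
    by (rule leibniz_insert[OF C y])
  moreover have "leibniz C (\<lambda>k b. M b k) = leibniz C A"
  proof -
    have "leibniz C M = leibniz C A" by (rule leibniz_cong) (use y in \<open>auto simp: M_def\<close>)
    then show ?thesis using leibniz_transpose[OF C, of M] by simp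
  qed
  moreover have "leibniz C (\<lambda>k b. M b (if k = i then y else k)) = leibniz C (\<lambda>b k. A b (if k = i then y else k))" for i
  proof -
    have "leibniz C (\<lambda>b k. M b (if k = i then y else k)) = leibniz C (\<lambda>b k. A b (if k = i then y else k))"
      by (rule leibniz_cong) (use y in \<open>auto simp: M_def\<close>)
    then show ?thesis using leibniz_transpose[OF C, of "\<lambda>b k. M b (if k = i then y else k)"] by simp
  qed
  ultimately show ?thesis using a y by (simp add: M_def)
qed

section \<open>Exchanges along injections\<close>

text \<open>The exchange of \<open>Y\<close> with \<open>f ` Y\<close> in which \<open>y\<close> and \<open>f y\<close> trade places, for an injection \<open>f\<close> that
  may not preserve the order.  Summing over all injections avoids keeping track of the order.\<close>

definition swap_along :: "nat set \<Rightarrow> (nat \<Rightarrow> nat) \<Rightarrow> (nat \<Rightarrow> 'v) \<Rightarrow> nat \<Rightarrow> 'v" where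
  "swap_along Y f v = (\<lambda>k. if k \<in> Y then v (f k) else if k \<in> f ` Y then v (the_inv_into Y f k) else v k)"

lemma tuples_permute:
  assumes "\<pi> permutes S" "S \<subseteq> {..<n}" "v \<in> tuples n V"
  shows "v \<circ> \<pi> \<in> tuples n V"
proof (rule PiE_I)
  have p: "\<pi> permutes {..<n}" using assms permutes_subset by blast
  fix i
  show "(v \<circ> \<pi>) i \<in> V" if "i \<in> {..<n}"
    using that permutes_in_image[OF p, of i] PiE_mem[OF assms(3)] by simp
  show "(v \<circ> \<pi>) i = undefined" if "i \<notin> {..<n}"
    using that permutes_not_in[OF p that] PiE_arb[OF assms(3)] by simp
qed

lemma alternating_permute:
  fixes \<phi> :: "(nat \<Rightarrow> 'v) \<Rightarrow> real"
  assumes alt: "\<And>v k k'. v \<in> tuples n V \<Longrightarrow> k \<in> C \<Longrightarrow> k' \<in> C \<Longrightarrow> k \<noteq> k' \<Longrightarrow>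
      \<phi> (v \<circ> Transposition.transpose k k') = - \<phi> v"
    and C: "finite C" "C \<subseteq> {..<n}" and p: "\<pi> permutes C" and v: "v \<in> tuples n V"
  shows "\<phi> (v \<circ> \<pi>) = of_int (sign \<pi>) * \<phi> v"
  using C(1) p v
proof (induction \<pi> arbitrary: v rule: permutes_rev_induct)
  case id then show ?case by simp
next
  case (swap a b p)
  have "v \<circ> p \<in> tuples n V" by (rule tuples_permute[OF swap.hyps(4) C(2) swap.prems])
  then have "\<phi> ((v \<circ> p) \<circ> Transposition.transpose a b) = - \<phi> (v \<circ> p)"
    using swap alt by auto
  then show ?case
    using swap.IH[OF swap.prems] swap.hyps(3) sign_compose[OF permutes_imp_permutation[OF C(1) swap.hyps(4)] permutation_swap_id, of a b]
    by (simp add: o_assoc sign_swap_id del: o_apply)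
qed

text \<open>Adding a box \<open>y\<close> to \<open>Y\<close>: by the exchange relation for \<open>y\<close> alone, a tuple in which the
  boxes of \<open>Y\<close> have been exchanged is the sum of the tuples in which \<open>y\<close> is exchanged as well. The
  new partner of \<open>y\<close> may have been the partner of some \<open>y'\<close>; these terms are the exchanges along
  the same map after swapping \<open>y\<close> and \<open>y'\<close>, which changes the sign.\<close>

lemma sum_swap_along:
  fixes \<phi> :: "(nat \<Rightarrow> 'v) \<Rightarrow> real"
  assumes single: "\<And>v y. v \<in> tuples n V \<Longrightarrow> y \<in> D \<Longrightarrow> \<phi> v = (\<Sum>i\<in>C. \<phi> (v \<circ> Transposition.transpose y i))"
    and alt: "\<And>v k k'. v \<in> tuples n V \<Longrightarrow> k \<in> D \<Longrightarrow> k' \<in> D \<Longrightarrow> k \<noteq> k' \<Longrightarrow>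
      \<phi> (v \<circ> Transposition.transpose k k') = - \<phi> v"
    and CD: "finite C" "C \<subseteq> {..<n}" "D \<subseteq> {..<n}" "C \<inter> D = {}" and Y: "finite Y" "Y \<subseteq> D"
    and v: "v \<in> tuples n V"
  shows "(\<Sum>f | f \<in> Y \<rightarrow>\<^sub>E C \<and> inj_on f Y. \<phi> (swap_along Y f v)) = fact (card Y) * \<phi> v"
  using Y v
proof (induction Y arbitrary: v rule: finite_induct)
  case empty
  have "{f \<in> {} \<rightarrow>\<^sub>E C. inj_on f {}} = {\<lambda>_. undefined}" by auto
  then show ?case by (simp add: swap_along_def)
next
  case (insert y Y)
  let ?F = "\<lambda>Y. {f. f \<in> Y \<rightarrow>\<^sub>E C \<and> inj_on f Y}"
  have y: "y \<in> D" and YD: "Y \<subseteq> D" using insert.prems by auto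
  have finF: "finite (?F Y)" using insert.hyps CD(1) finite_PiE[of Y "\<lambda>_. C"] by auto
  have IH: "(\<Sum>f\<in>?F Y. \<phi> (swap_along Y f w)) = fact (card Y) * \<phi> w" if "w \<in> tuples n V" for w
    using insert.IH[OF YD that] .
  have bij: "bij_betw (\<lambda>(g, i). g(y := i)) (SIGMA g:?F Y. C - g ` Y) (?F (insert y Y))"
  proof (rule bij_betwI')
    fix p q assume pq: "p \<in> (SIGMA g:?F Y. C - g ` Y)" "q \<in> (SIGMA g:?F Y. C - g ` Y)"
    have pq1: "fst p \<in> Y \<rightarrow>\<^sub>E C" "fst q \<in> Y \<rightarrow>\<^sub>E C" using pq by auto
    have "fst p = fst q" if "(fst p)(y := snd p) = (fst q)(y := snd q)"
    proof
      fix k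
      show "fst p k = fst q k"
      proof (cases "k = y")
        case True
        then show ?thesis using PiE_arb[OF pq1(1)] PiE_arb[OF pq1(2)] insert.hyps by simp
      next
        case False then show ?thesis using fun_cong[OF that, of k] by simp
      qed
    qed
    moreover have "snd p = snd q" if "(fst p)(y := snd p) = (fst q)(y := snd q)"
      using fun_cong[OF that, of y] by simp
    ultimately show "((case p of (g, i) \<Rightarrow> g(y := i)) = (case q of (g, i) \<Rightarrow> g(y := i))) = (p = q)"
      by (auto simp: split_beta prod_eq_iff)
  next
    fix p assume "p \<in> (SIGMA g:?F Y. C - g ` Y)"
    then obtain g i where p: "p = (g, i)" "g \<in> Y \<rightarrow>\<^sub>E C" "inj_on g Y" "i \<in> C" "i \<notin> g ` Y" by auto
    have img: "(g(y := i)) ` Y = g ` Y" using insert.hyps by auto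
    have "inj_on (g(y := i)) Y" using p(3) insert.hyps by (auto simp: inj_on_def)
    then have "inj_on (g(y := i)) (insert y Y)" using img p(5) insert.hyps by (auto simp: inj_on_insert)
    moreover have "g(y := i) \<in> insert y Y \<rightarrow>\<^sub>E C" using p by (auto simp: PiE_iff extensional_def)
    ultimately show "(case p of (g, i) \<Rightarrow> g(y := i)) \<in> ?F (insert y Y)" using p(1) by simp
  next
    fix f assume "f \<in> ?F (insert y Y)"
    then have f: "f \<in> insert y Y \<rightarrow>\<^sub>E C" "inj_on f (insert y Y)" by auto
    let ?g = "restrict f Y"
    have "?g ` Y = f ` Y" by simp
    moreover have "f y \<notin> f ` Y" using f(2) insert.hyps by (auto simp: inj_on_def)
    moreover have "inj_on ?g Y" using f(2) by (auto simp: inj_on_def)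
    moreover have "?g \<in> Y \<rightarrow>\<^sub>E C" "f y \<in> C" using f(1) by (auto simp: PiE_iff)
    ultimately have "(?g, f y) \<in> (SIGMA g:?F Y. C - g ` Y)" by auto
    moreover have "f = ?g(y := f y)" using f(1) by (auto simp: fun_eq_iff PiE_iff extensional_def)
    ultimately show "\<exists>p\<in>(SIGMA g:?F Y. C - g ` Y). f = (case p of (g, i) \<Rightarrow> g(y := i))"
      by (intro bexI[of _ "(?g, f y)"]) simp
  qed
  have outer: "(\<Sum>i\<in>C - g ` Y. \<phi> (swap_along (insert y Y) (g(y := i)) v)) =
      \<phi> (swap_along Y g v) - (\<Sum>y'\<in>Y. \<phi> (swap_along Y g (v \<circ> Transposition.transpose y y')))"
    if g: "g \<in> ?F Y" for g
  proof -
    let ?u = "swap_along Y g v"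
    have gC: "g x \<in> C" if "x \<in> Y" for x using g that by auto
    have ginj: "inj_on g Y" using g by auto
    have inv: "the_inv_into Y g (g x) = x" if "x \<in> Y" for x using the_inv_into_f_f[OF ginj that] .
    have gdisj: "k \<notin> Y" if "k \<in> C" for k using that YD CD(4) by auto
    have yC: "y \<notin> C" using y CD(4) by auto
    have u: "?u \<in> tuples n V"
    proof (rule PiE_I)
      fix k assume k: "k \<in> {..<n}"
      have "g x < n" if "x \<in> Y" for x using gC[OF that] CD(2) by auto
      moreover have "x < n" if "x \<in> Y" for x using that YD CD(3) by auto
      ultimately show "?u k \<in> V"
        using k inv PiE_mem[OF insert.prems(2)] by (auto simp: swap_along_def)
    next
      fix k assume k: "k \<notin> {..<n}"
      then have "k \<notin> Y" "k \<notin> g ` Y" using YD gC CD by auto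
      then show "?u k = undefined" using PiE_arb[OF insert.prems(2) k] by (simp add: swap_along_def)
    qed
    have "\<phi> ?u = (\<Sum>i\<in>C. \<phi> (?u \<circ> Transposition.transpose y i))" by (rule single[OF u y])
    also have "\<dots> = (\<Sum>i\<in>C - g ` Y. \<phi> (?u \<circ> Transposition.transpose y i)) + (\<Sum>i\<in>g ` Y. \<phi> (?u \<circ> Transposition.transpose y i))"
      by (rule sum.subset_diff) (use gC CD in auto)
    also have "(\<Sum>i\<in>C - g ` Y. \<phi> (?u \<circ> Transposition.transpose y i)) =
        (\<Sum>i\<in>C - g ` Y. \<phi> (swap_along (insert y Y) (g(y := i)) v))"
    proof (rule sum.cong[OF refl])
      fix i assume i: "i \<in> C - g ` Y"
      have img: "(g(y := i)) ` insert y Y = insert i (g ` Y)" using insert.hyps by auto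
      have inj': "inj_on (g(y := i)) (insert y Y)"
        using ginj i insert.hyps by (auto simp: inj_on_def)
      have inv1: "the_inv_into (insert y Y) (g(y := i)) i = y"
        using the_inv_into_f_f[OF inj', of y] by simp
      have inv2: "the_inv_into (insert y Y) (g(y := i)) (g x) = x" if "x \<in> Y" for x
        using the_inv_into_f_f[OF inj', of x] that insert.hyps by (auto split: if_splits)
      have "?u \<circ> Transposition.transpose y i = swap_along (insert y Y) (g(y := i)) v"
      proof
        fix k
        consider "k = y" | "k = i" "k \<noteq> y" | "k \<in> Y" "k \<noteq> y" "k \<noteq> i" | x where "x \<in> Y" "k = g x" "k \<noteq> y" "k \<noteq> i" "k \<notin> Y"
          | "k \<notin> Y" "k \<notin> g ` Y" "k \<noteq> y" "k \<noteq> i" by blast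
        then show "(?u \<circ> Transposition.transpose y i) k = swap_along (insert y Y) (g(y := i)) v k"
        proof cases
          case 1
          then show ?thesis using i gdisj[of i] insert.hyps by (simp add: swap_along_def)
        next
          case 2
          then have "k \<notin> Y" "y \<notin> g ` Y" using i gdisj gC yC by auto
          then show ?thesis using 2 i insert.hyps inv1 unfolding swap_along_def img by simp
        next
          case 3
          then show ?thesis by (simp add: swap_along_def)
        next
          case 4
          then show ?thesis using inv inv2 unfolding swap_along_def img by simp
        next
          case 5
          then show ?thesis unfolding swap_along_def img by simp
        qed
      qed
      then show "\<phi> (?u \<circ> Transposition.transpose y i) = \<phi> (swap_along (insert y Y) (g(y := i)) v)" by simp
    qed
    also have "(\<Sum>i\<in>g ` Y. \<phi> (?u \<circ> Transposition.transpose y i)) =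
        (\<Sum>y'\<in>Y. \<phi> (swap_along Y g (v \<circ> Transposition.transpose y y')))"
      unfolding sum.reindex[OF ginj] o_def[of _ g]
    proof (rule sum.cong[OF refl])
      fix y' assume y': "y' \<in> Y"
      have yg: "y \<notin> g ` Y" using gC yC by auto
      have "?u \<circ> Transposition.transpose y (g y') = swap_along Y g (v \<circ> Transposition.transpose y y')"
      proof
        fix k
        have gy: "g y' \<notin> Y" "g y' \<noteq> y" using gC[OF y'] gdisj yC by auto
        consider "k = y" | "k = g y'" | "k \<in> Y" "k \<noteq> y" "k \<noteq> g y'" | x where "x \<in> Y" "k = g x" "k \<noteq> y" "k \<noteq> g y'" "k \<notin> Y"
          | "k \<notin> Y" "k \<notin> g ` Y" "k \<noteq> y" "k \<noteq> g y'" by blast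
        then show "(?u \<circ> Transposition.transpose y (g y')) k = swap_along Y g (v \<circ> Transposition.transpose y y') k"
        proof cases
          case 1
          then show ?thesis using gy y' insert.hyps inv yg by (simp add: swap_along_def)
        next
          case 2
          then show ?thesis using gy y' insert.hyps inv yg by (simp add: swap_along_def)
        next
          case 3
          then have "g k \<noteq> y'" "g k \<noteq> y" using gC gdisj y' yC by auto
          then show ?thesis using 3 by (simp add: swap_along_def)
        next
          case 4
          then have "x \<noteq> y'" "x \<noteq> y" using insert.hyps by auto
          then show ?thesis using 4 inv by (simp add: swap_along_def)
        next
          case 5
          then have "k \<noteq> y'" using y' by auto
          then show ?thesis using 5 by (simp add: swap_along_def)
        qed
      qed
      then show "\<phi> (?u \<circ> Transposition.transpose y (g y')) = \<phi> (swap_along Y g (v \<circ> Transposition.transpose y y'))" by simp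
    qed
    finally show ?thesis by (simp only: add_diff_cancel_right')
  qed
  have "(\<Sum>f\<in>?F (insert y Y). \<phi> (swap_along (insert y Y) f v)) =
      (\<Sum>p\<in>(SIGMA g:?F Y. C - g ` Y). \<phi> (swap_along (insert y Y) (case p of (g, i) \<Rightarrow> g(y := i)) v))"
    by (rule sum.reindex_bij_betw[OF bij, symmetric])
  also have "\<dots> = (\<Sum>g\<in>?F Y. \<Sum>i\<in>C - g ` Y. \<phi> (swap_along (insert y Y) (g(y := i)) v))"
    using finF CD(1) by (subst sum.Sigma) (auto intro!: sum.cong simp: split_beta)
  also have "\<dots> = (\<Sum>g\<in>?F Y. \<phi> (swap_along Y g v)) -
      (\<Sum>y'\<in>Y. \<Sum>g\<in>?F Y. \<phi> (swap_along Y g (v \<circ> Transposition.transpose y y')))"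
    using outer by (subst sum.swap) (simp add: sum_subtractf)
  also have "\<dots> = fact (card Y) * \<phi> v - (\<Sum>y'\<in>Y. - (fact (card Y) * \<phi> v))"
  proof -
    have "v \<circ> Transposition.transpose y y' \<in> tuples n V" if "y' \<in> Y" for y'
      by (rule tuples_permute[of _ "{y, y'}"]) (use that y YD CD(3) insert.prems in \<open>auto simp: permutes_swap_id\<close>)
    moreover have "\<phi> (v \<circ> Transposition.transpose y y') = - \<phi> v" if "y' \<in> Y" for y'
      using alt[OF insert.prems(2) y, of y'] that YD insert.hyps by auto
    ultimately show ?thesis using IH insert.prems(2) by simp
  qed
  also have "\<dots> = fact (card (insert y Y)) * \<phi> v"
    using insert.hyps by (simp add: algebra_simps)
  finally show ?case .
qed

text \<open>All injections with the same image \<open>X\<close> give the same value as the order-preserving one: two of them differ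
  by a permutation of \<open>X\<close>, which acts on both columns and hence with the square of its sign.\<close>

lemma exchange_axiom_from_single:
  fixes \<phi> :: "(nat \<Rightarrow> 'v) \<Rightarrow> real"
  assumes n: "n = sum_list lam"
    and alt: "\<And>v j k k'. v \<in> tuples n V \<Longrightarrow> k \<in> diagram_column lam j \<Longrightarrow> k' \<in> diagram_column lam j \<Longrightarrow> k \<noteq> k' \<Longrightarrow>
      \<phi> (v \<circ> Transposition.transpose k k') = - \<phi> v"
    and single: "\<And>v y. v \<in> tuples n V \<Longrightarrow> y \<in> diagram_column lam j' \<Longrightarrow>
      \<phi> v = (\<Sum>i\<in>diagram_column lam j. \<phi> (v \<circ> Transposition.transpose y i))"
    and j: "j < j'" and Y: "Y \<subseteq> diagram_column lam j'" and v: "v \<in> tuples n V"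
  shows "\<phi> v = (\<Sum>X\<in>exchanges lam j Y. \<phi> (exchange X Y v))"
proof -
  let ?C = "diagram_column lam j" and ?D = "diagram_column lam j'"
  have sub: "?C \<subseteq> {..<n}" "?D \<subseteq> {..<n}" using diagram_column_subset n by auto
  then have fin: "finite ?C" "finite ?D" "finite Y" using Y by (auto intro: finite_subset)
  have disj: "?C \<inter> ?D = {}" using j by (auto simp: diagram_column_eq)
  let ?F = "{f. f \<in> Y \<rightarrow>\<^sub>E ?C \<and> inj_on f Y}"
  have finF: "finite ?F" using finite_PiE[of Y "\<lambda>_. ?C"] fin by auto
  have finX: "finite (exchanges lam j Y)" using fin by (auto simp: exchanges_def)
  have "fact (card Y) * \<phi> v = (\<Sum>f\<in>?F. \<phi> (swap_along Y f v))"
    by (rule sum_swap_along[OF single alt, symmetric, of _ _ ?D]) (use fin sub disj Y v in auto)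
  also have "\<dots> = (\<Sum>X\<in>exchanges lam j Y. \<Sum>f\<in>{f \<in> ?F. f ` Y = X}. \<phi> (swap_along Y f v))"
    by (rule sum.group[symmetric, OF finF finX]) (auto simp: exchanges_def card_image)
  also have "\<dots> = (\<Sum>X\<in>exchanges lam j Y. fact (card Y) * \<phi> (exchange X Y v))"
  proof (rule sum.cong[OF refl])
    fix X assume X: "X \<in> exchanges lam j Y"
    note f = exchanges_finite[OF X Y]
    have XC: "X \<subseteq> ?C" using X by (auto simp: exchanges_def)
    have XY: "X \<inter> Y = {}" using XC Y disj by auto
    let ?m = "order_match Y X" and ?i = "order_match X Y"
    have mb: "bij_betw ?m Y X" using order_match_bij[OF f(2,1)] f(3) by simp
    have mi: "?i (?m y) = y" "?m y \<in> X" "?m y \<notin> Y" if "y \<in> Y" for y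
      using order_match_inverse[OF that f(2,1)] order_match_in[OF that f(2,1)] f(3) XY by auto
    have im: "?m (?i x) = x" "?i x \<in> Y" "?i x \<notin> X" if "x \<in> X" for x
      using order_match_inverse[OF that f(1,2)] order_match_in[OF that f(1,2)] f(3) XY by auto
    let ?w = "exchange X Y v"
    have w: "?w \<in> tuples n V" using exchange_in_tuples[OF X Y] v n by simp
    let ?G = "\<lambda>\<sigma>. restrict (\<sigma> \<circ> ?m) Y"
    have bij: "bij_betw ?G {\<sigma>. \<sigma> permutes X} {f \<in> ?F. f ` Y = X}"
    proof (rule bij_betwI')
      fix \<sigma> \<rho> assume p: "\<sigma> \<in> {\<sigma>. \<sigma> permutes X}" "\<rho> \<in> {\<sigma>. \<sigma> permutes X}"
      have "\<sigma> = \<rho>" if eq: "?G \<sigma> = ?G \<rho>"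
      proof
        fix x
        show "\<sigma> x = \<rho> x"
        proof (cases "x \<in> X")
          case True
          then show ?thesis using fun_cong[OF eq, of "?i x"] im by simp
        next
          case False
          then show ?thesis using p permutes_not_in[of \<sigma> X x] permutes_not_in[of \<rho> X x] by simp
        qed
      qed
      then show "(?G \<sigma> = ?G \<rho>) = (\<sigma> = \<rho>)" by auto
    next
      fix \<sigma> assume "\<sigma> \<in> {\<sigma>. \<sigma> permutes X}"
      then have p: "\<sigma> permutes X" by simp
      have "bij_betw (\<sigma> \<circ> ?m) Y X" using bij_betw_trans[OF mb permutes_imp_bij[OF p]] .
      then have "bij_betw (?G \<sigma>) Y X" by (rule bij_betw_cong[THEN iffD1, rotated]) simp
      then have "inj_on (?G \<sigma>) Y" "?G \<sigma> ` Y = X" by (auto simp: bij_betw_def)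
      moreover have "?G \<sigma> \<in> Y \<rightarrow>\<^sub>E ?C" using \<open>?G \<sigma> ` Y = X\<close> XC by (auto simp: PiE_iff)
      ultimately show "?G \<sigma> \<in> {f \<in> ?F. f ` Y = X}" by auto
    next
      fix g assume "g \<in> {f \<in> ?F. f ` Y = X}"
      then have g: "g \<in> Y \<rightarrow>\<^sub>E ?C" "inj_on g Y" "g ` Y = X" by auto
      define \<sigma> where "\<sigma> x = (if x \<in> X then g (?i x) else x)" for x
      have "bij_betw (g \<circ> ?i) X X"
        by (rule bij_betw_trans[OF order_match_bij[OF f(1,2,3)]]) (use g in \<open>auto simp: bij_betw_def\<close>)
      then have "bij_betw \<sigma> X X" by (rule bij_betw_cong[THEN iffD1, rotated]) (simp add: \<sigma>_def)
      then have "\<sigma> permutes X" by (rule bij_imp_permutes) (simp add: \<sigma>_def)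
      moreover have "g = ?G \<sigma>"
        using mi g(1) by (auto simp: fun_eq_iff \<sigma>_def PiE_arb[OF g(1)])
      ultimately show "\<exists>\<sigma>\<in>{\<sigma>. \<sigma> permutes X}. g = ?G \<sigma>" by auto
    qed
    have altY: "\<phi> (v \<circ> Transposition.transpose k k') = - \<phi> v"
      if "v \<in> tuples n V" "k \<in> Y" "k' \<in> Y" "k \<noteq> k'" for v k k'
      by (rule alt[OF that(1) _ _ that(4), of j']) (use that Y in auto)
    have altX: "\<phi> (v \<circ> Transposition.transpose k k') = - \<phi> v"
      if "v \<in> tuples n V" "k \<in> X" "k' \<in> X" "k \<noteq> k'" for v k k'
      by (rule alt[OF that(1) _ _ that(4), of j]) (use that XC in auto)
    have eq: "\<phi> (swap_along Y (?G \<sigma>) v) = \<phi> ?w" if p: "\<sigma> permutes X" for \<sigma>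
    proof -
      define M where "M x = (if x \<in> X then ?i x else if x \<in> Y then ?m x else x)" for x
      have M2: "M (M x) = x" for x using mi im by (auto simp: M_def)
      have Mp: "M permutes X \<union> Y"
      proof (rule bij_imp_permutes)
        have Min: "M x \<in> X \<union> Y" if "x \<in> X \<union> Y" for x using that mi im by (auto simp: M_def)
        show "bij_betw M (X \<union> Y) (X \<union> Y)" by (rule bij_betwI[of _ _ _ M]) (use Min M2 in auto)
      qed (auto simp: M_def)
      have pM: "permutation M" "permutation \<sigma>"
        using Mp p f(1,2) by (auto intro: permutes_imp_permutation)
      define \<rho> where "\<rho> = M \<circ> \<sigma> \<circ> M"
      have \<rho>y: "\<rho> y = ?i (\<sigma> (?m y))" if "y \<in> Y" for y
        using that mi[OF that] XY permutes_in_image[OF p, of "?m y"] by (auto simp: \<rho>_def M_def)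
      have \<rho>p: "\<rho> permutes Y"
      proof (rule bij_imp_permutes)
        have "bij \<rho>" unfolding \<rho>_def using pM by (intro bij_comp permutation_bijective)
        moreover have "\<rho> ` Y = Y"
        proof (rule endo_inj_surj[OF f(2)])
          show "\<rho> ` Y \<subseteq> Y" using \<rho>y mi im permutes_in_image[OF p] by auto
          show "inj_on \<rho> Y" using \<open>bij \<rho>\<close> by (meson bij_is_inj inj_on_subset subset_UNIV)
        qed
        ultimately show "bij_betw \<rho> Y Y" by (auto simp: bij_betw_def intro: inj_on_subset)
        show "\<rho> x = x" if "x \<notin> Y" for x
        proof (cases "x \<in> X")
          case True
          then have "\<sigma> (?i x) = ?i x" using im[OF True] permutes_not_in[OF p] by auto
          then show ?thesis using True im[OF True] by (simp add: \<rho>_def M_def)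
        next
          case False
          then show ?thesis using that permutes_not_in[OF p False] by (simp add: \<rho>_def M_def)
        qed
      qed
      have s\<rho>: "sign \<rho> = sign \<sigma>"
      proof -
        have "sign \<rho> = sign M * sign \<sigma> * sign M" unfolding \<rho>_def
          using pM by (simp add: sign_compose permutation_compose)
        then show ?thesis by (cases M rule: sign_cases) auto
      qed
      have inv\<sigma>: "inv \<sigma> permutes X" by (rule permutes_inv[OF p])
      have "swap_along Y (?G \<sigma>) v = (?w \<circ> inv \<sigma>) \<circ> \<rho>"
      proof
        fix k
        have "?G \<sigma> \<in> {f \<in> ?F. f ` Y = X}" by (rule bij_betw_apply[OF bij]) (simp add: p)
        then have img: "?G \<sigma> ` Y = X" and injG: "inj_on (?G \<sigma>) Y" by blast+
        consider "k \<in> Y" | "k \<in> X" | "k \<notin> X" "k \<notin> Y" by blast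
        then show "swap_along Y (?G \<sigma>) v k = ((?w \<circ> inv \<sigma>) \<circ> \<rho>) k"
        proof cases
          case 1
          have "\<rho> k \<in> Y" "\<rho> k \<notin> X" using 1 permutes_in_image[OF \<rho>p] XY by auto
          then have "inv \<sigma> (\<rho> k) = \<rho> k" using permutes_not_in[OF inv\<sigma>] by simp
          moreover have "?w (\<rho> k) = v (?m (\<rho> k))" using \<open>\<rho> k \<in> Y\<close> \<open>\<rho> k \<notin> X\<close> by (simp add: exchange_def)
          moreover have "?m (\<rho> k) = \<sigma> (?m k)"
            using \<rho>y[OF 1] im(1)[of "\<sigma> (?m k)"] mi[OF 1] permutes_in_image[OF p] by simp
          ultimately show ?thesis using 1 by (simp add: swap_along_def)
        next
          case 2
          then have k: "k \<notin> Y" using XY by auto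
          have iX: "inv \<sigma> k \<in> X" using 2 permutes_in_image[OF inv\<sigma>] by simp
          have "?G \<sigma> (?i (inv \<sigma> k)) = k" using im[OF iX] permutes_inverses[OF p] by simp
          then have "the_inv_into Y (?G \<sigma>) k = ?i (inv \<sigma> k)"
            using the_inv_into_f_f[OF injG, of "?i (inv \<sigma> k)"] im[OF iX] by simp
          moreover have "\<rho> k = k" using permutes_not_in[OF \<rho>p k] .
          moreover have "?w (inv \<sigma> k) = v (?i (inv \<sigma> k))" using iX by (simp add: exchange_def)
          ultimately show ?thesis using 2 k img unfolding swap_along_def by simp
        next
          case 3
          then have "\<rho> k = k" "inv \<sigma> k = k" using permutes_not_in[OF \<rho>p] permutes_not_in[OF inv\<sigma>] by auto
          then show ?thesis using 3 img unfolding swap_along_def by (simp add: exchange_def)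
        qed
      qed
      moreover have "?w \<circ> inv \<sigma> \<in> tuples n V" by (rule tuples_permute[OF inv\<sigma> _ w]) (use f n in auto)
      moreover have "\<phi> ((?w \<circ> inv \<sigma>) \<circ> \<rho>) = of_int (sign \<rho>) * \<phi> (?w \<circ> inv \<sigma>)" if "?w \<circ> inv \<sigma> \<in> tuples n V"
        by (rule alternating_permute[OF altY f(2) _ \<rho>p that]) (use f n in auto)
      moreover have "\<phi> (?w \<circ> inv \<sigma>) = of_int (sign (inv \<sigma>)) * \<phi> ?w"
        by (rule alternating_permute[OF altX f(1) _ inv\<sigma> w]) (use f n in auto)
      moreover have "of_int (sign \<rho>) * (of_int (sign (inv \<sigma>)) * \<phi> ?w) = \<phi> ?w"
        using s\<rho> pM(2) by (cases \<sigma> rule: sign_cases) (auto simp: sign_inverse)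
      ultimately show ?thesis by simp
    qed
    have "(\<Sum>f\<in>{f \<in> ?F. f ` Y = X}. \<phi> (swap_along Y f v)) = (\<Sum>\<sigma> | \<sigma> permutes X. \<phi> (swap_along Y (?G \<sigma>) v))"
      by (rule sum.reindex_bij_betw[OF bij, symmetric])
    also have "\<dots> = (\<Sum>\<sigma> | \<sigma> permutes X. \<phi> ?w)" using eq by (intro sum.cong) auto
    also have "\<dots> = fact (card Y) * \<phi> ?w" using card_permutations[OF f(3) f(1)] by simp
    finally show "(\<Sum>f\<in>{f \<in> ?F. f ` Y = X}. \<phi> (swap_along Y f v)) = fact (card Y) * \<phi> (exchange X Y v)" .
  qed
  also have "\<dots> = fact (card Y) * (\<Sum>X\<in>exchanges lam j Y. \<phi> (exchange X Y v))"
    by (simp add: sum_distrib_left)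
  finally show ?thesis by simp
qed

section \<open>Bideterminants\<close>

text \<open>Products of minors of the matrix with the functionals \<open>z s\<close> as rows; for generic \<open>z\<close> they span a space of polynomials
  isomorphic to the Schur module.\<close>

definition bideterminant :: "nat list \<Rightarrow> (nat \<Rightarrow> 'v \<Rightarrow> real) \<Rightarrow> (nat \<Rightarrow> 'v) \<Rightarrow> real" where
  "bideterminant lam z v =
     (\<Prod>j<sum_list lam. leibniz (diagram_column lam j) (\<lambda>a k. z (box_row lam a) (v k)))"

lemma box_column_lt: "k < sum_list lam \<Longrightarrow> box_column lam k < sum_list lam"
  by (simp add: box_column_def)

lemma finite_diagram_column: "finite (diagram_column lam j)"
  using diagram_column_subset finite_subset by blast

text \<open>Only the factor of the column containing \<open>i\<close> depends on the entry \<open>x\<close>, through the expansion along this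
  entry.\<close>

lemma bideterminant_update:
  assumes i: "i < sum_list lam"
  obtains c where "\<And>x. bideterminant lam z (v(i := x)) =
    (\<Sum>a\<in>diagram_column lam (box_column lam i). z (box_row lam a) x * c a)"
proof -
  let ?C = "diagram_column lam" and ?j = "box_column lam i"
  have iC: "i \<in> ?C j \<longleftrightarrow> j = ?j" for j using i by (auto simp: diagram_column_eq)
  obtain c where c: "\<And>x. leibniz (?C ?j) (\<lambda>a k. if k = i then x a else z (box_row lam a) (v k)) = (\<Sum>a\<in>?C ?j. x a * c a)"
    by (rule leibniz_column_linear[OF finite_diagram_column, of i lam ?j "\<lambda>a k. z (box_row lam a) (v k)"])
      (use iC that in auto)
  define R where "R = (\<Prod>j\<in>{..<sum_list lam} - {?j}. leibniz (?C j) (\<lambda>a k. z (box_row lam a) (v k)))"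
  have "bideterminant lam z (v(i := x)) = (\<Sum>a\<in>?C ?j. z (box_row lam a) x * (c a * R))" for x
  proof -
    have "bideterminant lam z (v(i := x)) = leibniz (?C ?j) (\<lambda>a k. z (box_row lam a) ((v(i := x)) k)) *
        (\<Prod>j\<in>{..<sum_list lam} - {?j}. leibniz (?C j) (\<lambda>a k. z (box_row lam a) ((v(i := x)) k)))"
      unfolding bideterminant_def by (rule prod.remove) (use box_column_lt[OF i] in auto)
    also have "(\<Prod>j\<in>{..<sum_list lam} - {?j}. leibniz (?C j) (\<lambda>a k. z (box_row lam a) ((v(i := x)) k))) = R"
      unfolding R_def
    proof (rule prod.cong[OF refl])
      fix j assume "j \<in> {..<sum_list lam} - {?j}"
      then have "i \<notin> ?C j" using iC by auto
      then show "leibniz (?C j) (\<lambda>a k. z (box_row lam a) ((v(i := x)) k)) = leibniz (?C j) (\<lambda>a k. z (box_row lam a) (v k))"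
        by (intro leibniz_cong) auto
    qed
    also have "leibniz (?C ?j) (\<lambda>a k. z (box_row lam a) ((v(i := x)) k)) =
        leibniz (?C ?j) (\<lambda>a k. if k = i then z (box_row lam a) x else z (box_row lam a) (v k))"
      by (intro leibniz_cong) auto
    also have "\<dots> = (\<Sum>a\<in>?C ?j. z (box_row lam a) x * c a)" by (rule c)
    finally show ?thesis by (simp only: sum_distrib_right mult.assoc)
  qed
  then show thesis by (rule that)
qed

lemma bideterminant_multilinear:
  assumes z: "\<And>s. linear (z s)"
  shows "multilinear_on (sum_list lam) V UNIV (bideterminant lam z)"
  unfolding multilinear_on_def
proof (intro conjI ballI allI impI)
  fix v and i x y assume i: "i < sum_list lam"
  obtain c where "\<And>x. bideterminant lam z (v(i := x)) =
    (\<Sum>a\<in>diagram_column lam (box_column lam i). z (box_row lam a) x * c a)"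
    by (rule bideterminant_update[OF i, where z = z and v = v]) (rule that)
  then show "bideterminant lam z (v(i := x + y)) = bideterminant lam z (v(i := x)) + bideterminant lam z (v(i := y))"
    by (simp add: linear_add[OF z] algebra_simps sum.distrib)
next
  fix v and i and d :: real and x assume i: "i < sum_list lam"
  obtain c where "\<And>x. bideterminant lam z (v(i := x)) =
    (\<Sum>a\<in>diagram_column lam (box_column lam i). z (box_row lam a) x * c a)"
    by (rule bideterminant_update[OF i, where z = z and v = v]) (rule that)
  then show "bideterminant lam z (v(i := d *\<^sub>R x)) = d *\<^sub>R bideterminant lam z (v(i := x))"
    by (simp add: linear_scale[OF z] sum_distrib_left mult.assoc)
qed auto

lemma bideterminant_equal:
  assumes "k \<in> diagram_column lam j" "k' \<in> diagram_column lam j" "k \<noteq> k'" "v k = v k'"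
  shows "bideterminant lam z v = 0"
proof -
  have "leibniz (diagram_column lam j) (\<lambda>a k. z (box_row lam a) (v k)) = 0"
    by (rule leibniz_equal_columns[OF finite_diagram_column assms(1-3)]) (simp add: assms(4))
  moreover have "j < sum_list lam" using assms(1) box_column_lt by (auto simp: diagram_column_eq)
  ultimately show ?thesis unfolding bideterminant_def by (intro prod_zero) auto
qed

text \<open>The minor of the right column is a linear combination of the values \<open>z (box_row lam a) (v y)\<close>.  Multiplied with the minor of
  the left column, each of these values can be distributed over the left column by Cramer's rule.\<close>

lemma bideterminant_exchange_single:
  assumes z: "\<And>s. linear (z s)" and j: "j < j'" and y: "y \<in> diagram_column lam j'"
  shows "bideterminant lam z v = (\<Sum>i\<in>diagram_column lam j. bideterminant lam z (v \<circ> Transposition.transpose y i))"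
proof -
  let ?C = "diagram_column lam" and ?r = "box_row lam"
  let ?L = "\<lambda>v j. leibniz (?C j) (\<lambda>a k. z (?r a) (v k))"
  have jn: "j' < sum_list lam" using y box_column_lt by (auto simp: diagram_column_eq)
  have yj: "y \<notin> ?C j" using j y by (auto simp: diagram_column_eq)
  define R where "R = (\<Prod>i\<in>{..<sum_list lam} - {j, j'}. ?L v i)"
  have split: "bideterminant lam z u = ?L u j * ?L u j' * (\<Prod>i\<in>{..<sum_list lam} - {j, j'}. ?L u i)" for u
  proof -
    have "{..<sum_list lam} = insert j (insert j' ({..<sum_list lam} - {j, j'}))" using j jn by auto
    then have "bideterminant lam z u = (\<Prod>i\<in>insert j (insert j' ({..<sum_list lam} - {j, j'})). ?L u i)"
      by (simp add: bideterminant_def)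
    then show ?thesis using j by simp
  qed
  obtain c where c: "\<And>x. leibniz (?C j') (\<lambda>a k. if k = y then x a else z (?r a) (v k)) = (\<Sum>a\<in>?C j'. x a * c a)"
    by (rule leibniz_column_linear[OF finite_diagram_column y, of "\<lambda>a k. z (?r a) (v k)"]) (rule that)
  have trm: "bideterminant lam z (v \<circ> Transposition.transpose y i) =
      leibniz (?C j) (\<lambda>a k. z (?r a) (v (if k = i then y else k))) * (\<Sum>a\<in>?C j'. z (?r a) (v i) * c a) * R"
    if i: "i \<in> ?C j" for i
  proof -
    let ?u = "v \<circ> Transposition.transpose y i"
    have ij: "i \<notin> ?C j'" using i j by (auto simp: diagram_column_eq)
    have "?L ?u j = leibniz (?C j) (\<lambda>a k. z (?r a) (v (if k = i then y else k)))"
      using yj by (intro leibniz_cong) (auto simp: Transposition.transpose_def)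
    moreover have "?L ?u j' = leibniz (?C j') (\<lambda>a k. if k = y then z (?r a) (v i) else z (?r a) (v k))"
      using ij by (intro leibniz_cong) (auto simp: Transposition.transpose_def)
    moreover have "(\<Prod>i\<in>{..<sum_list lam} - {j, j'}. ?L ?u i) = R" unfolding R_def
    proof (rule prod.cong[OF refl])
      fix l assume "l \<in> {..<sum_list lam} - {j, j'}"
      then have "y \<notin> ?C l" "i \<notin> ?C l" using y i by (auto simp: diagram_column_eq)
      then show "?L ?u l = ?L v l" by (intro leibniz_cong) (auto simp: Transposition.transpose_def)
    qed
    ultimately show ?thesis unfolding split[of ?u] by (simp only: c)
  qed
  have cramer: "(\<Sum>i\<in>?C j. z (?r a) (v i) * leibniz (?C j) (\<lambda>a k. z (?r a) (v (if k = i then y else k)))) =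
      z (?r a) (v y) * ?L v j" if a: "a \<in> ?C j'" for a
  proof -
    \<comment> \<open>The row of \<open>a\<close> reaches the column \<open>j'\<close>, hence also the column \<open>j\<close>.\<close>
    have a': "a < sum_list lam" "box_column lam a = j'" using a by (auto simp: diagram_column_eq)
    have "j < lam ! ?r a" using box_coordinates(2)[OF a'(1)] a'(2) j by simp
    then have "sum_list (take (?r a) lam) + j \<in> ?C j" "?r (sum_list (take (?r a) lam) + j) = ?r a"
      using box_coordinates(1)[OF a'(1)] box_unique[of "?r a" lam j] by (auto simp: diagram_column_eq)
    then obtain b where "b \<in> ?C j" "?r b = ?r a" by blast
    then show ?thesis
      using leibniz_cramer[OF finite_diagram_column yj, of b "\<lambda>a k. z (?r a) (v k)"] by simp
  qed
  have "(\<Sum>i\<in>?C j. bideterminant lam z (v \<circ> Transposition.transpose y i)) =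
      (\<Sum>i\<in>?C j. \<Sum>a\<in>?C j'. c a * R * (z (?r a) (v i) * leibniz (?C j) (\<lambda>a k. z (?r a) (v (if k = i then y else k)))))"
    using trm by (simp add: sum_distrib_left sum_distrib_right mult_ac)
  also have "\<dots> = (\<Sum>a\<in>?C j'. c a * R * (z (?r a) (v y) * ?L v j))"
    by (subst sum.swap) (simp add: sum_distrib_left[symmetric] cramer)
  also have "\<dots> = ?L v j * (\<Sum>a\<in>?C j'. z (?r a) (v y) * c a) * R"
    by (simp add: sum_distrib_left sum_distrib_right mult_ac)
  also have "(\<Sum>a\<in>?C j'. z (?r a) (v y) * c a) = ?L v j'"
    unfolding c[symmetric] by (intro leibniz_cong) auto
  also have "?L v j * ?L v j' * R = bideterminant lam z v" unfolding split R_def ..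
  finally show ?thesis ..
qed

lemma bideterminant_exchange_axioms:
  fixes z :: "nat \<Rightarrow> 'v::real_vector \<Rightarrow> real"
  assumes z: "\<And>s. linear (z s)" and V: "subspace V"
  shows "exchange_axioms lam V (bideterminant lam z)"
  unfolding exchange_axioms_def
proof (intro conjI ballI allI impI)
  fix v :: "nat \<Rightarrow> 'v" and j k k' assume "k \<in> diagram_column lam j" "k' \<in> diagram_column lam j" "k \<noteq> k'" "v k = v k'"
  then show "bideterminant lam z v = 0" by (rule bideterminant_equal)
next
  fix v :: "nat \<Rightarrow> 'v" and j j' :: nat and Y
  assume v: "v \<in> tuples (sum_list lam) V" and j: "j < j'" and Y: "Y \<subseteq> diagram_column lam j'"
  show "bideterminant lam z v = (\<Sum>X\<in>exchanges lam j Y. bideterminant lam z (exchange X Y v))"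
  proof (rule exchange_axiom_from_single[OF refl _ _ j Y v])
    fix v :: "nat \<Rightarrow> 'v" and j k k' assume "v \<in> tuples (sum_list lam) V" "k \<in> diagram_column lam j" "k' \<in> diagram_column lam j" "k \<noteq> k'"
    then show "bideterminant lam z (v \<circ> Transposition.transpose k k') = - bideterminant lam z v"
      using bideterminant_equal[of k lam j k'] unfolding diagram_column_eq
      by (intro alternating_swap[OF bideterminant_multilinear[OF z] V]) simp_all
  next
    fix v :: "nat \<Rightarrow> 'v" and y assume "y \<in> diagram_column lam j'"
    then show "bideterminant lam z v = (\<Sum>i\<in>diagram_column lam j. bideterminant lam z (v \<circ> Transposition.transpose y i))"
      by (rule bideterminant_exchange_single[OF z j])
  qed
qed

section \<open>Linear independence of semistandard tableaux\<close>

lemma sum_powers_less: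
  fixes g :: "'i \<Rightarrow> nat"
  assumes D: "finite D" "card D < B" and g: "\<And>k. k \<in> D \<Longrightarrow> g k < t"
  shows "(\<Sum>k\<in>D. B ^ g k) < B ^ t"
proof (cases "D = {}")
  case True then show ?thesis using D by simp
next
  case False
  then obtain u where t: "t = Suc u" using g by (cases t) auto
  have "B ^ g k \<le> B ^ u" if "k \<in> D" for k using g[OF that] D t by (intro power_increasing) auto
  then have "(\<Sum>k\<in>D. B ^ g k) \<le> card D * B ^ u" using sum_bounded_above[of D "\<lambda>k. B ^ g k" "B ^ u"] by simp
  also have "\<dots> < B * B ^ u" using D by simp
  finally show ?thesis by (simp add: t)
qed

text \<open>The entry in row \<open>s\<close> and column \<open>a\<close> of a generic matrix will be replaced by this power of a variable.  The exponent
  exceeds the sum of \<open>n\<close> exponents of lexicographically smaller positions with columns at most \<open>m\<close>; sums of \<open>n\<close> exponents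
  are thus compared by their largest differing terms.\<close>

definition weight :: "nat \<Rightarrow> nat \<Rightarrow> nat \<Rightarrow> nat \<Rightarrow> nat" where
  "weight n m s a = (n + 2) ^ (s * (m + 1) + a)"

definition tableau_weight :: "nat list \<Rightarrow> nat \<Rightarrow> nat set \<Rightarrow> (nat \<Rightarrow> nat) \<Rightarrow> nat" where
  "tableau_weight lam m C t = (\<Sum>k\<in>C. weight (sum_list lam) m (box_row lam k) (t k))"

lemma lex_less: "s < s' \<Longrightarrow> a \<le> m \<Longrightarrow> s * (m + 1) + a < s' * (m + 1) + (b :: nat)"
proof -
  assume "s < s'" "a \<le> m"
  then have "s * (m + 1) + a < (s + 1) * (m + 1)" by (simp add: algebra_simps)
  also have "\<dots> \<le> s' * (m + 1)" using \<open>s < s'\<close> by (intro mult_right_mono) auto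
  finally show ?thesis by simp
qed

text \<open>Let \<open>h\<close> be the lowest box moved by \<open>\<pi>\<close>.  The term of \<open>h\<close> in the diagonal exceeds the sum of the terms of
  all boxes above or equal to \<open>h\<close> for \<open>\<pi>\<close>: each of them has a smaller row, or the same row and a smaller
  entry.\<close>

lemma diagonal_dominates:
  assumes C: "C = diagram_column lam j" and p: "\<pi> permutes C" "\<pi> \<noteq> id"
    and t: "\<And>k. k \<in> C \<Longrightarrow> t k \<in> {1..m}" "\<And>k k'. k \<in> C \<Longrightarrow> k' \<in> C \<Longrightarrow> k < k' \<Longrightarrow> t k < t k'"
  shows "(\<Sum>k\<in>C. weight (sum_list lam) m (box_row lam (\<pi> k)) (t k)) < tableau_weight lam m C t"
proof -
  let ?n = "sum_list lam" and ?r = "box_row lam"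
  have finC: "finite C" unfolding C by (rule finite_diagram_column)
  have Cn: "C \<subseteq> {..<?n}" unfolding C by (rule diagram_column_subset)
  have rless: "?r k < ?r k'" if "k \<in> C" "k' \<in> C" "k < k'" for k k'
    using that box_row_less[of k k' lam] by (auto simp: C diagram_column_eq)
  define M where "M = {k \<in> C. \<pi> k \<noteq> k}"
  have "M \<noteq> {}"
  proof
    assume "M = {}"
    then have "\<pi> k = k" for k using permutes_not_in[OF p(1), of k] by (cases "k \<in> C") (auto simp: M_def)
    then show False using p(2) by auto
  qed
  moreover have "finite M" using finC by (simp add: M_def)
  ultimately have h: "Max M \<in> M" "\<And>k. k \<in> M \<Longrightarrow> k \<le> Max M" by auto
  define h where "h = Max M"
  have hC: "h \<in> C" "\<pi> h \<noteq> h" using h(1) by (auto simp: h_def M_def)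
  have fixd: "\<pi> k = k" if "k \<in> C" "h < k" for k using that h(2)[of k] by (force simp: h_def M_def)
  have pC: "\<pi> k \<in> C" if "k \<in> C" for k using that permutes_in_image[OF p(1)] by simp
  have ple: "\<pi> k \<le> h" if "k \<in> C" "k \<le> h" for k
  proof (rule ccontr)
    assume "\<not> \<pi> k \<le> h"
    then have "\<pi> (\<pi> k) = \<pi> k" using fixd[OF pC[OF that(1)]] by simp
    then have "\<pi> k = k" using permutes_inj[OF p(1)] by (auto dest: injD)
    then show False using that \<open>\<not> \<pi> k \<le> h\<close> by simp
  qed
  define D where "D = {k \<in> C. k \<le> h}"
  have D: "finite D" "D \<subseteq> C" using finC by (auto simp: D_def)
  let ?w = "weight ?n m"
  have "(\<Sum>k\<in>D. ?w (?r (\<pi> k)) (t k)) < ?w (?r h) (t h)"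
    unfolding weight_def
  proof (rule sum_powers_less[OF D(1)])
    have "card D \<le> card {..<?n}" using D Cn by (intro card_mono) auto
    then show "card D < ?n + 2" by simp
    fix k assume "k \<in> D"
    then have k: "k \<in> C" "k \<le> h" by (auto simp: D_def)
    have tk: "t k \<le> m" using t(1)[OF k(1)] by simp
    show "?r (\<pi> k) * (m + 1) + t k < ?r h * (m + 1) + t h"
    proof (cases "\<pi> k = h")
      case True
      then have "k \<noteq> h" using hC by auto
      then have "t k < t h" using t(2)[OF k(1) hC(1)] k by simp
      then show ?thesis using True by simp
    next
      case False
      then have "?r (\<pi> k) < ?r h" using rless[OF pC[OF k(1)] hC(1)] ple[OF k] by simp
      then show ?thesis by (rule lex_less[OF _ tk])
    qed
  qed
  also have "?w (?r h) (t h) \<le> (\<Sum>k\<in>D. ?w (?r k) (t k))"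
    using D(1) hC by (intro member_le_sum) (auto simp: D_def)
  finally have less: "(\<Sum>k\<in>D. ?w (?r (\<pi> k)) (t k)) < (\<Sum>k\<in>D. ?w (?r k) (t k))" .
  have rest: "(\<Sum>k\<in>C - D. ?w (?r (\<pi> k)) (t k)) = (\<Sum>k\<in>C - D. ?w (?r k) (t k))"
    using fixd by (intro sum.cong) (auto simp: D_def)
  show ?thesis unfolding tableau_weight_def
    using less rest sum.subset_diff[OF D(2) finC, of "\<lambda>k. ?w (?r (\<pi> k)) (t k)"]
      sum.subset_diff[OF D(2) finC, of "\<lambda>k. ?w (?r k) (t k)"] by simp
qed

text \<open>At the last box in which two tableaux differ, the one with the larger entry wins, as all boxes of the other one up to
  there have a smaller row, or the same row and a smaller entry.\<close>

lemma tableau_weight_inj: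
  assumes "t \<in> semistandard_tableaux lam m" "t' \<in> semistandard_tableaux lam m" "t \<noteq> t'"
  shows "tableau_weight lam m {..<sum_list lam} t \<noteq> tableau_weight lam m {..<sum_list lam} t'"
proof -
  let ?n = "sum_list lam" and ?r = "box_row lam"
  let ?w = "weight ?n m"
  have less: "tableau_weight lam m {..<?n} t < tableau_weight lam m {..<?n} t'"
    if t: "t \<in> semistandard_tableaux lam m" and h: "h < ?n" "t h < t' h" and eq: "\<And>k. h < k \<Longrightarrow> k < ?n \<Longrightarrow> t k = t' k"
    for t t' h
  proof -
    have D: "{..h} \<subseteq> {..<?n}" using h by auto
    have "(\<Sum>k\<in>{..h}. ?w (?r k) (t k)) < ?w (?r h) (t' h)"
      unfolding weight_def
    proof (rule sum_powers_less)
      show "card {..h} < ?n + 2" using h by simp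
      fix k assume "k \<in> {..h}"
      then have k: "k \<le> h" by simp
      have tk: "t k \<le> m" using t k h PiE_mem[of t "{..<?n}" "\<lambda>_. {1..m}" k] unfolding semistandard_iff by auto
      show "?r k * (m + 1) + t k < ?r h * (m + 1) + t' h"
      proof (cases "?r k = ?r h")
        case True
        have "t k \<le> t h" using t k h True unfolding semistandard_iff by (cases "k = h") auto
        then show ?thesis using True h by simp
      next
        case False
        then have "?r k < ?r h" using box_row_mono[OF k h(1)] by simp
        then show ?thesis by (rule lex_less[OF _ tk])
      qed
    qed auto
    also have "\<dots> \<le> (\<Sum>k\<in>{..h}. ?w (?r k) (t' k))" by (intro member_le_sum) auto
    finally have "(\<Sum>k\<in>{..h}. ?w (?r k) (t k)) < (\<Sum>k\<in>{..h}. ?w (?r k) (t' k))" .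
    moreover have "(\<Sum>k\<in>{..<?n} - {..h}. ?w (?r k) (t k)) = (\<Sum>k\<in>{..<?n} - {..h}. ?w (?r k) (t' k))"
      using eq by (intro sum.cong) auto
    ultimately show ?thesis unfolding tableau_weight_def
      using sum.subset_diff[OF D, of "\<lambda>k. ?w (?r k) (t k)"] sum.subset_diff[OF D, of "\<lambda>k. ?w (?r k) (t' k)"] by simp
  qed
  have ext: "t \<in> extensional {..<?n}" "t' \<in> extensional {..<?n}"
    using assms unfolding semistandard_iff PiE_def by auto
  define M where "M = {k. k < ?n \<and> t k \<noteq> t' k}"
  have "M \<noteq> {}"
  proof
    assume "M = {}"
    then have "t = t'" using ext by (intro extensionalityI) (auto simp: M_def)
    then show False using assms by simp
  qed
  moreover have "finite M" by (simp add: M_def)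
  ultimately have h: "Max M \<in> M" "\<And>k. k \<in> M \<Longrightarrow> k \<le> Max M" by auto
  have eq: "t k = t' k" if "Max M < k" "k < ?n" for k
  proof (rule ccontr)
    assume "t k \<noteq> t' k"
    then have "k \<in> M" using that by (simp add: M_def)
    then show False using h(2)[of k] that by simp
  qed
  have "t (Max M) < t' (Max M) \<or> t' (Max M) < t (Max M)" "Max M < ?n" using h(1) by (auto simp: M_def)
  then show ?thesis using less[OF assms(1), of "Max M" t'] less[OF assms(2), of "Max M" t] eq by force
qed

lemma leibniz_monom_lead:
  assumes C: "C = diagram_column lam j"
    and t: "\<And>k. k \<in> C \<Longrightarrow> t k \<in> {1..m}" "\<And>k k'. k \<in> C \<Longrightarrow> k' \<in> C \<Longrightarrow> k < k' \<Longrightarrow> t k < t k'"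
  defines "p \<equiv> leibniz C (\<lambda>a k. monom (1::real) (weight (sum_list lam) m (box_row lam a) (t k)))"
  shows "degree p = tableau_weight lam m C t" "lead_coeff p = 1"
proof -
  let ?w = "weight (sum_list lam) m" and ?E = "tableau_weight lam m C t"
  have finC: "finite C" unfolding C by (rule finite_diagram_column)
  have pm: "(\<Prod>k\<in>D. monom (1::real) (g k)) = monom 1 (\<Sum>k\<in>D. g k)" if "finite D" for D :: "nat set" and g
    using that by (induction D rule: finite_induct) (auto simp: mult_monom)
  define e where "e \<pi> = (\<Sum>k\<in>C. ?w (box_row lam (\<pi> k)) (t k))" for \<pi>
  have p: "p = (\<Sum>\<pi> | \<pi> permutes C. of_int (sign \<pi>) * monom 1 (e \<pi>))"
    unfolding p_def leibniz_def e_def by (simp add: pm[OF finC])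
  have eid: "e id = ?E" by (simp add: e_def tableau_weight_def)
  have eless: "e \<pi> < ?E" if "\<pi> permutes C" "\<pi> \<noteq> id" for \<pi>
    unfolding e_def by (rule diagonal_dominates[OF C that t])
  have co: "coeff p d = (\<Sum>\<pi> | \<pi> permutes C. of_int (sign \<pi>) * (if e \<pi> = d then 1 else 0))" for d
    unfolding p by (simp add: coeff_sum of_int_poly coeff_monom)
  have "coeff p d = (if d = ?E then 1 else 0)" if "d \<ge> ?E" for d
  proof -
    have "(\<Sum>\<pi>\<in>{\<pi>. \<pi> permutes C} - {id}. of_int (sign \<pi>) * (if e \<pi> = d then 1 else (0::real))) = 0"
      using eless that by (intro sum.neutral) fastforce
    then have "coeff p d = of_int (sign (id :: nat \<Rightarrow> nat)) * (if e id = d then 1 else 0)"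
      unfolding co using finite_permutations[OF finC] by (subst sum.remove[of _ id]) (auto simp: permutes_id)
    then show ?thesis using eid by simp
  qed
  then have E: "coeff p ?E = 1" "\<And>d. d > ?E \<Longrightarrow> coeff p d = 0" by auto
  show deg: "degree p = ?E"
    by (rule antisym[OF degree_le le_degree]) (use E in auto)
  show "lead_coeff p = 1" unfolding deg by (rule E(1))
qed

lemma distinct_degrees_independent:
  fixes p :: "'t \<Rightarrow> real poly"
  assumes S: "finite S" and p: "\<And>t. t \<in> S \<Longrightarrow> p t \<noteq> 0" "inj_on (\<lambda>t. degree (p t)) S"
    and z: "(\<Sum>t\<in>S. smult (c t) (p t)) = 0" and t: "t \<in> S"
  shows "c t = 0"
proof (rule ccontr)
  assume "c t \<noteq> 0"
  let ?N = "{t \<in> S. c t \<noteq> 0}"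
  have N: "finite ?N" "?N \<noteq> {}" using S t \<open>c t \<noteq> 0\<close> by auto
  have "Max ((\<lambda>t. degree (p t)) ` ?N) \<in> (\<lambda>t. degree (p t)) ` ?N" using N by (intro Max_in) auto
  then obtain u where u: "u \<in> ?N" "degree (p u) = Max ((\<lambda>t. degree (p t)) ` ?N)" by auto
  have max: "degree (p s) \<le> degree (p u)" if "s \<in> ?N" for s unfolding u(2) using that N by simp
  have "c s * coeff (p s) (degree (p u)) = 0" if s: "s \<in> S - {u}" for s
  proof (cases "c s = 0")
    case False
    then have "degree (p s) \<le> degree (p u)" using max[of s] s by simp
    moreover have "degree (p s) \<noteq> degree (p u)"
      using inj_onD[OF p(2), of s u] s u(1) by blast
    ultimately show ?thesis by (simp add: coeff_eq_0)
  qed simp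
  then have "(\<Sum>s\<in>S - {u}. c s * coeff (p s) (degree (p u))) = 0" by (intro sum.neutral) blast
  moreover have "0 = (\<Sum>s\<in>S. c s * coeff (p s) (degree (p u)))"
    using arg_cong[OF z, of "\<lambda>q. coeff q (degree (p u))"] by (simp add: coeff_sum)
  ultimately have "c u * lead_coeff (p u) = 0"
    using sum.remove[OF S, of u "\<lambda>s. c s * coeff (p s) (degree (p u))"] u(1) by simp
  then show False using u(1) p(1) by auto
qed

lemma finite_semistandard: "finite (semistandard_tableaux lam m)"
proof (rule finite_subset)
  show "semistandard_tableaux lam m \<subseteq> tuples (sum_list lam) {1..m}" unfolding semistandard_iff subset_iff by blast
qed (simp add: finite_PiE)

text \<open>A linear relation between tableaux gives, by the universal property, a relation between the values of bideterminants at
  every real \<open>x\<close>, hence between polynomials with distinct degrees.\<close>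

lemma tableaux_independent:
  fixes e :: "nat \<Rightarrow> 'v::real_vector" and f :: "nat \<Rightarrow> 'v \<Rightarrow> real"
  assumes V: "subspace V" and n: "n = sum_list lam"
    and f: "\<And>a. linear (f a)" "\<And>a b. a \<in> {1..m} \<Longrightarrow> b \<in> {1..m} \<Longrightarrow> f a (e b) = (if a = b then 1 else 0)"
    and e: "\<And>a. a \<in> {1..m} \<Longrightarrow> e a \<in> V"
    and c: "(\<Sum>t\<in>semistandard_tableaux lam m. c t *\<^sub>R schur_map lam V (\<lambda>k\<in>{..<n}. e (t k))) = 0"
    and t: "t \<in> semistandard_tableaux lam m"
  shows "c t = 0"
proof -
  let ?S = "semistandard_tableaux lam m" and ?w = "weight n m" and ?C = "diagram_column lam"
  define p where "p t = (\<Prod>j<n. leibniz (?C j) (\<lambda>a k. monom (1::real) (?w (box_row lam a) (t k))))" for t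
  have lead: "degree (p t) = tableau_weight lam m {..<n} t \<and> lead_coeff (p t) = 1" if t: "t \<in> ?S" for t
  proof -
    have L: "degree (leibniz (?C j) (\<lambda>a k. monom (1::real) (?w (box_row lam a) (t k)))) = tableau_weight lam m (?C j) t"
      "lead_coeff (leibniz (?C j) (\<lambda>a k. monom (1::real) (?w (box_row lam a) (t k)))) = 1" for j
      unfolding n by (rule leibniz_monom_lead[OF refl]; use t in \<open>force simp: semistandard_iff diagram_column_eq dest: PiE_mem\<close>)+
    have l1: "lead_coeff (p t) = 1" unfolding p_def by (simp add: lead_coeff_prod L(2))
    have "degree (p t) = (\<Sum>j<n. tableau_weight lam m (?C j) t)"
      unfolding p_def using L(2)
      by (subst degree_prod_eq_sum_degree) (auto simp: L(1) intro!: sum.cong, metis L(2) zero_neq_one leading_coeff_0_iff)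
    also have "\<dots> = tableau_weight lam m {..<n} t"
    proof -
      have "(\<Sum>j<n. \<Sum>k\<in>{k \<in> {..<n}. box_column lam k = j}. weight n m (box_row lam k) (t k)) =
          (\<Sum>k<n. weight n m (box_row lam k) (t k))"
        by (rule sum.group) (use box_column_lt n in auto)
      moreover have "{k \<in> {..<n}. box_column lam k = j} = ?C j" for j by (auto simp: diagram_column_eq n)
      ultimately show ?thesis by (simp add: tableau_weight_def n)
    qed
    finally show ?thesis using l1 by simp
  qed
  have "poly (\<Sum>t\<in>?S. smult (c t) (p t)) x = 0" for x
  proof -
    define z where "z s v = (\<Sum>a\<in>{1..m}. x ^ ?w s a * f a v)" for s v
    have z: "linear (z s)" for s unfolding z_def
      by (intro linear_compose_sum ballI) (use f(1) in \<open>auto simp: linear_iff algebra_simps\<close>)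
    have ze: "z s (e a) = x ^ ?w s a" if "a \<in> {1..m}" for s a
    proof -
      have "z s (e a) = (\<Sum>b\<in>{1..m}. if b = a then x ^ ?w s b else 0)"
        unfolding z_def using f(2) that by (intro sum.cong) auto
      then show ?thesis using that by simp
    qed
    let ?\<phi> = "bideterminant lam z"
    have \<phi>: "multilinear_on (sum_list lam) V UNIV ?\<phi>" "exchange_axioms lam V ?\<phi>"
      by (rule bideterminant_multilinear[OF z], rule bideterminant_exchange_axioms[OF z V])
    have val: "lin_extend ?\<phi> (schur_map lam V (\<lambda>k\<in>{..<n}. e (t k))) = poly (p t) x" if t: "t \<in> ?S" for t
    proof -
      have tk: "t k \<in> {1..m}" if "k < n" for k using t that n unfolding semistandard_iff by (metis PiE_mem lessThan_iff)
      have "?\<phi> (\<lambda>k\<in>{..<n}. e (t k)) = (\<Prod>j<n. leibniz (?C j) (\<lambda>a k. x ^ ?w (box_row lam a) (t k)))"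
        unfolding bideterminant_def n[symmetric]
        by (intro prod.cong leibniz_cong refl) (use tk ze n in \<open>auto simp: diagram_column_eq\<close>)
      also have "\<dots> = poly (p t) x"
        by (simp add: p_def leibniz_def poly_prod poly_sum poly_monom)
      finally show ?thesis using lin_extend_schur_map[OF \<phi>] by simp
    qed
    have "0 = lin_extend ?\<phi> (\<Sum>t\<in>?S. c t *\<^sub>R schur_map lam V (\<lambda>k\<in>{..<n}. e (t k)))"
      unfolding c by (simp add: linear_0[OF linear_lin_extend])
    also have "\<dots> = (\<Sum>t\<in>?S. c t * poly (p t) x)"
      by (simp add: linear_sum[OF linear_lin_extend] linear_scale[OF linear_lin_extend] val)
    finally show ?thesis by (simp add: poly_sum)
  qed
  then have zero: "(\<Sum>t\<in>?S. smult (c t) (p t)) = 0" by (simp add: poly_all_0_iff_0[symmetric])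
  show ?thesis
  proof (rule distinct_degrees_independent[OF finite_semistandard _ _ zero t])
    show "p t \<noteq> 0" if "t \<in> ?S" for t using lead[OF that] by auto
    show "inj_on (\<lambda>t. degree (p t)) ?S"
      using tableau_weight_inj lead n by (intro inj_onI) metis
  qed
qed

section \<open>Schur modules and Schur bodies\<close>

lemma tuples_mono: "v \<in> tuples n P \<Longrightarrow> P \<subseteq> V \<Longrightarrow> v \<in> tuples n V"
  by (meson PiE_mono subsetD)

lemma multilinear_continuous_on:
  fixes \<phi> :: "(nat \<Rightarrow> 'v::real_normed_vector) \<Rightarrow> 'f::real_normed_vector"
  assumes m: "multilinear_on n V F \<phi>" and V: "fin_dim V"
  shows "continuous_on (tuples n V) \<phi>"
proof -
  define r where "r = dim V"
  obtain b where "basis_of (dim V) b V" using basis_of_exists[OF V] .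
  then have b: "basis_of r b V" by (simp add: r_def)
  obtain f where f: "\<And>i. linear (f i)" "\<And>x. x \<in> V \<Longrightarrow> (\<Sum>i<r. f i x *\<^sub>R b i) = x"
    by (rule basis_of_dual[OF b]) (rule that)
  have bV: "b a \<in> V" if "a \<in> {..<r}" for a using b that by (auto simp: basis_of_def intro: span_base)
  have ex: "\<phi> v = (\<Sum>J\<in>tuples n {..<r}. (\<Prod>i<n. f (J i) (v i)) *\<^sub>R \<phi> (\<lambda>i\<in>{..<n}. b (J i)))"
    if "v \<in> tuples n V" for v
    by (rule multilinear_expansion[OF m fin_dim_subspace[OF V] finite_lessThan bV f(2) that])
  have "continuous_on (tuples n V) (\<lambda>v. f a (v i))" if "i < n" for a i
    by (rule continuous_on_compose2[OF linear_continuous_on_fin_dim[OF V f(1)] continuous_on_coordinate])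
      (use that in auto)
  then have "continuous_on (tuples n V) (\<lambda>v. \<Sum>J\<in>tuples n {..<r}. (\<Prod>i<n. f (J i) (v i)) *\<^sub>R \<phi> (\<lambda>i\<in>{..<n}. b (J i)))"
    by (intro continuous_intros) auto
  then show ?thesis by (rule continuous_on_cong[THEN iffD1, rotated 2]) (use ex in auto)
qed

text \<open>A basis of \<open>V\<close> can be chosen inside \<open>P\<close>.\<close>

lemma multilinear_span:
  fixes \<phi> :: "(nat \<Rightarrow> 'v::real_vector) \<Rightarrow> 'f::real_vector"
  assumes m: "multilinear_on n V F \<phi>" and V: "fin_dim V" and P: "span P = V" and v: "v \<in> tuples n V"
  shows "\<phi> v \<in> span (\<phi> ` tuples n P)"
proof -
  define r where "r = dim V"
  obtain b where "basis_of (dim V) b V" "\<And>i. i < dim V \<Longrightarrow> b i \<in> P"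
    by (rule basis_of_exists_in[OF V P]) (rule that)
  then have b: "basis_of r b V" and bP: "\<And>i. i < r \<Longrightarrow> b i \<in> P" by (simp_all add: r_def)
  obtain f where f: "\<And>i. linear (f i)" "\<And>x. x \<in> V \<Longrightarrow> (\<Sum>i<r. f i x *\<^sub>R b i) = x"
    by (rule basis_of_dual[OF b]) (rule that)
  have bV: "b a \<in> V" if "a \<in> {..<r}" for a using b that by (auto simp: basis_of_def intro: span_base)
  have "\<phi> v = (\<Sum>J\<in>tuples n {..<r}. (\<Prod>i<n. f (J i) (v i)) *\<^sub>R \<phi> (\<lambda>i\<in>{..<n}. b (J i)))"
    by (rule multilinear_expansion[OF m fin_dim_subspace[OF V] finite_lessThan bV f(2) v])
  also have "\<dots> \<in> span (\<phi> ` tuples n P)"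
  proof (intro span_sum span_scale span_base imageI)
    fix J assume J: "J \<in> tuples n {..<r}"
    show "(\<lambda>i\<in>{..<n}. b (J i)) \<in> tuples n P"
      using PiE_mem[OF J] bP by auto
  qed
  finally show ?thesis .
qed

text \<open>The basis theorem: straightening gives a spanning family, bideterminants show that it is independent.  The entries
  of tableaux start at 1, so the basis is shifted by one.\<close>

lemma schur_module_dim:
  fixes V :: "'v::real_vector set"
  assumes lam: "number_partition lam n" and V: "fin_dim V"
  shows "fin_dim (schur_module lam V)"
    and "dim (schur_module lam V) = card (semistandard_tableaux lam (dim V))"
proof -
  have n: "n = sum_list lam" using lam by (simp add: number_partition_def)
  have sV: "subspace V" by (rule fin_dim_subspace[OF V])
  define m where "m = dim V"
  obtain b where "basis_of (dim V) b V" using basis_of_exists[OF V] .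
  then have b: "basis_of m b V" by (simp add: m_def)
  obtain g where g: "\<And>i. linear (g i)" "\<And>i j. i < m \<Longrightarrow> j < m \<Longrightarrow> g i (b j) = (if i = j then 1 else 0)"
    "\<And>x. x \<in> V \<Longrightarrow> (\<Sum>i<m. g i x *\<^sub>R b i) = x"
    by (rule basis_of_dual[OF b]) (rule that)
  define e where "e a = b (a - 1)" for a
  define f where "f a = g (a - 1)" for a
  have e: "e a \<in> V" if "a \<in> {1..m}" for a
    using b that by (auto simp: e_def basis_of_def intro!: span_base)
  have f: "linear (f a)" for a by (simp add: f_def g)
  have fe: "f a (e a') = (if a = a' then 1 else 0)" if "a \<in> {1..m}" "a' \<in> {1..m}" for a a'
    using g(2)[of "a - 1" "a' - 1"] that by (auto simp: e_def f_def)
  have fs: "(\<Sum>a\<in>{1..m}. f a x *\<^sub>R e a) = x" if "x \<in> V" for x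
    using g(3)[OF that] by (simp add: e_def f_def sum.atLeast1_atMost_eq)
  let ?h = "schur_map lam V" and ?S = "semistandard_tableaux lam m"
  let ?u = "\<lambda>t. ?h (\<lambda>k\<in>{..<n}. e (t k))"
  have m: "multilinear_on n V (schur_module lam V) ?h" and ex: "exchange_axioms lam V ?h"
    using schur_map_exchange[OF sV, of lam] by (simp_all add: n)
  have ind: "c t = 0" if "(\<Sum>t\<in>?S. c t *\<^sub>R ?u t) = 0" "t \<in> ?S" for c t
    by (rule tableaux_independent[OF sV n f fe e that])
  have inj: "inj_on ?u ?S"
  proof (rule inj_onI, rule ccontr)
    fix s t assume *: "s \<in> ?S" "t \<in> ?S" "?u s = ?u t" "s \<noteq> t"
    have "(\<Sum>q\<in>?S. ((if q = s then 1 else 0) - (if q = t then 1 else 0 :: real)) *\<^sub>R ?u q) = ?u s - ?u t"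
      using * finite_semistandard[of lam m]
      by (simp add: scaleR_diff_left sum_subtractf if_distrib[of "\<lambda>x. x *\<^sub>R _"] cong: if_cong)
    then have "(\<Sum>q\<in>?S. ((if q = s then 1 else 0) - (if q = t then 1 else 0 :: real)) *\<^sub>R ?u q) = 0"
      using * by simp
    from ind[OF this *(1)] * show False by simp
  qed
  have indep: "independent (?u ` ?S)"
  proof (rule real_vector.independent_if_scalars_zero)
    fix c x assume c: "(\<Sum>x\<in>?u ` ?S. c x *\<^sub>R x) = 0" and x: "x \<in> ?u ` ?S"
    then obtain t where t: "t \<in> ?S" "x = ?u t" by auto
    have "(\<Sum>t\<in>?S. c (?u t) *\<^sub>R ?u t) = 0" using c by (simp add: sum.reindex[OF inj])
    from ind[OF this t(1)] show "c x = 0" by (simp add: t(2))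
  qed (simp add: finite_semistandard)
  have sp: "span (?u ` ?S) = schur_module lam V"
  proof
    have "?u t \<in> schur_module lam V" if t: "t \<in> ?S" for t
    proof (rule multilinear_on_in[OF m])
      have "t \<in> tuples n {1..m}" using t by (simp add: semistandard_iff n)
      then show "(\<lambda>k\<in>{..<n}. e (t k)) \<in> tuples n V" using e by (auto dest: PiE_mem)
    qed
    moreover have "subspace (schur_module lam V)" by (metis span_schur_map subspace_span)
    ultimately show "span (?u ` ?S) \<subseteq> schur_module lam V" by (intro span_minimal) auto
    have "?h v \<in> span (?u ` ?S)" if v: "v \<in> tuples n V" for v
    proof -
      have "?h v = (\<Sum>J\<in>tuples n {1..m}. (\<Prod>i<n. f (J i) (v i)) *\<^sub>R ?h (\<lambda>i\<in>{..<n}. e (J i)))"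
        by (rule multilinear_expansion[OF m sV _ e fs v]) auto
      also have "\<dots> \<in> span (?u ` ?S)"
        by (intro span_sum span_scale straightening[OF lam sV m ex e])
      finally show ?thesis .
    qed
    then have "span (?h ` tuples n V) \<subseteq> span (?u ` ?S)" by (intro span_minimal) auto
    then show "schur_module lam V \<subseteq> span (?u ` ?S)" by (simp add: n span_schur_map)
  qed
  show "fin_dim (schur_module lam V)"
    unfolding fin_dim_def using sp finite_semistandard by (metis finite_imageI)
  have "dim (schur_module lam V) = card (?u ` ?S)"
    using sp indep by (metis dim_eq_card dim_span)
  also have "\<dots> = card ?S" by (rule card_image[OF inj])
  finally show "dim (schur_module lam V) = card (semistandard_tableaux lam (dim V))" by (simp add: m_def)
qed

lemma subspace_schur_module: "subspace (schur_module lam V)"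
  by (metis span_schur_map subspace_span)

lemma affine_hull_eq_span: "0 \<in> S \<Longrightarrow> affine hull S = span S" for S :: "'a::real_vector set"
  using affine_hull_span_gen[of 0 S] by (simp add: hull_inc)

lemma cc_object_span: "cc_object V P \<Longrightarrow> span P = V"
  by (auto simp: cc_object_def convex_body_def simp flip: affine_hull_eq_span)

lemma schur_body_in_module:
  assumes "subspace V" "P \<subseteq> V"
  shows "schur_body lam V P \<subseteq> schur_module lam V"
proof -
  have "schur_map lam V ` tuples (sum_list lam) P \<subseteq> schur_map lam V ` tuples (sum_list lam) V"
    using assms(2) by (intro image_mono PiE_mono)
  also have "\<dots> \<subseteq> schur_module lam V" by (metis span_schur_map span_superset)
  finally show ?thesis unfolding schur_body_def
    by (intro hull_minimal subspace_imp_convex subspace_schur_module)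
qed

lemma schur_body_cc_object:
  assumes lam: "number_partition lam n" "n \<ge> 1" and P: "cc_object V P"
  shows "cc_object (schur_module lam V) (schur_body lam V P)"
proof -
  have n: "n = sum_list lam" using lam by (simp add: number_partition_def)
  have P': "fin_dim V" "P \<subseteq> V" "compact P" "0 \<in> P" and sV: "subspace V"
    using P by (auto simp: cc_object_def convex_body_def)
  let ?M = "schur_module lam V" and ?B = "schur_body lam V P" and ?h = "schur_map lam V"
  have m: "multilinear_on n V ?M ?h" using schur_map_exchange(1)[OF sV, of lam] by (simp add: n)
  have fM: "fin_dim ?M" by (rule schur_module_dim(1)[OF lam(1) P'(1)])
  have tP: "tuples n P \<subseteq> tuples n V" using P'(2) by (intro PiE_mono)
  have "compact (?h ` tuples n P)"
    by (rule compact_continuous_image[OF continuous_on_subset[OF multilinear_continuous_on[OF m P'(1)] tP] compact_tuples[OF P'(3)]])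
  moreover have "?h ` tuples n P \<subseteq> ?M" using tP multilinear_on_in[OF m] by auto
  ultimately have comp: "compact ?B" unfolding schur_body_def n[symmetric]
    using compact_convex_hull_fin_dim[OF fM] by blast
  have zero: "0 \<in> ?B"
  proof -
    let ?z = "\<lambda>i\<in>{..<n}. 0 :: 'a"
    have z: "?z \<in> tuples n P" using P'(4) by auto
    have "?h (?z(0 := 0 *\<^sub>R 0)) = 0 *\<^sub>R ?h (?z(0 := 0))"
      by (rule multilinear_on_scale[OF m]) (use z tP P' lam in auto)
    moreover have "?z(0 := 0) = ?z" using lam by auto
    ultimately have "?h ?z = 0" by (simp only: scaleR_zero_left)
    then have "0 \<in> ?h ` tuples n P" using z by (metis imageI)
    then show ?thesis unfolding schur_body_def n[symmetric] by (rule hull_inc)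
  qed
  have "span ?B = ?M"
  proof
    show "span ?B \<subseteq> ?M" by (intro span_minimal schur_body_in_module sV P' subspace_schur_module)
    have "?h v \<in> span ?B" if "v \<in> tuples n V" for v
    proof -
      have "?h v \<in> span (?h ` tuples n P)" by (rule multilinear_span[OF m P'(1) cc_object_span[OF P] that])
      also have "\<dots> \<subseteq> span ?B" unfolding schur_body_def n[symmetric] by (intro span_mono hull_subset)
      finally show ?thesis .
    qed
    then have "span (?h ` tuples n V) \<subseteq> span ?B" by (intro span_minimal) auto
    then show "?M \<subseteq> span ?B" by (simp add: n span_schur_map)
  qed
  then have "affine hull ?B = ?M" using affine_hull_eq_span[OF zero] by simp
  then show ?thesis
    using comp zero fM schur_body_in_module[OF sV P'(2)] subspace_schur_module
    by (auto simp: cc_object_def convex_body_def schur_body_def)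
qed

lemma linear_schur_linear: "linear (schur_linear lam F f)"
proof -
  have "schur_linear lam F f = quot_map (schur_relations lam F) \<circ> lin_extend (\<lambda>v. tab (restrict (f \<circ> v) {..<sum_list lam}))"
    by (simp add: fun_eq_iff schur_linear_def)
  then show ?thesis
    using linear_compose[OF linear_lin_extend linear_quot_map[OF subspace_schur_relations]] by metis
qed

text \<open>The chosen extension of a morphism is some linear map of the ambient types; that it maps \<open>V\<close> into \<open>F\<close>
  follows from \<open>span P = V\<close>.\<close>

lemma cc_hom_extension:
  assumes P: "cc_object V P" and F: "subspace F" and T: "T \<in> cc_hom V P F W"
  defines "f \<equiv> SOME f. linear f \<and> restrict f P = T"
  shows "linear f" "\<And>x. x \<in> P \<Longrightarrow> f x = T x" "f ` V \<subseteq> F" "f ` P \<subseteq> W"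
proof -
  obtain g where g: "T = restrict g P" "linear g" "g ` V \<subseteq> F" "g ` P \<subseteq> W"
    using T unfolding cc_hom_def by blast
  have "\<exists>f. linear f \<and> restrict f P = T" using g(1,2) by blast
  then have f: "linear f \<and> restrict f P = T" unfolding f_def by (rule someI_ex)
  then show lf: "linear f" by simp
  show fT: "f x = T x" if "x \<in> P" for x using f that by (metis restrict_apply')
  then have fg: "f x = g x" if "x \<in> P" for x using g(1) that by simp
  have "f x = g x" if "x \<in> V" for x
    by (rule linear_eq_on[OF lf g(2), of x P]) (use that cc_object_span[OF P] fg in auto)
  then show "f ` V \<subseteq> F" "f ` P \<subseteq> W" using g fg by auto
qed

lemma schur_linear_body:
  assumes lam: "number_partition lam n" and V: "subspace V" and F: "subspace F" and P: "P \<subseteq> V"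
    and f: "linear f" "f ` V \<subseteq> F" "f ` P \<subseteq> W"
  shows "schur_linear lam F f ` schur_module lam V \<subseteq> schur_module lam F"
    and "schur_linear lam F f ` schur_body lam V P \<subseteq> schur_body lam F W"
proof -
  have n: "n = sum_list lam" using lam by (simp add: number_partition_def)
  let ?L = "schur_linear lam F f"
  have L: "?L (schur_map lam V v) = schur_map lam F (restrict (f \<circ> v) {..<n})" if "v \<in> tuples n V" for v
    by (rule schur_linear_schur_map[OF lam V F f(1,2) that])
  have "?L ` (schur_map lam V ` tuples n V) \<subseteq> schur_map lam F ` tuples n F"
  proof (intro image_subsetI, elim imageE, hypsubst)
    fix v assume v: "v \<in> tuples n V"
    have "restrict (f \<circ> v) {..<n} \<in> tuples n F" using PiE_mem[OF v] f(2) by auto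
    then show "?L (schur_map lam V v) \<in> schur_map lam F ` tuples n F" using L[OF v] by simp
  qed
  then have "span (?L ` (schur_map lam V ` tuples n V)) \<subseteq> span (schur_map lam F ` tuples n F)" by (rule span_mono)
  then show "?L ` schur_module lam V \<subseteq> schur_module lam F"
    by (simp only: linear_span_image[OF linear_schur_linear] n span_schur_map)
  have "?L ` (schur_map lam V ` tuples n P) \<subseteq> schur_map lam F ` tuples n W"
  proof (intro image_subsetI, elim imageE, hypsubst)
    fix v assume v: "v \<in> tuples n P"
    then have "v \<in> tuples n V" using P by (rule tuples_mono)
    moreover have "restrict (f \<circ> v) {..<n} \<in> tuples n W" using PiE_mem[OF v] f(3) by auto
    ultimately show "?L (schur_map lam V v) \<in> schur_map lam F ` tuples n W" using L by simp
  qed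
  then have "convex hull (?L ` (schur_map lam V ` tuples n P)) \<subseteq> convex hull (schur_map lam F ` tuples n W)"
    by (rule hull_mono)
  then show "?L ` schur_body lam V P \<subseteq> schur_body lam F W"
    unfolding schur_body_def n[symmetric] by (simp add: convex_hull_linear_image[OF linear_schur_linear])
qed

lemma schur_morphism_hom:
  assumes lam: "number_partition lam n" and P: "cc_object V P" and Q: "cc_object F Q" and T: "T \<in> cc_hom V P F Q"
  shows "schur_morphism lam V P F T \<in> cc_hom (schur_module lam V) (schur_body lam V P) (schur_module lam F) (schur_body lam F Q)"
proof -
  have s: "subspace V" "P \<subseteq> V" "subspace F" using P Q by (auto simp: cc_object_def convex_body_def)
  note f = cc_hom_extension[OF P s(3) T]
  show ?thesis unfolding schur_morphism_def cc_hom_def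
    using linear_schur_linear schur_linear_body[OF lam s(1,3,2) f(1,3,4)] by blast
qed

lemma linear_eq_on_schur_body:
  assumes "linear f" "linear g" "\<And>v. v \<in> tuples (sum_list lam) P \<Longrightarrow> f (schur_map lam V v) = g (schur_map lam V v)"
    and "x \<in> schur_body lam V P"
  shows "f x = g x"
  by (rule linear_eq_on[OF assms(1,2), of x "schur_map lam V ` tuples (sum_list lam) P"])
    (use assms(3,4) convex_hull_subset_span in \<open>auto simp: schur_body_def\<close>)

lemma schur_morphism_id:
  assumes lam: "number_partition lam n" and P: "cc_object V P"
  shows "schur_morphism lam V P V (restrict id P) = restrict id (schur_body lam V P)"
proof -
  have n: "n = sum_list lam" using lam by (simp add: number_partition_def)
  have s: "subspace V" "P \<subseteq> V" using P by (auto simp: cc_object_def convex_body_def)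
  have "restrict id P \<in> cc_hom V P V P" unfolding cc_hom_def using linear_id by (intro CollectI exI[of _ id]) simp
  note f = cc_hom_extension[OF P s(1) this]
  let ?f = "SOME f. linear f \<and> restrict f P = restrict id P"
  have "schur_linear lam V ?f x = id x" if x: "x \<in> schur_body lam V P" for x
  proof (rule linear_eq_on_schur_body[OF linear_schur_linear linear_id _ x])
    fix v assume v: "v \<in> tuples (sum_list lam) P"
    then have vV: "v \<in> tuples n V" unfolding n using s(2) by (rule tuples_mono)
    have "restrict (?f \<circ> v) {..<n} = v"
    proof
      fix i show "restrict (?f \<circ> v) {..<n} i = v i"
        using f(2)[of "v i"] PiE_mem[OF v, of i] PiE_arb[OF v, of i] n by (cases "i < n") simp_all
    qed
    then show "schur_linear lam V ?f (schur_map lam V v) = id (schur_map lam V v)"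
      using schur_linear_schur_map[OF lam s(1) s(1) f(1,3) vV] by simp
  qed
  then show ?thesis unfolding schur_morphism_def by (intro restrict_ext)
qed

lemma schur_morphism_compose:
  assumes lam: "number_partition lam n" and P: "cc_object V1 P1" "cc_object V2 P2" "cc_object V3 P3"
    and T: "T1 \<in> cc_hom V1 P1 V2 P2" "T2 \<in> cc_hom V2 P2 V3 P3"
  shows "schur_morphism lam V1 P1 V3 (compose P1 T2 T1) =
    compose (schur_body lam V1 P1) (schur_morphism lam V2 P2 V3 T2) (schur_morphism lam V1 P1 V2 T1)"
proof -
  have n: "n = sum_list lam" using lam by (simp add: number_partition_def)
  have s: "subspace V1" "P1 \<subseteq> V1" "subspace V2" "P2 \<subseteq> V2" "subspace V3"
    using P by (auto simp: cc_object_def convex_body_def)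
  have T21: "compose P1 T2 T1 \<in> cc_hom V1 P1 V3 P3"
  proof -
    obtain g1 where g1: "T1 = restrict g1 P1" "linear g1" "g1 ` V1 \<subseteq> V2" "g1 ` P1 \<subseteq> P2" using T(1) by (auto simp: cc_hom_def)
    obtain g2 where g2: "T2 = restrict g2 P2" "linear g2" "g2 ` V2 \<subseteq> V3" "g2 ` P2 \<subseteq> P3" using T(2) by (auto simp: cc_hom_def)
    have "compose P1 T2 T1 = restrict (g2 \<circ> g1) P1" using g1 g2 by (auto simp: compose_def fun_eq_iff)
    moreover have "linear (g2 \<circ> g1)" by (rule linear_compose[OF g1(2) g2(2)])
    moreover have "(g2 \<circ> g1) ` V1 \<subseteq> V3" "(g2 \<circ> g1) ` P1 \<subseteq> P3"
      using g1(3,4) g2(3,4) by (simp_all add: image_subset_iff)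
    ultimately show ?thesis unfolding cc_hom_def by blast
  qed
  note f1 = cc_hom_extension[OF P(1) s(3) T(1)] and f2 = cc_hom_extension[OF P(2) s(5) T(2)]
    and f3 = cc_hom_extension[OF P(1) s(5) T21]
  define f where "f = (SOME f. linear f \<and> restrict f P1 = T1)"
  define g where "g = (SOME f. linear f \<and> restrict f P2 = T2)"
  define k where "k = (SOME f. linear f \<and> restrict f P1 = compose P1 T2 T1)"
  note f1 = f1[folded f_def] and f2 = f2[folded g_def] and f3 = f3[folded k_def]
  have body: "schur_linear lam V2 f x \<in> schur_body lam V2 P2" if "x \<in> schur_body lam V1 P1" for x
    using schur_linear_body(2)[OF lam s(1,3,2) f1(1,3,4)] that by blast
  have "schur_linear lam V3 k x = (schur_linear lam V3 g \<circ> schur_linear lam V2 f) x" if x: "x \<in> schur_body lam V1 P1" for x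
  proof (rule linear_eq_on_schur_body[OF linear_schur_linear linear_compose[OF linear_schur_linear linear_schur_linear] _ x])
    fix v assume "v \<in> tuples (sum_list lam) P1"
    then have v: "v \<in> tuples n P1" by (simp add: n)
    then have vV: "v \<in> tuples n V1" using s(2) by (rule tuples_mono)
    have fv: "restrict (f \<circ> v) {..<n} \<in> tuples n P2" using PiE_mem[OF v] f1(4) by auto
    then have fvV: "restrict (f \<circ> v) {..<n} \<in> tuples n V2" using s(4) by (rule tuples_mono)
    have "k (v i) = g (f (v i))" if "i < n" for i
    proof -
      have "v i \<in> P1" using PiE_mem[OF v, of i] that by simp
      moreover from this have "f (v i) \<in> P2" using f1(4) by auto
      ultimately show ?thesis using f1(2) f2(2) f3(2) by (simp add: compose_def)
    qed
    then have "restrict (k \<circ> v) {..<n} = restrict (g \<circ> restrict (f \<circ> v) {..<n}) {..<n}" by auto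
    then show "schur_linear lam V3 k (schur_map lam V1 v) = (schur_linear lam V3 g \<circ> schur_linear lam V2 f) (schur_map lam V1 v)"
      by (simp add: schur_linear_schur_map[OF lam s(1,5) f3(1,3) vV] schur_linear_schur_map[OF lam s(1,3) f1(1,3) vV]
          schur_linear_schur_map[OF lam s(3,5) f2(1,3) fvV])
  qed
  then show ?thesis unfolding schur_morphism_def f_def[symmetric] g_def[symmetric] k_def[symmetric]
    using body by (auto simp: compose_def fun_eq_iff)
qed

lemma schur_body_universal:
  assumes lam: "number_partition lam n" and P: "cc_object V P" and W: "cc_object F W"
    and T: "exchange_map_into lam V P F W T"
  shows "\<exists>!t. t \<in> cc_hom (schur_module lam V) (schur_body lam V P) F W \<and> (\<forall>v\<in>tuples n P. t (schur_map lam V v) = T v)"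
proof -
  have n: "n = sum_list lam" using lam by (simp add: number_partition_def)
  have s: "subspace F" "convex W" using W by (auto simp: cc_object_def convex_body_def)
  let ?h = "schur_map lam V" and ?B = "schur_body lam V P"
  obtain \<phi> where \<phi>: "multilinear_on n V F \<phi>" "exchange_axioms lam V \<phi>" "\<And>v. v \<in> tuples n P \<Longrightarrow> T v = \<phi> v"
    and TW: "\<And>v. v \<in> tuples n P \<Longrightarrow> T v \<in> W"
    using T by (auto simp: exchange_map_into_def n)
  let ?g = "lin_extend \<phi>"
  have g: "?g (?h v) = \<phi> v" for v using lin_extend_schur_map \<phi> n by metis
  have inB: "?h v \<in> ?B" if "v \<in> tuples n P" for v
    unfolding schur_body_def using that n by (intro hull_inc) simp
  have "?g ` (?h ` tuples n V) \<subseteq> F" using g multilinear_on_in[OF \<phi>(1)] by auto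
  then have "?g ` schur_module lam V \<subseteq> F"
    using linear_span_image[OF linear_lin_extend, of \<phi> "?h ` tuples n V"] s(1) span_minimal[of "?g ` ?h ` tuples n V" F]
    by (simp add: n span_schur_map)
  moreover have "?g ` (?h ` tuples n P) \<subseteq> W" using g \<phi>(3) TW by auto
  then have "?g ` ?B \<subseteq> W"
    unfolding schur_body_def n[symmetric] convex_hull_linear_image[OF linear_lin_extend]
    using s(2) by (intro hull_minimal)
  ultimately have hom: "restrict ?g ?B \<in> cc_hom (schur_module lam V) ?B F W"
    unfolding cc_hom_def using linear_lin_extend by blast
  show ?thesis
  proof (rule ex1I[of _ "restrict ?g ?B"])
    show "restrict ?g ?B \<in> cc_hom (schur_module lam V) ?B F W \<and> (\<forall>v\<in>tuples n P. restrict ?g ?B (?h v) = T v)"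
      using hom inB g \<phi>(3) by simp
    fix t assume t: "t \<in> cc_hom (schur_module lam V) ?B F W \<and> (\<forall>v\<in>tuples n P. t (?h v) = T v)"
    then obtain f where f: "t = restrict f ?B" "linear f" by (auto simp: cc_hom_def)
    have "f x = ?g x" if "x \<in> ?B" for x
      by (rule linear_eq_on_schur_body[OF f(2) linear_lin_extend _ that]) (use t f(1) inB g \<phi>(3) n in auto)
    then show "t = restrict ?g ?B" unfolding f(1) by (intro restrict_ext)
  qed
qed

text \<open>Two boxes of the first column can be swapped, which changes the sign of a generator.\<close>

lemma schur_body_symmetric:
  assumes lam: "number_partition lam n" and V: "subspace V" "P \<subseteq> V" and l: "length lam > 1"
  shows "uminus ` schur_body lam V P = schur_body lam V P"
proof -
  have n: "n = sum_list lam" using lam by (simp add: number_partition_def)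
  let ?h = "schur_map lam V"
  have m: "multilinear_on n V (schur_module lam V) ?h" and ex: "exchange_axioms lam V ?h"
    using schur_map_exchange[OF V(1), of lam] by (simp_all add: n)
  have pos: "lam ! i > 0" if "i < length lam" for i
    using lam that unfolding number_partition_def by (metis gr0I nth_mem)
  define k where "k i = sum_list (take i lam) + 0" for i
  have k: "k i < n" "box_row lam (k i) = i" "box_column lam (k i) = 0" if "i < length lam" for i
    using box_unique[OF that pos[OF that]] by (simp_all add: k_def n)
  have l0: "0 < length lam" using l by linarith
  have kk: "k 0 < n" "k 1 < n" "k 0 \<noteq> k 1" "box_column lam (k 0) = box_column lam (k 1)"
    using k[OF l0] k[OF l] by auto
  let ?\<tau> = "Transposition.transpose (k 0) (k 1)"
  have t: "v \<circ> ?\<tau> \<in> tuples n P" if "v \<in> tuples n P" for v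
    by (rule tuples_permute[of _ "{k 0, k 1}"]) (use that kk in \<open>auto simp: permutes_swap_id\<close>)
  have h: "?h (v \<circ> ?\<tau>) = - ?h v" if v: "v \<in> tuples n P" for v
  proof (rule alternating_swap[OF m V(1) kk(1-3)])
    show "v \<in> tuples n V" using v V(2) by (rule tuples_mono)
    show "?h w = 0" if "w \<in> tuples n V" "w (k 0) = w (k 1)" for w
      by (rule exchange_axioms_alternating[OF ex _ _ kk(3,4)]) (use that kk n in auto)
  qed
  have "uminus ` (?h ` tuples n P) = ?h ` tuples n P"
  proof
    show sub: "uminus ` (?h ` tuples n P) \<subseteq> ?h ` tuples n P"
    proof (intro image_subsetI, elim imageE, hypsubst)
      fix v assume v: "v \<in> tuples n P"
      show "- ?h v \<in> ?h ` tuples n P" using imageI[OF t[OF v], of ?h] by (simp only: h[OF v])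
    qed
    have "uminus ` uminus ` (?h ` tuples n P) \<subseteq> uminus ` (?h ` tuples n P)" by (rule image_mono[OF sub])
    then show "?h ` tuples n P \<subseteq> uminus ` (?h ` tuples n P)" by (simp add: image_image)
  qed
  moreover have "linear (uminus :: 'a formal_sum \<Rightarrow> _)" by (simp add: linear_iff)
  ultimately show ?thesis
    unfolding schur_body_def n[symmetric] by (metis convex_hull_linear_image)
qed

lemma schur_body_convex_hull:
  assumes "number_partition lam n" "subspace V" "E \<subseteq> V" "P = convex hull E"
  shows "schur_body lam V P = convex hull (schur_map lam V ` tuples n E)"
  using multilinear_convex_hull[OF schur_map_exchange(1)[OF assms(2)] assms(2,3), of lam] assms(1,4)
  by (simp add: schur_body_def number_partition_def)

lemma schur_body_polytope:
  assumes "number_partition lam n" "subspace V" "P \<subseteq> V" "polytope P"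
  shows "polytope (schur_body lam V P)"
proof -
  obtain S where S: "finite S" "P = convex hull S" using assms(4) by (auto simp: polytope_def)
  then have "S \<subseteq> V" using assms(3) hull_subset[of S convex] by auto
  from schur_body_convex_hull[OF assms(1,2) this S(2)] show ?thesis
    unfolding polytope_def using S(1) by (metis finite_PiE finite_imageI finite_lessThan)
qed

section \<open>Positive semidefinite matrices and spectrahedra\<close>

text \<open>One step of symmetric Gaussian elimination on \<open>A\<close> splits off a square, on which \<open>B\<close> is
  non-negative, and leaves a positive semidefinite matrix without last row.\<close>

lemma psd_trace_nonneg:
  assumes "psd_matrix d A" "psd_matrix d B"
  shows "0 \<le> (\<Sum>i<d. \<Sum>j<d. A i j * B i j)"
  using assms
proof (induction d arbitrary: A)
  case 0 then show ?case by simp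
next
  case (Suc d)
  have symA: "A i j = A j i" if "i < Suc d" "j < Suc d" for i j
    using Suc.prems(1) that unfolding psd_matrix_def by blast
  have psdA: "0 \<le> (\<Sum>i<Suc d. \<Sum>j<Suc d. u i * A i j * u j)" for u
    using Suc.prems(1) unfolding psd_matrix_def by blast
  have psdB: "0 \<le> (\<Sum>i<Suc d. \<Sum>j<Suc d. u i * B i j * u j)" for u
    using Suc.prems(2) unfolding psd_matrix_def by blast
  have B: "psd_matrix d B"
    unfolding psd_matrix_def
  proof (intro conjI allI impI)
    show "B i j = B j i" if "i < d" "j < d" for i j using Suc.prems(2) that unfolding psd_matrix_def by simp
    show "0 \<le> (\<Sum>i<d. \<Sum>j<d. u i * B i j * u j)" for u
      using psdB[of "\<lambda>i. if i < d then u i else 0"] by simp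
  qed
  let ?a = "A d d"
  have split: "(\<Sum>i<Suc d. \<Sum>j<Suc d. u i * A i j * u j) =
      (\<Sum>i<d. \<Sum>j<d. u i * A i j * u j) + 2 * u d * (\<Sum>i<d. A i d * u i) + ?a * (u d)\<^sup>2" for u
  proof -
    have "(\<Sum>j<d. u d * A d j * u j) = u d * (\<Sum>i<d. A i d * u i)"
      unfolding sum_distrib_left using symA by (intro sum.cong) auto
    moreover have "(\<Sum>i<d. u i * A i d * u d) = u d * (\<Sum>i<d. A i d * u i)"
      unfolding sum_distrib_left by (intro sum.cong) auto
    ultimately show ?thesis by (simp add: sum.distrib power2_eq_square algebra_simps)
  qed
  have a0: "?a \<ge> 0" using psdA[of "\<lambda>i. if i = d then 1 else 0"] unfolding split by simp
  show ?case
  proof (cases "?a = 0")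
    case True
    have z: "A k d = 0" if k: "k < d" for k
    proof (rule ccontr)
      assume nz: "A k d \<noteq> 0"
      define q where "q = A k k"
      have "0 \<le> q + 2 * s * A k d" for s
      proof -
        let ?u = "\<lambda>i. if i = d then s else if i = k then 1 else 0"
        have "(\<Sum>i<d. \<Sum>j<d. ?u i * A i j * ?u j) = (\<Sum>i<d. \<Sum>j<d. if i = k \<and> j = k then q else 0)"
          by (intro sum.cong) (auto simp: q_def)
        also have "\<dots> = (\<Sum>i<d. if i = k then q else 0)"
          using k by (intro sum.cong) auto
        also have "\<dots> = q" using k by simp
        finally have 1: "(\<Sum>i<d. \<Sum>j<d. ?u i * A i j * ?u j) = q" .
        have "(\<Sum>i<d. A i d * ?u i) = (\<Sum>i<d. if i = k then A k d else 0)" by (intro sum.cong) auto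
        then have 2: "(\<Sum>i<d. A i d * ?u i) = A k d" using k by simp
        show ?thesis using psdA[of ?u] unfolding split 1 2 True by simp
      qed
      from this[of "- (q + 1) / (2 * A k d)"] nz show False by (simp add: field_simps)
    qed
    have "psd_matrix d A"
      unfolding psd_matrix_def
    proof (intro conjI allI impI)
      show "A i j = A j i" if "i < d" "j < d" for i j using symA that by simp
      show "0 \<le> (\<Sum>i<d. \<Sum>j<d. u i * A i j * u j)" for u
        using psdA[of "\<lambda>i. if i < d then u i else 0"] by simp
    qed
    then have "0 \<le> (\<Sum>i<d. \<Sum>j<d. A i j * B i j)" using Suc.IH B by blast
    moreover have "(\<Sum>i<Suc d. \<Sum>j<Suc d. A i j * B i j) = (\<Sum>i<d. \<Sum>j<d. A i j * B i j)"
      using z symA True by simp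
    ultimately show ?thesis by simp
  next
    case False
    then have ap: "?a > 0" using a0 by simp
    define A' where "A' i j = A i j - A i d * A j d / ?a" for i j
    have "psd_matrix d A'"
      unfolding psd_matrix_def
    proof (intro conjI allI impI)
      show "A' i j = A' j i" if "i < d" "j < d" for i j using symA[of i j] that by (simp add: A'_def)
      fix u
      define s where "s = (\<Sum>i<d. A i d * u i)"
      let ?u = "\<lambda>i. if i < d then u i else - s / ?a"
      have "(\<Sum>i<d. \<Sum>j<d. u i * A' i j * u j) = (\<Sum>i<d. \<Sum>j<d. u i * A i j * u j) - s\<^sup>2 / ?a"
        unfolding A'_def s_def power2_eq_square sum_product
        by (simp add: algebra_simps sum_subtractf sum_divide_distrib)
      also have "\<dots> = (\<Sum>i<Suc d. \<Sum>j<Suc d. ?u i * A i j * ?u j)"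
      proof -
        have "(\<Sum>i<d. A i d * ?u i) = s" by (simp add: s_def)
        then show ?thesis unfolding split using ap by (simp add: power2_eq_square field_simps)
      qed
      finally show "0 \<le> (\<Sum>i<d. \<Sum>j<d. u i * A' i j * u j)" using psdA[of ?u] by simp
    qed
    then have "0 \<le> (\<Sum>i<d. \<Sum>j<d. A' i j * B i j)" using Suc.IH B by blast
    also have "\<dots> = (\<Sum>i<Suc d. \<Sum>j<Suc d. (A i j - A i d * A j d / ?a) * B i j)"
    proof -
      have z: "A d j - A d d * A j d / ?a = 0" "A j d - A j d * A d d / ?a = 0" if "j < Suc d" for j
      proof -
        have "A d j = A j d" by (rule symA) (use that in auto)
        then show "A d j - A d d * A j d / ?a = 0" "A j d - A j d * A d d / ?a = 0" using ap by simp_all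
      qed
      have "(\<Sum>j<d. (A d j - A d d * A j d / ?a) * B d j) = 0" "(\<Sum>i<d. (A i d - A i d * A d d / ?a) * B i d) = 0"
        using z by (intro sum.neutral ballI; metis lessThan_iff less_SucI mult_zero_left)+
      moreover have "(A d d - A d d * A d d / ?a) * B d d = 0" using z(1)[of d] by simp
      ultimately
      show ?thesis unfolding A'_def sum.lessThan_Suc sum.distrib by (simp only: add_0_right)
    qed
    also have "\<dots> = (\<Sum>i<Suc d. \<Sum>j<Suc d. A i j * B i j) - (\<Sum>i<Suc d. \<Sum>j<Suc d. A i d * B i j * A j d) / ?a"
    proof -
      have "(A i j - A i d * A j d / ?a) * B i j = A i j * B i j - (A i d * B i j * A j d) / ?a" for i j
        by (simp add: left_diff_distrib)
      then show ?thesis by (simp only: sum_subtractf sum_divide_distrib)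
    qed
    finally show ?thesis
      using psdB[of "\<lambda>i. A i d"] ap by (smt (verit) divide_nonneg_nonneg)
  qed
qed

definition affine_fun :: "nat \<Rightarrow> ((nat \<Rightarrow> real) \<Rightarrow> real) \<Rightarrow> bool" where
  "affine_fun N F \<longleftrightarrow> (\<exists>c0 c. \<forall>x\<in>tuples N UNIV. F x = c0 + (\<Sum>l<N. x l * c l))"

lemma affine_fun_const: "affine_fun N (\<lambda>_. c)"
  unfolding affine_fun_def by (intro exI[of _ c] exI[of _ "\<lambda>_. 0"]) simp

lemma affine_fun_coord:
  assumes "i < N"
  shows "affine_fun N (\<lambda>x. x i)"
proof -
  have "(\<Sum>l<N. x l * (if l = i then 1 else 0)) = x i" for x :: "nat \<Rightarrow> real"
    using assms by (simp add: if_distrib[of "(*) _"] cong: if_cong)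
  then show ?thesis unfolding affine_fun_def
    by (intro exI[of _ 0] exI[of _ "\<lambda>l. if l = i then 1 else 0"]) simp
qed

lemma affine_fun_add:
  assumes "affine_fun N F" "affine_fun N G"
  shows "affine_fun N (\<lambda>x. F x + G x)"
proof -
  obtain c0 c d0 d where "\<forall>x\<in>tuples N UNIV. F x = c0 + (\<Sum>l<N. x l * c l)" "\<forall>x\<in>tuples N UNIV. G x = d0 + (\<Sum>l<N. x l * d l)"
    using assms by (auto simp: affine_fun_def)
  then have "\<forall>x\<in>tuples N UNIV. F x + G x = (c0 + d0) + (\<Sum>l<N. x l * (c l + d l))"
    by (simp add: algebra_simps sum.distrib)
  then show ?thesis unfolding affine_fun_def by (intro exI[of _ "c0 + d0"] exI[of _ "\<lambda>l. c l + d l"])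
qed

lemma affine_fun_scale:
  assumes "affine_fun N F"
  shows "affine_fun N (\<lambda>x. F x * k)"
proof -
  obtain c0 c where "\<forall>x\<in>tuples N UNIV. F x = c0 + (\<Sum>l<N. x l * c l)"
    using assms by (auto simp: affine_fun_def)
  then have "\<forall>x\<in>tuples N UNIV. F x * k = c0 * k + (\<Sum>l<N. x l * (c l * k))"
    by (simp add: algebra_simps sum_distrib_left)
  then show ?thesis unfolding affine_fun_def by (intro exI[of _ "c0 * k"] exI[of _ "\<lambda>l. c l * k"])
qed

lemma affine_fun_diff: "affine_fun N F \<Longrightarrow> affine_fun N G \<Longrightarrow> affine_fun N (\<lambda>x. F x - G x)"
  using affine_fun_add[OF _ affine_fun_scale[of N G "-1"], of F] by simp

lemma affine_fun_sum: "(\<And>i. i \<in> A \<Longrightarrow> affine_fun N (F i)) \<Longrightarrow> affine_fun N (\<lambda>x. \<Sum>i\<in>A. F i x)"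
  by (induction A rule: infinite_finite_induct) (auto intro: affine_fun_const affine_fun_add)

lemma sum_lessThan_add: "(\<Sum>i<N + s. f i) = (\<Sum>i<N. f i) + (\<Sum>q<s. f (N + q) :: 'a::comm_monoid_add)" for N s :: nat
  by (induction s) (auto simp: add.assoc)

lemma psd_matrix_block:
  fixes A :: "nat \<Rightarrow> nat \<Rightarrow> real" and g :: "nat \<Rightarrow> real" and N s :: nat
  defines "B \<equiv> (\<lambda>i j. if i < N \<and> j < N then A i j else if i = j then g (i - N) else 0)"
  shows "psd_matrix (N + s) B \<longleftrightarrow> psd_matrix N A \<and> (\<forall>q<s. 0 \<le> g q)"
proof -
  have form: "(\<Sum>i<N + s. \<Sum>j<N + s. u i * B i j * u j) =
      (\<Sum>i<N. \<Sum>j<N. u i * A i j * u j) + (\<Sum>q<s. (u (N + q))\<^sup>2 * g q)" for u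
  proof -
    have "(\<Sum>j<N + s. u i * B i j * u j) = (\<Sum>j<N. u i * A i j * u j)" if "i < N" for i
      unfolding sum_lessThan_add B_def using that by simp
    moreover have "(\<Sum>j<N + s. u (N + q) * B (N + q) j * u j) = (u (N + q))\<^sup>2 * g q" if "q < s" for q
    proof -
      have "(\<Sum>p<s. u (N + q) * B (N + q) (N + p) * u (N + p)) = (\<Sum>p<s. if p = q then (u (N + q))\<^sup>2 * g q else 0)"
        by (intro sum.cong) (auto simp: B_def power2_eq_square)
      then show ?thesis unfolding sum_lessThan_add using that by (simp add: B_def)
    qed
    ultimately show ?thesis unfolding sum_lessThan_add[of _ N s] by simp
  qed
  show ?thesis
  proof
    assume L: "psd_matrix (N + s) B"
    have "psd_matrix N A"
      unfolding psd_matrix_def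
    proof (intro conjI allI impI)
      fix i j assume ij: "i < N" "j < N"
      then have "B i j = B j i" using L unfolding psd_matrix_def by (meson trans_less_add1)
      then show "A i j = A j i" using ij by (simp add: B_def)
    next
      fix u
      have "0 \<le> (\<Sum>i<N + s. \<Sum>j<N + s. (if i < N then u i else 0) * B i j * (if j < N then u j else 0))"
        by (rule L[unfolded psd_matrix_def, THEN conjunct2, rule_format])
      then show "0 \<le> (\<Sum>i<N. \<Sum>j<N. u i * A i j * u j)" unfolding form by simp
    qed
    moreover have "0 \<le> g q" if "q < s" for q
    proof -
      let ?u = "\<lambda>i. if i = N + q then 1 else 0 :: real"
      have "0 \<le> (\<Sum>i<N + s. \<Sum>j<N + s. ?u i * B i j * ?u j)"
        by (rule L[unfolded psd_matrix_def, THEN conjunct2, rule_format])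
      moreover have "(\<Sum>p<s. (?u (N + p))\<^sup>2 * g p) = (\<Sum>p<s. if p = q then g q else 0)"
        by (intro sum.cong) auto
      ultimately show ?thesis unfolding form using that by simp
    qed
    ultimately show "psd_matrix N A \<and> (\<forall>q<s. 0 \<le> g q)" by blast
  next
    assume R: "psd_matrix N A \<and> (\<forall>q<s. 0 \<le> g q)"
    show "psd_matrix (N + s) B"
      unfolding psd_matrix_def form
    proof (intro conjI allI impI)
      show "B i j = B j i" for i j using R unfolding psd_matrix_def B_def by auto
      fix u
      have "0 \<le> (\<Sum>i<N. \<Sum>j<N. u i * A i j * u j)" using R unfolding psd_matrix_def by simp
      moreover have "0 \<le> (\<Sum>q<s. (u (N + q))\<^sup>2 * g q)" using R by (intro sum_nonneg) simp
      ultimately show "0 \<le> (\<Sum>i<N. \<Sum>j<N. u i * A i j * u j) + (\<Sum>q<s. (u (N + q))\<^sup>2 * g q)"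
        by (rule add_nonneg_nonneg)
    qed
  qed
qed

text \<open>A linear matrix inequality and finitely many linear inequalities form one linear matrix inequality, with a
  block diagonal matrix.\<close>

lemma spectrahedron_blocks:
  fixes A :: "(nat \<Rightarrow> real) \<Rightarrow> nat \<Rightarrow> nat \<Rightarrow> real" and G :: "nat \<Rightarrow> (nat \<Rightarrow> real) \<Rightarrow> real"
  assumes A: "\<And>i j. i < N \<Longrightarrow> j < N \<Longrightarrow> affine_fun K (\<lambda>x. A x i j)"
    and sym: "\<And>x i j. i < N \<Longrightarrow> j < N \<Longrightarrow> A x i j = A x j i"
    and G: "\<And>q. q < s \<Longrightarrow> affine_fun K (G q)"
  shows "spectrahedron K {x \<in> tuples K UNIV. psd_matrix N (A x) \<and> (\<forall>q<s. 0 \<le> G q x)}"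
proof -
  define B where "B x = (\<lambda>i j. if i < N \<and> j < N then A x i j else if i = j then G (i - N) x else 0)" for x
  have "affine_fun K (\<lambda>x. B x i j)" if "i < N + s" "j < N + s" for i j
    unfolding B_def using that A[of i j] G[of "i - N"] affine_fun_const[of K 0]
    by (cases "i < N \<and> j < N"; cases "i = j") auto
  then have "\<forall>i j. \<exists>c0 c. i < N + s \<and> j < N + s \<longrightarrow> (\<forall>x\<in>tuples K UNIV. B x i j = c0 + (\<Sum>l<K. x l * c l))"
    unfolding affine_fun_def by blast
  then obtain c0 c where c: "\<And>i j x. i < N + s \<Longrightarrow> j < N + s \<Longrightarrow> x \<in> tuples K UNIV \<Longrightarrow>
      B x i j = c0 i j + (\<Sum>l<K. x l * c i j l)"
    by metis
  \<comment> \<open>The coefficients on the diagonal and above determine a symmetric pencil.\<close>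
  define M0 where "M0 i j = c0 (min i j) (max i j)" for i j
  define M where "M l i j = c (min i j) (max i j) l" for l i j
  have Bs: "B x i j = B x j i" for x i j using sym by (auto simp: B_def)
  have eq: "M0 i j + (\<Sum>l<K. x l * M l i j) = B x i j" if "i < N + s" "j < N + s" "x \<in> tuples K UNIV" for x i j
  proof (cases "i \<le> j")
    case True then show ?thesis using c[OF that] by (simp add: M0_def M_def)
  next
    case False then show ?thesis using c[OF that(2,1,3)] Bs[of x i j] by (simp add: M0_def M_def)
  qed
  have "psd_matrix (N + s) (\<lambda>i j. M0 i j + (\<Sum>l<K. x l * M l i j)) \<longleftrightarrow> psd_matrix N (A x) \<and> (\<forall>q<s. 0 \<le> G q x)"
    if "x \<in> tuples K UNIV" for x
  proof -
    have "psd_matrix (N + s) (\<lambda>i j. M0 i j + (\<Sum>l<K. x l * M l i j)) \<longleftrightarrow> psd_matrix (N + s) (B x)"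
      unfolding psd_matrix_def using eq[OF _ _ that] by simp
    also have "\<dots> \<longleftrightarrow> psd_matrix N (A x) \<and> (\<forall>q<s. 0 \<le> G q x)"
      unfolding B_def by (rule psd_matrix_block)
    finally show ?thesis .
  qed
  then have "{x \<in> tuples K UNIV. psd_matrix N (A x) \<and> (\<forall>q<s. 0 \<le> G q x)} =
      {x \<in> tuples K UNIV. psd_matrix (N + s) (\<lambda>i j. M0 i j + (\<Sum>l<K. x l * M l i j))}"
    by (intro Collect_cong) (meson conj_cong refl)
  moreover have "M0 i j = M0 j i" "M l i j = M l j i" for i j l
    by (simp_all only: M0_def M_def min.commute[of j i] max.commute[of j i])
  ultimately show ?thesis unfolding spectrahedron_def
    by (intro exI[of _ "N + s"] exI[of _ M0] exI[of _ M] conjI allI impI)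
qed

text \<open>The positive semidefinite matrices in \<open>N * N\<close> additional variables, two linear inequalities for each of the linear
  equations.\<close>

lemma projected_spectrahedron_psd_image:
  fixes M0 :: "nat \<Rightarrow> nat \<Rightarrow> real" and Mt :: "nat \<Rightarrow> nat \<Rightarrow> nat \<Rightarrow> real"
  shows "projected_spectrahedron r {y \<in> tuples r UNIV. \<exists>A. psd_matrix N A \<and>
    (\<Sum>i<N. \<Sum>j<N. A i j * M0 i j) \<le> 1 \<and> (\<forall>t<r. y t = (\<Sum>i<N. \<Sum>j<N. A i j * Mt t i j))}" (is "projected_spectrahedron r ?R")
proof -
  let ?K = "r + N * N"
  have idx: "r + (i * N + j) < ?K" if "i < N" "j < N" for i j
  proof -
    have "i * N + j < i * N + N" using that by simp
    also have "\<dots> = (i + 1) * N" by simp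
    also have "\<dots> \<le> N * N" using that by (intro mult_right_mono) auto
    finally show ?thesis by simp
  qed
  define A where "A x i j = x (r + (i * N + j)) + x (r + (j * N + i))" for x :: "nat \<Rightarrow> real" and i j
  define G where "G q x = (if q = 0 then 1 - (\<Sum>i<N. \<Sum>j<N. A x i j * M0 i j)
     else if q \<le> r then x (q - 1) - (\<Sum>i<N. \<Sum>j<N. A x i j * Mt (q - 1) i j)
     else (\<Sum>i<N. \<Sum>j<N. A x i j * Mt (q - r - 1) i j) - x (q - r - 1))" for q x
  have affA: "affine_fun ?K (\<lambda>x. A x i j)" if "i < N" "j < N" for i j
    unfolding A_def by (intro affine_fun_add affine_fun_coord idx that)
  have affS: "affine_fun ?K (\<lambda>x. \<Sum>i<N. \<Sum>j<N. A x i j * m i j)" for m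
    by (intro affine_fun_sum affine_fun_scale affA) auto
  have affG: "affine_fun ?K (G q)" if "q < 1 + 2 * r" for q
  proof -
    consider "q = 0" | "q \<noteq> 0" "q \<le> r" | "q > r" by linarith
    then show ?thesis
    proof cases
      case 1 then show ?thesis unfolding G_def by (simp add: affine_fun_diff affine_fun_const affS)
    next
      case 2
      then have "q - 1 < ?K" by simp
      then show ?thesis using 2 unfolding G_def by (simp add: affine_fun_diff affine_fun_coord affS)
    next
      case 3
      then have "q - r - 1 < ?K" using that by simp
      then have "affine_fun ?K (\<lambda>x. (\<Sum>i<N. \<Sum>j<N. A x i j * Mt (q - r - 1) i j) - x (q - r - 1))"
        by (intro affine_fun_diff affine_fun_coord affS)
      then show ?thesis using 3 unfolding G_def by simp
    qed
  qed
  let ?S = "{x \<in> tuples ?K UNIV. psd_matrix N (A x) \<and> (\<forall>q<1 + 2 * r. 0 \<le> G q x)}"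
  have spec: "spectrahedron ?K ?S"
    by (rule spectrahedron_blocks[OF affA _ affG]) (auto simp: A_def)
  have Giff: "(\<forall>q<1 + 2 * r. 0 \<le> G q x) \<longleftrightarrow> (\<Sum>i<N. \<Sum>j<N. A x i j * M0 i j) \<le> 1 \<and>
      (\<forall>t<r. x t = (\<Sum>i<N. \<Sum>j<N. A x i j * Mt t i j))" for x
  proof
    assume L: "\<forall>q<1 + 2 * r. 0 \<le> G q x"
    have "0 \<le> G 0 x" using L by simp
    moreover have "x t = (\<Sum>i<N. \<Sum>j<N. A x i j * Mt t i j)" if "t < r" for t
    proof -
      have "0 \<le> G (t + 1) x" "0 \<le> G (t + r + 1) x" using L that by auto
      then show ?thesis using that by (simp add: G_def)
    qed
    ultimately show "(\<Sum>i<N. \<Sum>j<N. A x i j * M0 i j) \<le> 1 \<and> (\<forall>t<r. x t = (\<Sum>i<N. \<Sum>j<N. A x i j * Mt t i j))"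
      by (simp add: G_def)
  next
    assume R: "(\<Sum>i<N. \<Sum>j<N. A x i j * M0 i j) \<le> 1 \<and> (\<forall>t<r. x t = (\<Sum>i<N. \<Sum>j<N. A x i j * Mt t i j))"
    show "\<forall>q<1 + 2 * r. 0 \<le> G q x"
    proof (intro allI impI)
      fix q assume q: "q < 1 + 2 * r"
      have "x t = (\<Sum>i<N. \<Sum>j<N. A x i j * Mt t i j)" if "t < r" for t using R that by blast
      from this[of "q - 1"] this[of "q - r - 1"] show "0 \<le> G q x" using q R by (auto simp: G_def)
    qed
  qed
  have "?R = (\<lambda>x. restrict x {..<r}) ` ?S"
  proof
    show "?R \<subseteq> (\<lambda>x. restrict x {..<r}) ` ?S"
    proof
      fix y assume "y \<in> ?R"
      then obtain C where y: "y \<in> tuples r UNIV" and C: "psd_matrix N C" "(\<Sum>i<N. \<Sum>j<N. C i j * M0 i j) \<le> 1"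
        "\<And>t. t < r \<Longrightarrow> y t = (\<Sum>i<N. \<Sum>j<N. C i j * Mt t i j)" by auto
      define x where "x = (\<lambda>k\<in>{..<?K}. if k < r then y k else C ((k - r) div N) ((k - r) mod N) / 2)"
      have xA: "x (r + (i * N + j)) = C i j / 2" if "i < N" "j < N" for i j
        using idx[OF that] that by (simp add: x_def)
      have AC: "A x i j = C i j" if "i < N" "j < N" for i j
        using xA that C(1) unfolding A_def psd_matrix_def by (metis field_sum_of_halves)
      have "psd_matrix N (A x)" using C(1) AC unfolding psd_matrix_def by simp
      moreover have "x t = y t" if "t < r" for t using that by (simp add: x_def)
      ultimately have "x \<in> ?S" using C(2,3) AC unfolding Giff mem_Collect_eq by (auto simp: x_def)
      moreover have "restrict x {..<r} = y"
        using y by (auto simp: fun_eq_iff x_def PiE_iff extensional_def)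
      ultimately show "y \<in> (\<lambda>x. restrict x {..<r}) ` ?S" by blast
    qed
    show "(\<lambda>x. restrict x {..<r}) ` ?S \<subseteq> ?R"
    proof (rule image_subsetI)
      fix x assume "x \<in> ?S"
      then have "psd_matrix N (A x)" "(\<Sum>i<N. \<Sum>j<N. A x i j * M0 i j) \<le> 1"
        "\<forall>t<r. x t = (\<Sum>i<N. \<Sum>j<N. A x i j * Mt t i j)" unfolding Giff by auto
      then show "restrict x {..<r} \<in> ?R" by (intro CollectI conjI exI[of _ "A x"]) auto
    qed
  qed
  then show ?thesis unfolding projected_spectrahedron_def using spec by blast
qed

section \<open>Polynomials on tuples\<close>

lemma poly_function_mono:
  assumes "poly_function n j p" "j \<le> k"
  shows "poly_function n k p"
proof -
  have "poly_function n (j + (k - j)) (\<lambda>v. p v * 1)" by (rule poly_function.mult[OF assms(1) poly_function.const])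
  then show ?thesis using assms(2) by simp
qed

lemma poly_function_scale: "poly_function n k p \<Longrightarrow> poly_function n k (\<lambda>v. c * p v)"
  using poly_function.mult[OF poly_function.const[of n 0 c]] by fastforce

lemma poly_function_sum:
  "(\<And>i. i \<in> A \<Longrightarrow> poly_function n k (p i)) \<Longrightarrow> poly_function n k (\<lambda>v. \<Sum>i\<in>A. p i v)"
  by (induction A rule: infinite_finite_induct) (auto intro: poly_function.intros)

lemma poly_function_power: "poly_function n k p \<Longrightarrow> poly_function n (k * N) (\<lambda>v. p v ^ N)"
  by (induction N) (auto intro: poly_function.intros)

lemma poly_function_prod_coord:
  "(\<And>i. i < N \<Longrightarrow> linear (f i)) \<Longrightarrow> N \<le> n \<Longrightarrow> poly_function n N (\<lambda>v. \<Prod>i<N. f i (v i))"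
proof (induction N)
  case 0 then show ?case by (simp add: poly_function.const)
next
  case (Suc N)
  then have "poly_function n (N + Suc 0) (\<lambda>v. (\<Prod>i<N. f i (v i)) * f N (v N))"
    by (intro poly_function.mult poly_function.coord) auto
  then show ?case by simp
qed

lemma poly_function_continuous_on:
  fixes V :: "'v::real_normed_vector set"
  assumes "poly_function n k p" and V: "fin_dim V"
  shows "continuous_on (tuples n V) p"
  using assms(1)
proof induction
  case (coord f i k)
  show ?case
    by (rule continuous_on_compose2[OF linear_continuous_on_fin_dim[OF V coord(1)] continuous_on_coordinate])
      (use coord in auto)
qed (auto intro: continuous_intros)

text \<open>A monomial in the coordinates of the entries is encoded by the list of its factors, pairs of a position in the
  tuple and a coordinate; the product of monomials is then given by the concatenation of lists.\<close>

lemma poly_function_finite_span: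
  fixes V :: "'v::real_vector set"
  assumes V: "fin_dim V"
  obtains L :: "(nat \<times> nat) list set" and mon where "finite L" "\<And>xs. xs \<in> L \<Longrightarrow> poly_function n k (mon xs)"
    "\<And>a. poly_function n k a \<Longrightarrow> \<exists>c. \<forall>v\<in>tuples n V. a v = (\<Sum>xs\<in>L. c xs * mon xs v)"
proof -
  define m where "m = dim V"
  obtain b where "basis_of (dim V) b V" using basis_of_exists[OF V] .
  then have b: "basis_of m b V" by (simp add: m_def)
  obtain g where g: "\<And>i. linear (g i)" "\<And>x. x \<in> V \<Longrightarrow> (\<Sum>i<m. g i x *\<^sub>R b i) = x"
    by (rule basis_of_dual[OF b]) (rule that)
  define mon where "mon xs v = (\<Prod>(i, a)\<leftarrow>xs. g a (v i))" for xs :: "(nat \<times> nat) list" and v :: "nat \<Rightarrow> 'v"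
  define L where "L k = {xs :: (nat \<times> nat) list. set xs \<subseteq> {..<n} \<times> {..<m} \<and> length xs \<le> k}" for k
  have fin: "finite (L k)" for k unfolding L_def by (rule finite_lists_length_le) simp
  have poly: "poly_function n (length xs) (mon xs)" if "set xs \<subseteq> {..<n} \<times> {..<m}" for xs
    using that
  proof (induction xs)
    case Nil then show ?case by (simp add: mon_def poly_function.const)
  next
    case (Cons x xs)
    have "poly_function n (Suc 0 + length xs) (\<lambda>v. g (snd x) (v (fst x)) * mon xs v)"
      using Cons by (intro poly_function.mult poly_function.coord g) auto
    then show ?case by (simp add: mon_def split_beta)
  qed
  have ex: "\<exists>c. \<forall>v\<in>tuples n V. a v = (\<Sum>xs\<in>L k. c xs * mon xs v)" if "poly_function n k a" for k a
    using that
  proof induction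
    case (const k c)
    have "[] \<in> L k" by (simp add: L_def)
    then have "(\<Sum>xs\<in>L k. (if xs = [] then c else 0) * mon xs v) = c" for v
      using fin[of k] by (simp add: if_distrib[of "\<lambda>x. x * _"] sum.delta mon_def cong: if_cong)
    then show ?case by (intro exI[of _ "\<lambda>xs. if xs = [] then c else 0"]) simp
  next
    case (coord f i k)
    define S where "S = (\<lambda>a. [(i, a)]) ` {..<m}"
    have S: "S \<subseteq> L (Suc k)" using coord by (auto simp: S_def L_def)
    have "f (v i) = (\<Sum>xs\<in>L (Suc k). (if xs \<in> S then f (b (snd (hd xs))) else 0) * mon xs v)"
      if v: "v \<in> tuples n V" for v
    proof -
      have "v i \<in> V" using PiE_mem[OF v, of i] coord by simp
      then have "f (v i) = f (\<Sum>a<m. g a (v i) *\<^sub>R b a)" by (simp add: g(2))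
      also have "\<dots> = (\<Sum>a<m. f (b a) * g a (v i))"
        by (simp add: linear_sum[OF coord(1)] linear_scale[OF coord(1)] mult.commute)
      also have "\<dots> = (\<Sum>xs\<in>S. f (b (snd (hd xs))) * mon xs v)"
        unfolding S_def by (subst sum.reindex) (auto simp: inj_on_def mon_def)
      also have "\<dots> = (\<Sum>xs\<in>L (Suc k). (if xs \<in> S then f (b (snd (hd xs))) else 0) * mon xs v)"
        by (rule sum.mono_neutral_cong_left) (use S fin in auto)
      finally show ?thesis .
    qed
    then show ?case by (intro exI[of _ "\<lambda>xs. if xs \<in> S then f (b (snd (hd xs))) else 0"]) simp
  next
    case (add k p q)
    then obtain c d where "\<forall>v\<in>tuples n V. p v = (\<Sum>xs\<in>L k. c xs * mon xs v)"
      "\<forall>v\<in>tuples n V. q v = (\<Sum>xs\<in>L k. d xs * mon xs v)" by blast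
    then show ?case by (intro exI[of _ "\<lambda>xs. c xs + d xs"]) (simp add: algebra_simps sum.distrib)
  next
    case (mult j p k q)
    then obtain c d where cd: "\<And>v. v \<in> tuples n V \<Longrightarrow> p v = (\<Sum>xs\<in>L j. c xs * mon xs v)"
      "\<And>v. v \<in> tuples n V \<Longrightarrow> q v = (\<Sum>xs\<in>L k. d xs * mon xs v)" by blast
    let ?P = "L j \<times> L k"
    define e where "e zs = (\<Sum>(xs, ys)\<in>{p \<in> ?P. fst p @ snd p = zs}. c xs * d ys)" for zs
    have "p v * q v = (\<Sum>zs\<in>L (j + k). e zs * mon zs v)" if v: "v \<in> tuples n V" for v
    proof -
      have "p v * q v = (\<Sum>(xs, ys)\<in>?P. (c xs * mon xs v) * (d ys * mon ys v))"
        by (simp add: cd[OF v] sum_product sum.cartesian_product)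
      also have "\<dots> = (\<Sum>p\<in>?P. c (fst p) * d (snd p) * mon (fst p @ snd p) v)"
        by (intro sum.cong) (auto simp: mon_def)
      also have "\<dots> = (\<Sum>zs\<in>L (j + k). \<Sum>p\<in>{p \<in> ?P. fst p @ snd p = zs}. c (fst p) * d (snd p) * mon (fst p @ snd p) v)"
        by (rule sum.group[symmetric]) (use fin in \<open>auto simp: L_def\<close>)
      also have "\<dots> = (\<Sum>zs\<in>L (j + k). e zs * mon zs v)"
        unfolding e_def sum_distrib_right by (intro sum.cong) auto
      finally show ?thesis .
    qed
    then show ?case by (intro exI[of _ e]) simp
  qed
  have "poly_function n k (mon xs)" if "xs \<in> L k" for xs
    using poly[of xs] that poly_function_mono[of n "length xs" "mon xs" k] by (auto simp: L_def)
  then show thesis using that[of "L k" mon] fin ex by blast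
qed

text \<open>A spanning family of least size is linearly independent.\<close>

lemma poly_function_basis:
  fixes V :: "'v::real_vector set"
  assumes V: "fin_dim V" and P: "P \<subseteq> V"
  shows "\<exists>(N::nat) mm. (\<forall>i<N. poly_function n k (mm i)) \<and>
    (\<forall>a. poly_function n k a \<longrightarrow> (\<exists>c. \<forall>v\<in>tuples n P. a v = (\<Sum>i<N. c i * mm i v))) \<and>
    (\<forall>c. (\<forall>v\<in>tuples n P. (\<Sum>i<N. c i * mm i v) = 0) \<longrightarrow> (\<forall>i<N. c i = 0))"
proof -
  obtain L :: "(nat \<times> nat) list set" and mon where L: "finite L" "\<And>xs. xs \<in> L \<Longrightarrow> poly_function n k (mon xs)"
    "\<And>a. poly_function n k a \<Longrightarrow> \<exists>c. \<forall>v\<in>tuples n V. a v = (\<Sum>xs\<in>L. c xs * mon xs v)"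
    by (rule poly_function_finite_span[OF V, of n k]) (rule that)
  define Q where "Q S \<longleftrightarrow> S \<subseteq> L \<and> (\<forall>a. poly_function n k a \<longrightarrow> (\<exists>c. \<forall>v\<in>tuples n P. a v = (\<Sum>xs\<in>S. c xs * mon xs v)))" for S
  have "Q L"
    unfolding Q_def
  proof (intro conjI allI impI)
    fix a :: "(nat \<Rightarrow> 'v) \<Rightarrow> real" assume "poly_function n k a"
    then obtain c where c: "\<forall>v\<in>tuples n V. a v = (\<Sum>xs\<in>L. c xs * mon xs v)" using L(3) by blast
    have "\<forall>v\<in>tuples n P. a v = (\<Sum>xs\<in>L. c xs * mon xs v)"
      by (intro ballI c[rule_format] tuples_mono[OF _ P])
    then show "\<exists>c. \<forall>v\<in>tuples n P. a v = (\<Sum>xs\<in>L. c xs * mon xs v)" by (intro exI[of _ c])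
  qed simp
  then obtain S where S: "Q S" "\<And>S'. Q S' \<Longrightarrow> card S \<le> card S'"
    using ex_has_least_nat[of Q L card] by blast
  have SL: "S \<subseteq> L" and span: "\<And>a. poly_function n k a \<Longrightarrow> \<exists>c. \<forall>v\<in>tuples n P. a v = (\<Sum>xs\<in>S. c xs * mon xs v)"
    using S(1) by (auto simp: Q_def)
  have finS: "finite S" using SL L(1) by (rule finite_subset)
  have ind: "c xs = 0" if c: "\<And>v. v \<in> tuples n P \<Longrightarrow> (\<Sum>xs\<in>S. c xs * mon xs v) = 0" and xs: "xs \<in> S" for c xs
  proof (rule ccontr)
    assume nz: "c xs \<noteq> 0"
    have "Q (S - {xs})"
      unfolding Q_def
    proof (intro conjI allI impI)
      show "S - {xs} \<subseteq> L" using SL by auto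
      fix a :: "(nat \<Rightarrow> 'v) \<Rightarrow> real" assume "poly_function n k a"
      then obtain d where d: "\<forall>v\<in>tuples n P. a v = (\<Sum>xs\<in>S. d xs * mon xs v)" using span by blast
      define e where "e ys = d ys - d xs / c xs * c ys" for ys
      have "a v = (\<Sum>ys\<in>S - {xs}. e ys * mon ys v)" if v: "v \<in> tuples n P" for v
      proof -
        have "(\<Sum>ys\<in>S. e ys * mon ys v) = (\<Sum>ys\<in>S. d ys * mon ys v) - d xs / c xs * (\<Sum>ys\<in>S. c ys * mon ys v)"
          unfolding e_def by (simp add: left_diff_distrib sum_subtractf sum_distrib_left mult.assoc)
        then have "(\<Sum>ys\<in>S. e ys * mon ys v) = a v" using d v c[OF v] by simp
        moreover have "e xs = 0" using nz by (simp add: e_def)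
        ultimately show ?thesis using sum.remove[OF finS xs, of "\<lambda>ys. e ys * mon ys v"] by simp
      qed
      then show "\<exists>c. \<forall>v\<in>tuples n P. a v = (\<Sum>xs\<in>S - {xs}. c xs * mon xs v)" by blast
    qed
    then have "card S \<le> card (S - {xs})" by (rule S(2))
    then show False using finS xs by (metis card_Diff1_less not_le)
  qed
  obtain h where h: "bij_betw h {..<card S} S"
    using ex_bij_betw_nat_finite[OF finS] by (auto simp: atLeast0LessThan)
  have hS: "h i \<in> S" if "i < card S" for i using h that by (auto simp: bij_betw_def)
  have re: "(\<Sum>i<card S. F (h i)) = (\<Sum>xs\<in>S. F xs)" for F :: "_ \<Rightarrow> real" by (rule sum.reindex_bij_betw[OF h])
  show ?thesis
  proof (intro exI[of _ "card S"] exI[of _ "\<lambda>i. mon (h i)"] conjI allI impI)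
    show "poly_function n k (mon (h i))" if "i < card S" for i using L(2) hS[OF that] SL by auto
    show "\<exists>c. \<forall>v\<in>tuples n P. a v = (\<Sum>i<card S. c i * mon (h i) v)" if pa: "poly_function n k a" for a
    proof -
      obtain c where c: "\<forall>v\<in>tuples n P. a v = (\<Sum>xs\<in>S. c xs * mon xs v)" using span[OF pa] by blast
      then show ?thesis by (intro exI[of _ "\<lambda>i. c (h i)"]) (simp add: re[of "\<lambda>xs. c xs * mon xs _"])
    qed
    fix c i assume c: "\<forall>v\<in>tuples n P. (\<Sum>i<card S. c i * mon (h i) v) = 0" and i: "i < card S"
    let ?c = "\<lambda>xs. c (the_inv_into {..<card S} h xs)"
    have inv: "?c (h i) = c i" if "i < card S" for i
      using the_inv_into_f_f[of h "{..<card S}" i] h that by (auto simp: bij_betw_def)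
    have "(\<Sum>xs\<in>S. ?c xs * mon xs v) = 0" if "v \<in> tuples n P" for v
      using c[rule_format, OF that] inv unfolding re[of "\<lambda>xs. ?c xs * mon xs v", symmetric] by simp
    from ind[of ?c, OF this hS[OF i]] inv[OF i] show "c i = 0" by simp
  qed
qed

section \<open>Approximation by truncated moments\<close>

locale moment_setting =
  fixes V P :: "'v::real_normed_vector set" and mP :: "'v measure" and n :: nat
  assumes V: "fin_dim V" and P: "P \<subseteq> V" "compact P" and supp: "supported_measure P mP"
begin

abbreviation \<mu> where "\<mu> \<equiv> PiM {..<n} (\<lambda>_. mP)"

lemma space_mP: "space mP = P"
  using supp sets_eq_imp_space_eq[of mP "restrict_space borel P"]
  by (simp add: supported_measure_def space_restrict_space)

lemma space_\<mu>: "space \<mu> = tuples n P"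
  by (simp add: space_PiM space_mP)

lemma finite_mP: "finite_measure mP"
  using supp by (simp add: supported_measure_def)

lemma open_in_mP: "open U \<Longrightarrow> U \<inter> P \<in> sets mP"
  using supp by (auto simp: supported_measure_def sets_restrict_space Int_commute)

sublocale product: product_sigma_finite "\<lambda>_::nat. mP"
  using finite_mP by (simp add: product_sigma_finite_def finite_measure_def)

sublocale finite_measure \<mu>
proof
  interpret m: finite_measure mP by (rule finite_mP)
  have "emeasure \<mu> (space \<mu>) = (\<Prod>i<n. emeasure mP P)"
    unfolding space_\<mu> by (rule product.emeasure_PiM) (auto simp flip: space_mP)
  then show "emeasure \<mu> (space \<mu>) \<noteq> \<infinity>"
    by (simp add: ennreal_prod_eq_top power_eq_top_ennreal)
qed

lemma poly_continuous: "poly_function n k a \<Longrightarrow> continuous_on (tuples n P) a"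
  by (rule continuous_on_subset[OF poly_function_continuous_on[OF _ V]], assumption) (intro PiE_mono P(1))

lemma poly_measurable: "poly_function n k a \<Longrightarrow> a \<in> borel_measurable \<mu>"
proof (induction rule: poly_function.induct)
  case (coord f i k)
  have "f \<in> borel_measurable (restrict_space borel P)"
    by (intro borel_measurable_continuous_on_restrict continuous_on_subset[OF linear_continuous_on_fin_dim[OF V coord(1)] P(1)])
  moreover have "borel_measurable mP = borel_measurable (restrict_space borel P)"
    by (rule measurable_cong_sets) (use supp in \<open>simp_all add: supported_measure_def\<close>)
  ultimately have "f \<in> borel_measurable mP" by metis
  then show ?case using coord(2) by (intro measurable_compose[OF measurable_component_singleton]) auto
qed auto

lemma poly_bounded:
  assumes "poly_function n k a"
  obtains B where "B > 0" "\<And>v. v \<in> tuples n P \<Longrightarrow> \<bar>a v\<bar> \<le> B"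
proof -
  have "compact (a ` tuples n P)"
    by (rule compact_continuous_image[OF poly_continuous[OF assms] compact_tuples[OF P(2)]])
  from compact_imp_bounded[OF this] obtain B where B: "\<forall>x\<in>a ` tuples n P. norm x \<le> B"
    unfolding bounded_iff by blast
  have "\<bar>a v\<bar> \<le> max B 1" if "v \<in> tuples n P" for v using bspec[OF B imageI[OF that]] by simp
  then show thesis using that[of "max B 1"] by simp
qed

lemma poly_integrable:
  assumes "poly_function n k a"
  shows "integrable \<mu> a"
proof -
  obtain B where B: "\<And>v. v \<in> tuples n P \<Longrightarrow> \<bar>a v\<bar> \<le> B" using poly_bounded[OF assms] by metis
  show ?thesis
    by (rule integrable_const_bound[of _ B]) (use B poly_measurable[OF assms] in \<open>auto simp flip: space_\<mu>\<close>)
qed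

text \<open>A neighbourhood of a point contains a box of neighbourhoods.\<close>

lemma open_positive:
  assumes U: "open U" "v0 \<in> U" "v0 \<in> tuples n P" and meas: "U \<inter> tuples n P \<in> sets \<mu>"
  shows "measure \<mu> (U \<inter> tuples n P) > 0"
proof -
  have "openin (product_topology (\<lambda>i. euclidean) UNIV) U"
    using U(1) by (simp add: euclidean_product_topology)
  from product_topology_open_contains_basis[OF this U(2)]
  obtain X where X: "v0 \<in> (\<Pi>\<^sub>E i\<in>UNIV. X i)" "\<And>i. open (X i)" "(\<Pi>\<^sub>E i\<in>UNIV. X i) \<subseteq> U" by auto
  let ?B = "PiE {..<n} (\<lambda>i. X i \<inter> P)"
  have vX: "v0 i \<in> X i" for i using X(1) by auto
  have "?B \<subseteq> U \<inter> tuples n P"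
  proof
    fix w assume w: "w \<in> ?B"
    have "w i \<in> X i" for i
      using PiE_mem[OF w, of i] PiE_arb[OF w, of i] PiE_arb[OF U(3), of i] vX[of i] by (cases "i < n") auto
    then have "w \<in> U" using X(3) by auto
    moreover have "w \<in> tuples n P" using w by auto
    ultimately show "w \<in> U \<inter> tuples n P" by simp
  qed
  then have le: "emeasure \<mu> ?B \<le> emeasure \<mu> (U \<inter> tuples n P)" by (rule emeasure_mono[OF _ meas])
  have eq: "emeasure \<mu> ?B = (\<Prod>i<n. emeasure mP (X i \<inter> P))"
    by (rule product.emeasure_PiM) (auto intro: open_in_mP X)
  have "emeasure mP (X i \<inter> P) > 0" if "i < n" for i
    using supp X(2)[of i] vX[of i] PiE_mem[OF U(3), of i] that unfolding supported_measure_def by blast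
  then have "(\<Prod>i<N. emeasure mP (X i \<inter> P)) > 0" if "N \<le> n" for N
    using that by (induction N) (auto simp: ennreal_zero_less_mult_iff)
  from this[OF order_refl] le have "emeasure \<mu> (U \<inter> tuples n P) > 0"
    unfolding eq by (rule less_le_trans)
  then show ?thesis by (simp add: emeasure_eq_measure)
qed

lemma poly_superlevel_positive:
  assumes a: "poly_function n k a" and v0: "v0 \<in> tuples n P" "c < a v0"
  shows "{v \<in> tuples n P. c < a v} \<in> sets \<mu>" "measure \<mu> {v \<in> tuples n P. c < a v} > 0"
proof -
  have "{v \<in> space \<mu>. c < a v} \<in> sets \<mu>" using poly_measurable[OF a] by simp
  then show meas: "{v \<in> tuples n P. c < a v} \<in> sets \<mu>" by (simp add: space_\<mu>)
  obtain U where U: "open U" "U \<inter> tuples n P = a -` {c<..} \<inter> tuples n P"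
    using poly_continuous[OF a] unfolding continuous_on_open_invariant by (metis open_greaterThan)
  then have eq: "U \<inter> tuples n P = {v \<in> tuples n P. c < a v}" by auto
  then have "v0 \<in> U" using v0 by auto
  from open_positive[OF U(1) this v0(1)] meas show "measure \<mu> {v \<in> tuples n P. c < a v} > 0" by (simp add: eq)
qed

lemma poly_square: "poly_function n k a \<Longrightarrow> poly_function n (k + k) (\<lambda>v. (a v)\<^sup>2)"
  unfolding power2_eq_square by (rule poly_function.mult)

lemma square_integral_zero:
  assumes a: "poly_function n k a" and z: "(\<integral>v. (a v)\<^sup>2 \<partial>\<mu>) = 0" and v: "v \<in> tuples n P"
  shows "a v = 0"
proof (rule ccontr)
  assume nz: "a v \<noteq> 0"
  have "AE v in \<mu>. (a v)\<^sup>2 = 0"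
    using integral_nonneg_eq_0_iff_AE[OF poly_integrable[OF poly_square[OF a]]] z by simp
  then have "AE v in \<mu>. v \<notin> {v \<in> tuples n P. 0 < (a v)\<^sup>2}" by eventually_elim auto
  then have "measure \<mu> {v \<in> tuples n P. 0 < (a v)\<^sup>2} = 0"
    using poly_superlevel_positive(1)[OF poly_square[OF a] v, of 0] nz
    by (simp add: AE_iff_measurable[OF _ refl] measure_eq_AE[of _ "{}"] measure_eq_0_null_sets AE_iff_null_sets)
  then show False using poly_superlevel_positive(2)[OF poly_square[OF a] v, of 0] nz by simp
qed

text \<open>If \<open>g\<close> is negative somewhere, then the powers of \<open>M - g\<close>, where \<open>\<bar>g\<bar> \<le> M\<close>, concentrate on the region
  where \<open>g\<close> is most negative.\<close>

lemma nonneg_if_all_square_integrals: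
  assumes g: "poly_function n d g" and pos: "\<And>k a. poly_function n k a \<Longrightarrow> 0 \<le> (\<integral>v. g v * (a v)\<^sup>2 \<partial>\<mu>)"
    and v0: "v0 \<in> tuples n P"
  shows "0 \<le> g v0"
proof (rule ccontr)
  assume neg: "\<not> 0 \<le> g v0"
  define \<delta> where "\<delta> = - g v0 / 2"
  have d: "\<delta> > 0" "\<delta> < - g v0" using neg by (auto simp: \<delta>_def)
  obtain M where M: "M > 0" "\<And>v. v \<in> tuples n P \<Longrightarrow> \<bar>g v\<bar> \<le> M" using poly_bounded[OF g] by metis
  define A where "A = {v \<in> tuples n P. \<delta> < - g v}"
  have ng: "poly_function n d (\<lambda>v. - g v)" using poly_function_scale[OF g, of "-1"] by simp
  have A: "A \<in> sets \<mu>" "measure \<mu> A > 0"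
    unfolding A_def using poly_superlevel_positive[OF ng v0 d(2)] by auto
  have ineq: "\<delta> * measure \<mu> A * ((M + \<delta>) / M) ^ (2 * N) \<le> M * measure \<mu> (space \<mu>)" for N
  proof -
    define a where "a v = (M - g v) ^ N" for v
    have a: "poly_function n (d * N) a"
      unfolding a_def using poly_function_power[OF poly_function.add[OF poly_function.const[of n d M] ng], of N] by simp
    have bound: "g v * (a v)\<^sup>2 \<le> M * M ^ (2 * N) - \<delta> * (M + \<delta>) ^ (2 * N) * indicator A v" if v: "v \<in> space \<mu>" for v
    proof -
      have gM: "\<bar>g v\<bar> \<le> M" using M(2) v by (simp add: space_\<mu>)
      have a2: "(a v)\<^sup>2 = (M - g v) ^ (2 * N)" by (simp add: a_def power_mult[symmetric] mult.commute)
      show ?thesis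
      proof (cases "v \<in> A")
        case True
        then have gd: "\<delta> < - g v" by (simp add: A_def)
        have "\<delta> * (M + \<delta>) ^ (2 * N) \<le> - g v * (M - g v) ^ (2 * N)"
          using gd d(1) M(1) by (intro mult_mono power_mono) auto
        moreover have "0 \<le> M * M ^ (2 * N)" using M(1) by simp
        ultimately show ?thesis using True by (simp add: a2)
      next
        case False
        have "g v * (M - g v) ^ (2 * N) \<le> M * M ^ (2 * N)"
        proof (cases "g v \<ge> 0")
          case True
          then show ?thesis using gM by (intro mult_mono power_mono) auto
        next
          case False
          then have "g v * (M - g v) ^ (2 * N) \<le> 0" using M(1) by (intro mult_nonpos_nonneg) auto
          then show ?thesis using M(1) by (smt (verit) mult_nonneg_nonneg zero_le_power)
        qed
        then show ?thesis using False by (simp add: a2)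
      qed
    qed
    have "0 \<le> (\<integral>v. g v * (a v)\<^sup>2 \<partial>\<mu>)" by (rule pos[OF a])
    also have "\<dots> \<le> (\<integral>v. M * M ^ (2 * N) - \<delta> * (M + \<delta>) ^ (2 * N) * indicator A v \<partial>\<mu>)"
      using bound A(1) by (intro integral_mono poly_integrable[OF poly_function.mult[OF g poly_square[OF a]]]) (auto simp: emeasure_eq_measure)
    also have "\<dots> = M * M ^ (2 * N) * measure \<mu> (space \<mu>) - \<delta> * (M + \<delta>) ^ (2 * N) * measure \<mu> A"
      using A(1) sets.sets_into_space[OF A(1)] by (subst Bochner_Integration.integral_diff) (auto simp: emeasure_eq_measure Int_absorb2 Int_absorb1)
    finally have "\<delta> * measure \<mu> A * (M + \<delta>) ^ (2 * N) \<le> M * measure \<mu> (space \<mu>) * M ^ (2 * N)" by (simp add: mult_ac)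
    then show ?thesis using M(1) by (simp add: power_divide field_simps)
  qed
  have "1 < ((M + \<delta>) / M)\<^sup>2" using M(1) d(1) by (simp add: field_simps power_strict_mono one_less_power)
  then obtain N where "M * measure \<mu> (space \<mu>) / (\<delta> * measure \<mu> A) < (((M + \<delta>) / M)\<^sup>2) ^ N"
    using real_arch_pow by blast
  moreover have "\<delta> * measure \<mu> A > 0" using d A by simp
  moreover have "((M + \<delta>) / M) ^ (2 * N) = (((M + \<delta>) / M)\<^sup>2) ^ N" by (rule power_mult)
  ultimately have "M * measure \<mu> (space \<mu>) < \<delta> * measure \<mu> A * ((M + \<delta>) / M) ^ (2 * N)"
    by (simp only: pos_divide_less_eq mult.commute)
  then show False using ineq[of N] by simp
qed

end

text \<open>The approximation scheme makes sense for every polynomial map with components \<open>T i\<close> in place of the components of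
  the universal map.  The convex hull of the image of this map is a subset of an auxiliary space \<open>M\<close> with basis \<open>b\<close>, which
  allows the use of convexity and compactness in a real vector space.\<close>

locale polynomial_body = moment_setting V P mP n
  for V P :: "'v::real_normed_vector set" and mP :: "'v measure" and n :: nat +
  fixes r d :: nat and T :: "nat \<Rightarrow> (nat \<Rightarrow> 'v) \<Rightarrow> real"
    and M :: "'w::real_normed_vector set" and b :: "nat \<Rightarrow> 'w"
  assumes T: "\<And>i. i < r \<Longrightarrow> poly_function n d (T i)" and b: "basis_of r b M"
begin

definition from_coords :: "(nat \<Rightarrow> real) \<Rightarrow> 'w" where
  "from_coords y = (\<Sum>i<r. y i *\<^sub>R b i)"

definition body :: "'w set" where
  "body = convex hull ((\<lambda>v. from_coords (\<lambda>i. T i v)) ` tuples n P)"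

abbreviation Q where "Q k \<equiv> approx_Q n r T mP k"

text \<open>The numbers \<open>sq a\<close> and \<open>moment a i\<close> are the coefficients of the linear inequality that \<open>a\<close> imposes on the
  elements of \<open>Q k\<close>.\<close>

definition sq :: "((nat \<Rightarrow> 'v) \<Rightarrow> real) \<Rightarrow> real" where "sq a = (\<integral>v. (a v)\<^sup>2 \<partial>\<mu>)"

definition moment :: "((nat \<Rightarrow> 'v) \<Rightarrow> real) \<Rightarrow> nat \<Rightarrow> real" where
  "moment a i = (\<integral>v. T i v * (a v)\<^sup>2 \<partial>\<mu>)"

lemma sq_nonneg: "0 \<le> sq a"
  by (simp add: sq_def)

lemma from_coords_in: "from_coords y \<in> M"
  unfolding from_coords_def by (rule basis_of_sum_in[OF b])

lemma fin_dim_M: "fin_dim M"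
  by (rule basis_of_fin_dim[OF b])

lemma from_coords_affine: "s *\<^sub>R from_coords x + t *\<^sub>R from_coords y = from_coords (\<lambda>i. s * x i + t * y i)"
  by (simp add: from_coords_def scaleR_sum_right sum.distrib scaleR_left_distrib)

lemma from_coords_cong: "(\<And>i. i < r \<Longrightarrow> x i = y i) \<Longrightarrow> from_coords x = from_coords y"
  by (simp add: from_coords_def)

lemma weighted_integral:
  assumes a: "poly_function n k a"
  shows "(\<integral>v. (1 + (\<Sum>i<r. l i * T i v)) * (a v)\<^sup>2 \<partial>\<mu>) = sq a + (\<Sum>i<r. l i * moment a i)"
proof -
  have int: "integrable \<mu> (\<lambda>v. T i v * (a v)\<^sup>2)" if "i < r" for i
    by (rule poly_integrable[OF poly_function.mult[OF T[OF that] poly_square[OF a]]])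
  have "(\<integral>v. (1 + (\<Sum>i<r. l i * T i v)) * (a v)\<^sup>2 \<partial>\<mu>) = (\<integral>v. (a v)\<^sup>2 + (\<Sum>i<r. l i * (T i v * (a v)\<^sup>2)) \<partial>\<mu>)"
    by (simp add: distrib_right sum_distrib_right mult.assoc)
  also have "\<dots> = sq a + (\<integral>v. (\<Sum>i<r. l i * (T i v * (a v)\<^sup>2)) \<partial>\<mu>)"
    unfolding sq_def using int
    by (intro Bochner_Integration.integral_add poly_integrable[OF poly_square[OF a]] Bochner_Integration.integrable_sum) auto
  also have "(\<integral>v. (\<Sum>i<r. l i * (T i v * (a v)\<^sup>2)) \<partial>\<mu>) = (\<Sum>i<r. l i * moment a i)"
    unfolding moment_def using int by (subst Bochner_Integration.integral_sum) auto
  finally show ?thesis .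
qed

lemma approx_Q_iff:
  "l \<in> Q k \<longleftrightarrow> l \<in> tuples r UNIV \<and> (\<forall>a. poly_function n k a \<longrightarrow> 0 \<le> sq a + (\<Sum>i<r. l i * moment a i))"
  unfolding approx_Q_def using weighted_integral by auto

lemma moment_zero:
  assumes a: "poly_function n k a" and z: "sq a = 0"
  shows "moment a i = 0"
proof -
  have "a v = 0" if "v \<in> space \<mu>" for v
    using square_integral_zero[OF a] z that by (simp add: sq_def space_\<mu>)
  then have "moment a i = (\<integral>v. 0 \<partial>\<mu>)" unfolding moment_def
    by (intro Bochner_Integration.integral_cong) auto
  then show ?thesis by simp
qed

lemma approx_Q_anti: "j \<le> k \<Longrightarrow> Q k \<subseteq> Q j"
  unfolding approx_Q_def using poly_function_mono by blast

lemma polar_incseq: "incseq (\<lambda>k. polar r (Q k))"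
proof (rule incseq_SucI)
  fix k show "polar r (Q k) \<le> polar r (Q (Suc k))"
    using approx_Q_anti[of k "Suc k"] by (auto simp: polar_def)
qed

lemma body_compact: "compact body" and body_in: "body \<subseteq> M"
proof -
  have "continuous_on (tuples n P) (\<lambda>v. from_coords (\<lambda>i. T i v))"
    unfolding from_coords_def using poly_continuous[OF T] by (intro continuous_intros) auto
  then have "compact ((\<lambda>v. from_coords (\<lambda>i. T i v)) ` tuples n P)"
    by (rule compact_continuous_image[OF _ compact_tuples[OF P(2)]])
  then show "compact body" unfolding body_def
    by (rule compact_convex_hull_fin_dim[OF fin_dim_M, rotated]) (use from_coords_in in auto)
  show "body \<subseteq> M" unfolding body_def
    by (intro hull_minimal subspace_imp_convex fin_dim_subspace[OF fin_dim_M]) (use from_coords_in in auto)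
qed

lemma body_convex: "convex body"
  by (simp add: body_def)

lemma coords_separation:
  assumes K: "compact K" "convex K" "0 \<in> K" "K \<subseteq> M" and y: "y \<in> tuples r UNIV" "from_coords y \<notin> K"
  shows "\<exists>l\<in>tuples r UNIV. (\<Sum>i<r. l i * y i) < -1 \<and> (\<forall>z. from_coords z \<in> K \<longrightarrow> (\<Sum>i<r. l i * z i) \<ge> -1)"
proof -
  obtain f where f: "\<And>i. linear (f i)" "\<And>i j. i < r \<Longrightarrow> j < r \<Longrightarrow> f i (b j) = (if i = j then 1 else 0)"
    "\<And>x. x \<in> M \<Longrightarrow> (\<Sum>i<r. f i x *\<^sub>R b i) = x"
    by (rule basis_of_dual[OF b]) (rule that)
  have fc: "f i (from_coords z) = z i" if "i < r" for i z
    unfolding from_coords_def by (rule dual_sum[OF f(1,2) that])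
  have inj: "x = 0" if "x \<in> M" "\<forall>i<r. f i x = 0" for x using f(3)[OF that(1)] that(2) by simp
  obtain l where l: "l \<in> tuples r UNIV" "(\<Sum>i<r. l i * f i (from_coords y)) < -1"
    "\<And>z. z \<in> K \<Longrightarrow> (\<Sum>i<r. l i * f i z) \<ge> -1"
    by (rule separation_in_coordinates[OF fin_dim_M f(1) inj K from_coords_in y(2)]) (use that in auto)
  have "(\<Sum>i<r. l i * f i (from_coords z)) = (\<Sum>i<r. l i * z i)" for z
    by (intro sum.cong) (auto simp: fc)
  then show ?thesis using l by (intro bexI[of _ l] conjI allI impI) (metis, metis)
qed

text \<open>Let \<open>mm\<close> be a basis of the polynomials of degree at most \<open>k\<close> on \<open>P\<^sup>n\<close>, and let \<open>M0\<close>, \<open>Mt\<close> be the matrices of the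
  quadratic forms \<open>sq\<close>, \<open>moment\<close>.  A functional \<open>l\<close> is in \<open>Q k\<close> if and only if \<open>M0 + (\<Sum>t<r. l t * Mt t)\<close> is
  positive semidefinite.  Its pairing with a positive semidefinite \<open>A\<close> is then non-negative, so the vectors of moments of
  such \<open>A\<close> with \<open>M0\<close>-trace at most 1 lie in the polar.  Conversely, the moments of polynomials \<open>a\<close> with \<open>sq a \<le> 1\<close>
  form a compact set, because \<open>M0\<close> is positive definite.  A vector outside of its convex hull is separated from it by an
  element of \<open>Q k\<close>.\<close>

lemma polar_projected_spectrahedron: "projected_spectrahedron r (polar r (Q k))"
proof -
  obtain N :: nat and mm where bas: "\<forall>i<N. poly_function n k (mm i)"
    "\<forall>a. poly_function n k a \<longrightarrow> (\<exists>c. \<forall>v\<in>tuples n P. a v = (\<Sum>i<N. c i * mm i v))"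
    "\<forall>c. (\<forall>v\<in>tuples n P. (\<Sum>i<N. c i * mm i v) = 0) \<longrightarrow> (\<forall>i<N. c i = 0)"
    using poly_function_basis[OF V P(1), of n k] by (elim exE conjE) (rule that)
  have mm: "poly_function n k (mm i)" if "i < N" for i using bas(1) that by simp
  have span: "\<exists>c. \<forall>v\<in>tuples n P. a v = (\<Sum>i<N. c i * mm i v)" if "poly_function n k a" for a
    using bas(2) that by simp
  have ind: "c i = 0" if "\<And>v. v \<in> tuples n P \<Longrightarrow> (\<Sum>i<N. c i * mm i v) = 0" "i < N" for c i
    using bas(3) that by simp
  define M0 where "M0 i j = (\<integral>v. mm i v * mm j v \<partial>\<mu>)" for i j
  define Mt where "Mt t i j = (\<integral>v. T t v * (mm i v * mm j v) \<partial>\<mu>)" for t i j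
  define comb where "comb c v = (\<Sum>i<N. c i * mm i v)" for c :: "nat \<Rightarrow> real" and v
  have comb: "poly_function n k (comb c)" for c
    unfolding comb_def by (intro poly_function_sum poly_function_scale mm) auto
  have int0: "integrable \<mu> (\<lambda>v. mm i v * mm j v)" if "i < N" "j < N" for i j
    by (rule poly_integrable[OF poly_function.mult[OF mm mm]]) (use that in auto)
  have intt: "integrable \<mu> (\<lambda>v. T t v * (mm i v * mm j v))" if "i < N" "j < N" "t < r" for i j t
    by (rule poly_integrable[OF poly_function.mult[OF T poly_function.mult[OF mm mm]]]) (use that in auto)
  have sq_comb: "sq (comb c) = (\<Sum>i<N. \<Sum>j<N. c i * c j * M0 i j)" for c
  proof -
    have "sq (comb c) = (\<integral>v. (\<Sum>i<N. \<Sum>j<N. c i * c j * (mm i v * mm j v)) \<partial>\<mu>)"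
      unfolding sq_def comb_def power2_eq_square sum_product by (simp add: mult_ac)
    also have "\<dots> = (\<Sum>i<N. \<Sum>j<N. (\<integral>v. c i * c j * (mm i v * mm j v) \<partial>\<mu>))"
      using int0 by (subst Bochner_Integration.integral_sum; (intro sum.cong refl)?) (auto intro!: Bochner_Integration.integral_sum Bochner_Integration.integrable_sum)
    finally show ?thesis by (simp add: M0_def)
  qed
  have moment_comb: "moment (comb c) t = (\<Sum>i<N. \<Sum>j<N. c i * c j * Mt t i j)" if t: "t < r" for c t
  proof -
    have "moment (comb c) t = (\<integral>v. (\<Sum>i<N. \<Sum>j<N. c i * c j * (T t v * (mm i v * mm j v))) \<partial>\<mu>)"
      unfolding moment_def comb_def power2_eq_square sum_product by (simp add: mult_ac sum_distrib_left)
    also have "\<dots> = (\<Sum>i<N. \<Sum>j<N. (\<integral>v. c i * c j * (T t v * (mm i v * mm j v)) \<partial>\<mu>))"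
      using intt t by (subst Bochner_Integration.integral_sum; (intro sum.cong refl)?) (auto intro!: Bochner_Integration.integral_sum Bochner_Integration.integrable_sum)
    finally show ?thesis by (simp add: Mt_def)
  qed
  have sq_moment_eq: "sq a = sq (comb c)" "moment a t = moment (comb c) t"
    if "\<forall>v\<in>tuples n P. a v = (\<Sum>i<N. c i * mm i v)" for a c t
    unfolding sq_def moment_def comb_def using that
    by (auto intro!: Bochner_Integration.integral_cong simp: space_\<mu>)
  let ?R = "{y \<in> tuples r UNIV. \<exists>A. psd_matrix N A \<and>
    (\<Sum>i<N. \<Sum>j<N. A i j * M0 i j) \<le> 1 \<and> (\<forall>t<r. y t = (\<Sum>i<N. \<Sum>j<N. A i j * Mt t i j))}"
  have "polar r (Q k) = ?R"
  proof
    show "?R \<subseteq> polar r (Q k)"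
    proof
      fix y assume "y \<in> ?R"
      then obtain A where y: "y \<in> tuples r UNIV" and A: "psd_matrix N A" "(\<Sum>i<N. \<Sum>j<N. A i j * M0 i j) \<le> 1"
        "\<And>t. t < r \<Longrightarrow> y t = (\<Sum>i<N. \<Sum>j<N. A i j * Mt t i j)" by auto
      have "-1 \<le> (\<Sum>t<r. l t * y t)" if l: "l \<in> Q k" for l
      proof -
        define B where "B i j = M0 i j + (\<Sum>t<r. l t * Mt t i j)" for i j
        have "psd_matrix N B"
          unfolding psd_matrix_def
        proof (intro conjI allI impI)
          show "B i j = B j i" for i j by (simp add: B_def M0_def Mt_def mult.commute)
          fix u
          have "0 \<le> sq (comb u) + (\<Sum>t<r. l t * moment (comb u) t)" using l comb unfolding approx_Q_iff by blast
          also have "(\<Sum>t<r. l t * moment (comb u) t) = (\<Sum>i<N. \<Sum>j<N. u i * (\<Sum>t<r. l t * Mt t i j) * u j)"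
          proof -
            have "(\<Sum>t<r. l t * moment (comb u) t) = (\<Sum>t<r. \<Sum>i<N. \<Sum>j<N. u i * (l t * Mt t i j) * u j)"
              by (simp add: moment_comb sum_distrib_left mult_ac)
            also have "\<dots> = (\<Sum>i<N. \<Sum>t<r. \<Sum>j<N. u i * (l t * Mt t i j) * u j)" by (rule sum.swap)
            also have "\<dots> = (\<Sum>i<N. \<Sum>j<N. \<Sum>t<r. u i * (l t * Mt t i j) * u j)" by (intro sum.cong refl sum.swap)
            finally show ?thesis by (simp add: sum_distrib_left sum_distrib_right)
          qed
          finally show "0 \<le> (\<Sum>i<N. \<Sum>j<N. u i * B i j * u j)"
            by (simp add: sq_comb B_def distrib_left distrib_right sum.distrib mult_ac)
        qed
        then have "0 \<le> (\<Sum>i<N. \<Sum>j<N. A i j * B i j)" by (rule psd_trace_nonneg[OF A(1)])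
        also have "\<dots> = (\<Sum>i<N. \<Sum>j<N. A i j * M0 i j) + (\<Sum>i<N. \<Sum>j<N. \<Sum>t<r. l t * (A i j * Mt t i j))"
          by (simp add: B_def distrib_left sum.distrib sum_distrib_left mult_ac)
        also have "(\<Sum>i<N. \<Sum>j<N. \<Sum>t<r. l t * (A i j * Mt t i j)) = (\<Sum>t<r. l t * y t)"
        proof -
          have "(\<Sum>i<N. \<Sum>j<N. \<Sum>t<r. l t * (A i j * Mt t i j)) = (\<Sum>i<N. \<Sum>t<r. \<Sum>j<N. l t * (A i j * Mt t i j))"
            by (intro sum.cong refl sum.swap)
          also have "\<dots> = (\<Sum>t<r. \<Sum>i<N. \<Sum>j<N. l t * (A i j * Mt t i j))" by (rule sum.swap)
          finally show ?thesis by (simp add: A(3) sum_distrib_left)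
        qed
        finally show ?thesis using A(2) by simp
      qed
      then show "y \<in> polar r (Q k)" using y by (simp add: polar_def)
    qed
  next
    show "polar r (Q k) \<subseteq> ?R"
    proof
      fix y assume y: "y \<in> polar r (Q k)"
      then have yt: "y \<in> tuples r UNIV" by (simp add: polar_def)
      define ball where "ball = {c \<in> tuples N UNIV. sq (comb c) \<le> 1}"
      define K where "K = convex hull ((\<lambda>c. from_coords (moment (comb c))) ` ball)"
      have pdef: "sq (comb c) > 0" if "i < N" "c i \<noteq> 0" for c i
      proof -
        have "sq (comb c) \<noteq> 0"
          using square_integral_zero[OF comb] ind[of c i] that by (auto simp: sq_def comb_def)
        then show ?thesis using sq_nonneg[of "comb c"] by simp
      qed
      have scale: "sq (comb (\<lambda>i\<in>{..<N}. s * c i)) = \<bar>s\<bar> ^ 2 * sq (comb c)"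
        "t < r \<Longrightarrow> moment (comb (\<lambda>i\<in>{..<N}. s * c i)) t = s\<^sup>2 * moment (comb c) t" for c s t
        by (simp_all add: sq_comb moment_comb sum_distrib_left power2_eq_square mult_ac)
      have cont: "continuous_on S (\<lambda>c. sq (comb c))" "t < r \<Longrightarrow> continuous_on S (\<lambda>c. moment (comb c) t)" for S t
        unfolding sq_comb by (intro continuous_intros) (simp only: moment_comb, intro continuous_intros)
      obtain \<delta> where \<delta>: "\<delta> > 0" "\<And>c i. c \<in> tuples N UNIV \<Longrightarrow> i < N \<Longrightarrow> \<delta> * \<bar>c i\<bar> ^ 2 \<le> sq (comb c)"
        by (rule homogeneous_lower_bound[OF cont(1) scale(1) pdef pos2]) auto
      have "ball = tuples N {- sqrt (1 / \<delta>)..sqrt (1 / \<delta>)} \<inter> {c. sq (comb c) \<le> 1}"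
      proof -
        have "\<bar>c i\<bar> \<le> sqrt (1 / \<delta>)" if "c \<in> ball" "i < N" for c i
        proof -
          have "\<delta> * \<bar>c i\<bar> ^ 2 \<le> 1" using \<delta>(2)[of c i] that by (auto simp: ball_def)
          then show ?thesis using \<delta>(1) by (intro real_le_rsqrt) (simp add: field_simps)
        qed
        then have sub: "c \<in> tuples N {- sqrt (1 / \<delta>)..sqrt (1 / \<delta>)}" if "c \<in> ball" for c
          using that by (auto simp: ball_def PiE_iff abs_le_iff minus_le_iff)
        show ?thesis
        proof (intro set_eqI iffI)
          fix c assume "c \<in> ball"
          then show "c \<in> tuples N {- sqrt (1 / \<delta>)..sqrt (1 / \<delta>)} \<inter> {c. sq (comb c) \<le> 1}"
            using sub[of c] unfolding ball_def by blast
        next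
          fix c assume "c \<in> tuples N {- sqrt (1 / \<delta>)..sqrt (1 / \<delta>)} \<inter> {c. sq (comb c) \<le> 1}"
          then show "c \<in> ball" using tuples_mono[of c N _ UNIV] unfolding ball_def by blast
        qed
      qed
      moreover have "closed {c. sq (comb c) \<le> 1}"
        by (intro closed_Collect_le continuous_on_const cont)
      ultimately have "compact ball" by (simp add: compact_Int_closed compact_tuples)
      then have "compact ((\<lambda>c. from_coords (moment (comb c))) ` ball)"
        by (rule compact_continuous_image[rotated]) (unfold from_coords_def, intro continuous_intros cont(2), auto)
      then have K: "compact K" unfolding K_def
        by (rule compact_convex_hull_fin_dim[OF fin_dim_M, rotated]) (use from_coords_in in auto)
      have Kconv: "convex K" by (simp add: K_def)
      have KM: "K \<subseteq> M" unfolding K_def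
        by (intro hull_minimal subspace_imp_convex fin_dim_subspace[OF fin_dim_M]) (use from_coords_in in auto)
      have inK: "from_coords (moment (comb c)) \<in> K" if "c \<in> ball" for c
        unfolding K_def using that by (intro hull_inc) auto
      have K0: "0 \<in> K"
      proof -
        let ?z = "\<lambda>i\<in>{..<N}. 0 :: real"
        have "sq (comb ?z) = 0" by (simp add: sq_comb)
        then have "?z \<in> ball" by (simp add: ball_def)
        moreover have "from_coords (moment (comb ?z)) = 0" by (simp add: from_coords_def moment_comb)
        ultimately show ?thesis using inK[of ?z] by simp
      qed
      have "from_coords y \<in> K"
      proof (rule ccontr)
        assume ny: "from_coords y \<notin> K"
        obtain l where l: "l \<in> tuples r UNIV" "(\<Sum>i<r. l i * y i) < -1"
          "\<And>z. from_coords z \<in> K \<Longrightarrow> (\<Sum>i<r. l i * z i) \<ge> -1"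
          using coords_separation[OF K Kconv K0 KM yt ny] by blast
        have "0 \<le> sq a + (\<Sum>i<r. l i * moment a i)" if a: "poly_function n k a" for a
        proof (cases "sq a = 0")
          case True then show ?thesis using moment_zero[OF a True] by simp
        next
          case False
          then have pos: "sq a > 0" using sq_nonneg[of a] by simp
          obtain c where c: "\<forall>v\<in>tuples n P. a v = (\<Sum>i<N. c i * mm i v)" using span[OF a] by blast
          note eq = sq_moment_eq[OF c]
          define s where "s = 1 / sqrt (sq a)"
          have s2: "s\<^sup>2 = 1 / sq a" using pos by (simp add: s_def power_divide)
          let ?c = "\<lambda>i\<in>{..<N}. s * c i"
          have "sq (comb ?c) = 1" using scale(1)[of s c] s2 pos eq(1) by simp
          then have "?c \<in> ball" by (simp add: ball_def)
          then have "-1 \<le> (\<Sum>i<r. l i * moment (comb ?c) i)" using l(3) inK by blast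
          also have "\<dots> = (\<Sum>i<r. l i * moment a i) / sq a"
            unfolding sum_divide_distrib using scale(2)[of _ s c] s2 eq(2) by (intro sum.cong) auto
          finally show ?thesis using pos by (simp add: field_simps)
        qed
        then have "l \<in> Q k" using l(1) by (simp add: approx_Q_iff)
        then show False using y l(2) unfolding polar_def by force
      qed
      also have "K \<subseteq> from_coords ` ?R"
        unfolding K_def
      proof (rule hull_minimal)
        show "(\<lambda>c. from_coords (moment (comb c))) ` ball \<subseteq> from_coords ` ?R"
        proof (rule image_subsetI)
          fix c assume c: "c \<in> ball"
          define A where "A i j = c i * c j" for i j
          have "psd_matrix N A"
            unfolding psd_matrix_def
          proof (intro conjI allI impI)
            show "A i j = A j i" for i j by (simp add: A_def mult.commute)
            fix u :: "nat \<Rightarrow> real"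
            have "(\<Sum>i<N. \<Sum>j<N. u i * A i j * u j) = (\<Sum>i<N. u i * c i)\<^sup>2"
              unfolding power2_eq_square sum_product A_def by (simp add: mult_ac)
            then show "0 \<le> (\<Sum>i<N. \<Sum>j<N. u i * A i j * u j)" by simp
          qed
          moreover have "(\<Sum>i<N. \<Sum>j<N. A i j * M0 i j) \<le> 1" using c by (simp add: ball_def sq_comb A_def)
          ultimately have "restrict (moment (comb c)) {..<r} \<in> ?R"
            by (intro CollectI conjI exI[of _ A]) (auto simp: moment_comb A_def)
          moreover have "from_coords (moment (comb c)) = from_coords (restrict (moment (comb c)) {..<r})"
            by (rule from_coords_cong) simp
          ultimately show "from_coords (moment (comb c)) \<in> from_coords ` ?R" by blast
        qed
        show "convex (from_coords ` ?R)"
        proof (rule convexI)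
          fix x y and s t :: real assume xy: "x \<in> from_coords ` ?R" "y \<in> from_coords ` ?R" and st: "0 \<le> s" "0 \<le> t" "s + t = 1"
          obtain p A where p: "x = from_coords p" "psd_matrix N A" "(\<Sum>i<N. \<Sum>j<N. A i j * M0 i j) \<le> 1"
            "\<And>t. t < r \<Longrightarrow> p t = (\<Sum>i<N. \<Sum>j<N. A i j * Mt t i j)" using xy(1) by auto
          obtain q B where q: "y = from_coords q" "psd_matrix N B" "(\<Sum>i<N. \<Sum>j<N. B i j * M0 i j) \<le> 1"
            "\<And>t. t < r \<Longrightarrow> q t = (\<Sum>i<N. \<Sum>j<N. B i j * Mt t i j)" using xy(2) by auto
          define C where "C i j = s * A i j + t * B i j" for i j
          have lin: "(\<Sum>i<N. \<Sum>j<N. C i j * m i j) = s * (\<Sum>i<N. \<Sum>j<N. A i j * m i j) + t * (\<Sum>i<N. \<Sum>j<N. B i j * m i j)" for m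
            by (simp add: C_def distrib_right sum.distrib sum_distrib_left mult.assoc)
          have "psd_matrix N C"
            unfolding psd_matrix_def
          proof (intro conjI allI impI)
            show "C i j = C j i" if "i < N" "j < N" for i j using p(2) q(2) that unfolding psd_matrix_def C_def by simp
            fix u :: "nat \<Rightarrow> real"
            have "(\<Sum>i<N. \<Sum>j<N. u i * C i j * u j) = (\<Sum>i<N. \<Sum>j<N. C i j * (u i * u j))" by (simp add: mult_ac)
            also have "\<dots> = s * (\<Sum>i<N. \<Sum>j<N. u i * A i j * u j) + t * (\<Sum>i<N. \<Sum>j<N. u i * B i j * u j)"
              unfolding lin by (simp add: mult_ac)
            also have "\<dots> \<ge> 0" using p(2) q(2) st unfolding psd_matrix_def by simp
            finally show "0 \<le> (\<Sum>i<N. \<Sum>j<N. u i * C i j * u j)" .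
          qed
          moreover have "(\<Sum>i<N. \<Sum>j<N. C i j * M0 i j) \<le> 1"
            unfolding lin using p(3) q(3) st convex_bound_le[of _ 1] by blast
          ultimately have "(\<lambda>i\<in>{..<r}. s * p i + t * q i) \<in> ?R"
            by (intro CollectI conjI exI[of _ C]) (auto simp: lin p(4) q(4))
          moreover have "s *\<^sub>R x + t *\<^sub>R y = from_coords (\<lambda>i\<in>{..<r}. s * p i + t * q i)"
            unfolding p(1) q(1) from_coords_affine by (rule from_coords_cong) simp
          ultimately show "s *\<^sub>R x + t *\<^sub>R y \<in> from_coords ` ?R" by blast
        qed
      qed
      finally obtain z where z: "z \<in> ?R" "from_coords y = from_coords z" by blast
      have "y = z"
      proof -
        obtain f where f: "\<And>i. linear (f i)" "\<And>i j. i < r \<Longrightarrow> j < r \<Longrightarrow> f i (b j) = (if i = j then 1 else 0 :: real)"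
          by (rule basis_of_dual[OF b]) (rule that)
        have "y i = z i" if "i < r" for i
          using arg_cong[OF z(2), of "f i"] dual_sum[of f r b i, OF f that] by (simp add: from_coords_def)
        then show ?thesis using yt z(1) by (auto simp: fun_eq_iff PiE_iff extensional_def) (metis)
      qed
      then show "y \<in> ?R" using z(1) by simp
    qed
  qed
  then show ?thesis using projected_spectrahedron_psd_image by simp
qed

text \<open>If a point of the polar were outside of the body, then for a separating functional \<open>l\<close> the polynomial
  \<open>1 + (\<Sum>i<r. l i * T i v)\<close> would be non-negative on all of \<open>P\<^sup>n\<close>, hence \<open>l\<close> in \<open>Q k\<close>.  If a point of the body were outside of the closure, then a separating \<open>l\<close> would be in
  all \<open>Q k\<close>, since the polars contain the normalised moment vectors, and this polynomial would be non-negative on \<open>P\<^sup>n\<close>.\<close>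

theorem body_eq_closure:
  assumes zero: "0 \<in> body"
  shows "body = closure (\<Union>k. from_coords ` polar r (Q k))" (is "_ = closure ?U")
proof
  have "from_coords y \<in> body" if y: "y \<in> polar r (Q k)" for y k
  proof (rule ccontr)
    assume ny: "from_coords y \<notin> body"
    have yt: "y \<in> tuples r UNIV" using y by (simp add: polar_def)
    obtain l where l: "l \<in> tuples r UNIV" "(\<Sum>i<r. l i * y i) < -1"
      "\<And>z. from_coords z \<in> body \<Longrightarrow> (\<Sum>i<r. l i * z i) \<ge> -1"
      using coords_separation[OF body_compact body_convex zero body_in yt ny] by blast
    have "0 \<le> 1 + (\<Sum>i<r. l i * T i v)" if "v \<in> tuples n P" for v
    proof -
      have "from_coords (\<lambda>i. T i v) \<in> body" unfolding body_def using that by (intro hull_inc) auto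
      from l(3)[OF this] show ?thesis by simp
    qed
    then have "l \<in> Q k" unfolding approx_Q_def using l(1)
      by (auto intro!: Bochner_Integration.integral_nonneg_AE AE_I2 mult_nonneg_nonneg simp: space_\<mu>)
    then show False using y l(2) unfolding polar_def by force
  qed
  then have "?U \<subseteq> body" by blast
  then show sub: "closure ?U \<subseteq> body"
    by (rule closure_minimal) (rule compact_imp_closed[OF body_compact])
  have Uconv: "convex ?U"
  proof (rule convexI)
    fix x y and s t :: real assume "x \<in> ?U" "y \<in> ?U" and st: "0 \<le> s" "0 \<le> t" "s + t = 1"
    then obtain p q i j where pq: "x = from_coords p" "p \<in> polar r (Q i)" "y = from_coords q" "q \<in> polar r (Q j)" by auto
    define k where "k = max i j"
    have p: "p \<in> polar r (Q k)" "q \<in> polar r (Q k)"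
      using pq polar_incseq monoD[OF polar_incseq, of i k] monoD[OF polar_incseq, of j k] by (auto simp: k_def)
    have "-1 \<le> (\<Sum>i<r. l i * (s * p i + t * q i))" if "l \<in> Q k" for l
    proof -
      have "-1 \<le> (\<Sum>i<r. l i * p i)" "-1 \<le> (\<Sum>i<r. l i * q i)" using p that by (auto simp: polar_def)
      then have "s * (-1) + t * (-1) \<le> s * (\<Sum>i<r. l i * p i) + t * (\<Sum>i<r. l i * q i)"
        using st by (intro add_mono mult_left_mono) auto
      also have "\<dots> = (\<Sum>i<r. l i * (s * p i + t * q i))"
        by (simp add: distrib_left sum.distrib sum_distrib_left mult_ac)
      finally show ?thesis using st by simp
    qed
    then have "(\<lambda>i\<in>{..<r}. s * p i + t * q i) \<in> polar r (Q k)" by (simp add: polar_def)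
    moreover have "s *\<^sub>R x + t *\<^sub>R y = from_coords (\<lambda>i\<in>{..<r}. s * p i + t * q i)"
      unfolding pq from_coords_affine by (rule from_coords_cong) simp
    ultimately show "s *\<^sub>R x + t *\<^sub>R y \<in> ?U" by blast
  qed
  have comp: "compact (closure ?U)"
    using compact_Int_closed[OF body_compact closed_closure, of ?U] sub by (simp add: Int_absorb1)
  have U0: "0 \<in> closure ?U"
  proof -
    have "(\<lambda>i\<in>{..<r}. 0) \<in> polar r (Q 0)" by (simp add: polar_def)
    then have "from_coords (\<lambda>i\<in>{..<r}. 0) \<in> ?U" by blast
    moreover have "from_coords (\<lambda>i\<in>{..<r}. 0) = 0" by (simp add: from_coords_def)
    ultimately show ?thesis using closure_subset[of ?U] by (simp only: subset_iff)
  qed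
  have "from_coords (\<lambda>i. T i v) \<in> closure ?U" if v: "v \<in> tuples n P" for v
  proof (rule ccontr)
    define y where "y = (\<lambda>i\<in>{..<r}. T i v)"
    have y: "from_coords (\<lambda>i. T i v) = from_coords y" unfolding y_def by (rule from_coords_cong) simp
    assume "from_coords (\<lambda>i. T i v) \<notin> closure ?U"
    then have ny: "from_coords y \<notin> closure ?U" by (simp only: y not_False_eq_True)
    have yt: "y \<in> tuples r UNIV" by (simp add: y_def)
    have UM: "closure ?U \<subseteq> M" using sub body_in by (rule order_trans)
    obtain l where l: "l \<in> tuples r UNIV" "(\<Sum>i<r. l i * y i) < -1"
      "\<And>z. from_coords z \<in> closure ?U \<Longrightarrow> (\<Sum>i<r. l i * z i) \<ge> -1"
      using coords_separation[OF comp convex_closure[OF Uconv] U0 UM yt ny] by blast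
    have Qk: "0 \<le> sq a + (\<Sum>i<r. l i * moment a i)" if a: "poly_function n k a" for a k
    proof (cases "sq a = 0")
      case True then show ?thesis using moment_zero[OF a True] by simp
    next
      case False
      then have pos: "sq a > 0" using sq_nonneg[of a] by simp
      \<comment> \<open>The normalised moment vector of \<open>a\<close> lies in the polar by the definition of \<open>Q k\<close>.\<close>
      let ?z = "\<lambda>i\<in>{..<r}. moment a i / sq a"
      have "-1 \<le> (\<Sum>i<r. l' i * ?z i)" if "l' \<in> Q k" for l'
      proof -
        have "0 \<le> sq a + (\<Sum>i<r. l' i * moment a i)" using that a by (simp add: approx_Q_iff)
        then have "0 \<le> (sq a + (\<Sum>i<r. l' i * moment a i)) / sq a" using pos by simp
        also have "\<dots> = 1 + (\<Sum>i<r. l' i * ?z i)" using pos by (simp add: add_divide_distrib sum_divide_distrib)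
        finally show ?thesis by simp
      qed
      then have "?z \<in> polar r (Q k)" by (simp add: polar_def)
      then have "from_coords ?z \<in> ?U" by blast
      then have "from_coords ?z \<in> closure ?U" using closure_subset[of ?U] by (simp only: subset_iff)
      from l(3)[OF this] have "-1 \<le> (\<Sum>i<r. l i * moment a i) / sq a" by (simp add: sum_divide_distrib)
      then show ?thesis using pos by (simp add: field_simps)
    qed
    have "0 \<le> 1 + (\<Sum>i<r. l i * T i v)"
    proof (rule nonneg_if_all_square_integrals[OF _ _ v])
      show "poly_function n d (\<lambda>v. 1 + (\<Sum>i<r. l i * T i v))"
        by (intro poly_function.add poly_function.const poly_function_sum poly_function_scale T) auto
      show "0 \<le> (\<integral>v. (1 + (\<Sum>i<r. l i * T i v)) * (a v)\<^sup>2 \<partial>\<mu>)" if "poly_function n k a" for k a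
        unfolding weighted_integral[OF that] by (rule Qk[OF that])
    qed
    then show False using l(2) by (simp add: y_def)
  qed
  then show "body \<subseteq> closure ?U" unfolding body_def
    by (intro hull_minimal convex_closure Uconv) auto
qed

end

section \<open>Lebesgue measure on a convex body\<close>

lemma product_sigma_finite_lborel: "product_sigma_finite (\<lambda>_::nat. lborel :: real measure)"
  by (simp add: product_sigma_finite_def sigma_finite_lborel)

text \<open>The target has no countable basis of open sets in general, so measurability is derived from continuity on all of
  \<open>nat \<Rightarrow> real\<close>, whose Borel sets are those of the product.\<close>

lemma coordinate_map_measurable:
  fixes b :: "nat \<Rightarrow> 'v::real_normed_vector"
  shows "(\<lambda>c. \<Sum>i<m. c i *\<^sub>R b i) \<in> borel_measurable (PiM {..<m} (\<lambda>_. lborel))"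
proof -
  let ?g = "\<lambda>y :: nat \<Rightarrow> real. \<Sum>i<m. y i *\<^sub>R b i"
  let ?e = "\<lambda>c i. if i < m then c i else (0::real)"
  have "continuous_on UNIV ?g" by (intro continuous_intros)
  then have "?g \<in> borel_measurable borel" by (rule borel_measurable_continuous_onI)
  then have g: "?g \<in> borel_measurable (PiM UNIV (\<lambda>_. borel))"
    by (subst measurable_cong_sets[OF sets_PiM_equal_borel refl])
  have "(\<lambda>c. ?e c i) \<in> borel_measurable (PiM {..<m} (\<lambda>_. lborel))" for i
  proof (cases "i < m")
    case True
    have "(\<lambda>c. c i) \<in> measurable (PiM {..<m} (\<lambda>_. lborel :: real measure)) lborel"
      using True by (intro measurable_component_singleton) simp
    then show ?thesis using True by simp
  qed simp
  then have "?e \<in> measurable (PiM {..<m} (\<lambda>_. lborel)) (PiM UNIV (\<lambda>_. borel))"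
    by (rule measurable_abs_UNIV)
  from measurable_compose[OF this g] show ?thesis by simp
qed

text \<open>A point of \<open>P\<close> can be moved a little towards the interior of a simplex with vertices \<open>0\<close> and a basis in
  \<open>P\<close>.  It then has a whole neighbourhood in \<open>P\<close>, of positive volume.\<close>

lemma lebesgue_supported:
  fixes V P :: "'v::real_normed_vector set"
  assumes P: "convex_body V P" "0 \<in> P" and b: "basis_of m b V"
  shows "supported_measure P (lebesgue_restricted m b P)"
proof -
  have cP: "fin_dim V" "P \<subseteq> V" "compact P" "convex P" and hull: "affine hull P = V"
    using P(1) by (auto simp: convex_body_def)
  let ?L = "PiM {..<m} (\<lambda>_. lborel :: real measure)"
  define \<phi> where "\<phi> = (\<lambda>c. \<Sum>i<m. c i *\<^sub>R b i)"
  let ?D = "distr ?L borel \<phi>"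
  have LR: "lebesgue_restricted m b P = restrict_space ?D P"
    by (simp add: lebesgue_restricted_def \<phi>_def)
  have \<phi>: "\<phi> \<in> borel_measurable ?L" unfolding \<phi>_def by (rule coordinate_map_measurable)
  have spL: "space ?L = tuples m UNIV" by (simp add: space_PiM)
  interpret product_sigma_finite "\<lambda>_::nat. lborel :: real measure" by (rule product_sigma_finite_lborel)
  obtain f where f: "\<And>i. linear (f i)" "\<And>i j. i < m \<Longrightarrow> j < m \<Longrightarrow> f i (b j) = (if i = j then 1 else 0 :: real)"
    "\<And>x. x \<in> V \<Longrightarrow> (\<Sum>i<m. f i x *\<^sub>R b i) = x"
    by (rule basis_of_dual[OF b]) (rule that)
  have f\<phi>: "f i (\<phi> c) = c i" if "i < m" for i c unfolding \<phi>_def by (rule dual_sum[OF f(1,2) that])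
  have Pb: "P \<in> sets borel" using compact_imp_closed[OF cP(3)] by simp
  have em: "emeasure (restrict_space ?D P) A = emeasure ?L (\<phi> -` A \<inter> space ?L)" if "A \<subseteq> P" "A \<in> sets borel" for A
    using that Pb emeasure_distr[OF \<phi> that(2)] by (simp add: emeasure_restrict_space)
  have "sets (restrict_space ?D P) = sets (restrict_space borel P)" by (simp add: sets_restrict_space)
  moreover have "finite_measure (restrict_space ?D P)"
  proof
    have "\<exists>C. \<forall>x\<in>P. \<bar>f i x\<bar> \<le> C" for i
    proof -
      have "compact (f i ` P)"
        by (rule compact_continuous_image[OF continuous_on_subset[OF linear_continuous_on_fin_dim[OF cP(1) f(1)] cP(2)] cP(3)])
      then show ?thesis using compact_imp_bounded bounded_iff by (metis imageI real_norm_def)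
    qed
    then obtain C where C: "\<And>i x. x \<in> P \<Longrightarrow> \<bar>f i x\<bar> \<le> C i" by metis
    let ?B = "PiE {..<m} (\<lambda>i. {- C i..C i})"
    have "\<phi> -` P \<inter> space ?L \<subseteq> ?B"
    proof
      fix c assume "c \<in> \<phi> -` P \<inter> space ?L"
      then have c: "\<phi> c \<in> P" "c \<in> tuples m UNIV" by (auto simp: spL)
      have "\<bar>c i\<bar> \<le> C i" if "i < m" for i using C[OF c(1), of i] f\<phi>[OF that] by simp
      then show "c \<in> ?B" using c(2) by (auto simp: PiE_iff abs_le_iff minus_le_iff)
    qed
    then have "emeasure ?L (\<phi> -` P \<inter> space ?L) \<le> emeasure ?L ?B"
      by (rule emeasure_mono) (auto intro: sets_PiM_I_finite)
    also have "\<dots> = (\<Prod>i<m. emeasure lborel {- C i..C i})" by (rule emeasure_PiM) auto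
    also have "\<dots> < \<infinity>" unfolding infinity_ennreal_def less_top[symmetric]
      by (simp add: ennreal_prod_eq_top emeasure_lborel_Icc_eq)
    finally have "emeasure ?L (\<phi> -` P \<inter> space ?L) < \<infinity>" .
    then show "emeasure (restrict_space ?D P) (space (restrict_space ?D P)) \<noteq> \<infinity>"
      using em[OF order_refl Pb] by (simp add: space_restrict_space)
  qed
  moreover have "emeasure (restrict_space ?D P) (U \<inter> P) > 0" if U: "open U" "x \<in> U" and x: "x \<in> P" for x U
  proof -
    have "span P = V" using hull affine_hull_eq_span[OF P(2)] by simp
    moreover have "dim V = m" using b unfolding basis_of_def by (metis card_image card_lessThan dim_eq_card dim_span)
    ultimately obtain e where e: "basis_of m e V" "\<And>i. i < m \<Longrightarrow> e i \<in> P"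
      using basis_of_exists_in[OF cP(1)] by metis
    obtain g where g: "\<And>i. linear (g i)" "\<And>i j. i < m \<Longrightarrow> j < m \<Longrightarrow> g i (e j) = (if i = j then 1 else 0 :: real)"
      "\<And>x. x \<in> V \<Longrightarrow> (\<Sum>i<m. g i x *\<^sub>R e i) = x"
      by (rule basis_of_dual[OF e(1)]) (rule that)
    define q where "q t = (1 - t) *\<^sub>R x + (\<Sum>i<m. (t / (2 * (real m + 1))) *\<^sub>R e i)" for t
    have "real m + 1 \<noteq> 0" by linarith
    then have "continuous_on UNIV q" unfolding q_def by (auto intro!: continuous_intros)
    then have "open (q -` U)" by (rule open_vimage[OF U(1)])
    moreover have "0 \<in> q -` U" using U(2) by (simp add: q_def)
    ultimately obtain \<epsilon> where eps: "\<epsilon> > 0" "ball 0 \<epsilon> \<subseteq> q -` U" by (metis open_contains_ball)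
    define t where "t = min (\<epsilon> / 2) (1 / 2)"
    have t: "0 < t" "t < 1" using eps by (auto simp: t_def)
    have "t \<in> ball 0 \<epsilon>" using eps(1) t by (simp add: t_def)
    then have qU: "q t \<in> U" using eps(2) by blast
    have xV: "x \<in> V" using x cP by auto
    have sV: "subspace V" by (rule fin_dim_subspace[OF cP(1)])
    have qV: "q t \<in> V" unfolding q_def
      using basis_of_sum_in[OF e(1)] xV sV by (intro subspace_add subspace_scale)
    define W where "W = {y. \<forall>i<m. 0 < g i y - (1 - t) * g i x \<and> g i y - (1 - t) * g i x < t / (real m + 1)}"
    have WP: "y \<in> P" if y: "y \<in> V" "y \<in> W" for y
    proof -
      define \<beta> where "\<beta> i = (g i y - (1 - t) * g i x) / t" for i
      have \<beta>: "0 \<le> \<beta> i" "\<beta> i \<le> 1 / (real m + 1)" if "i < m" for i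
        using y(2) that t by (auto simp: W_def \<beta>_def field_simps intro!: less_imp_le)
      have sum\<beta>: "(\<Sum>i<m. \<beta> i) \<le> 1"
      proof -
        have "(\<Sum>i<m. \<beta> i) \<le> (\<Sum>i<m. 1 / (real m + 1))" using \<beta> by (intro sum_mono) auto
        also have "\<dots> = real m / (real m + 1)" by simp
        also have "\<dots> \<le> 1" by (simp add: divide_le_eq_1)
        finally show ?thesis .
      qed
      have "(\<Sum>i<m. \<beta> i *\<^sub>R e i) \<in> P"
      proof -
        have "(\<Sum>i\<in>insert m {..<m}. (if i = m then 1 - (\<Sum>i<m. \<beta> i) else \<beta> i) *\<^sub>R (if i = m then 0 else e i)) \<in> P"
          by (rule convex_sum[OF _ cP(4)]) (use \<beta> sum\<beta> e(2) P(2) in auto)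
        then show ?thesis by simp
      qed
      then have "(1 - t) *\<^sub>R x + t *\<^sub>R (\<Sum>i<m. \<beta> i *\<^sub>R e i) \<in> P"
        using t x by (intro convexD[OF cP(4)]) auto
      moreover have "(1 - t) *\<^sub>R x + t *\<^sub>R (\<Sum>i<m. \<beta> i *\<^sub>R e i) = y"
      proof -
        have "t *\<^sub>R (\<Sum>i<m. \<beta> i *\<^sub>R e i) = (\<Sum>i<m. g i y *\<^sub>R e i) - (1 - t) *\<^sub>R (\<Sum>i<m. g i x *\<^sub>R e i)"
          using t by (simp add: \<beta>_def scaleR_sum_right scaleR_diff_left sum_subtractf)
        then show ?thesis using g(3)[OF y(1)] g(3)[OF xV] by simp
      qed
      ultimately show ?thesis by simp
    qed
    have qW: "q t \<in> W"
    proof -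
      have "g i (q t) - (1 - t) * g i x = t / (2 * (real m + 1))" if "i < m" for i
        unfolding q_def using dual_sum[OF g(1,2) that, of "\<lambda>_. t / (2 * (real m + 1))"]
        by (simp add: linear_add[OF g(1)] linear_scale[OF g(1)])
      moreover have "0 < t / (2 * (real m + 1))" using t by simp
      moreover have "t / (2 * (real m + 1)) < t / (real m + 1)" using t by (intro divide_strict_left_mono) simp_all
      ultimately show ?thesis unfolding W_def by (intro CollectI allI impI conjI) (simp_all only:)
    qed
    define Z where "Z = {c :: nat \<Rightarrow> real. \<phi> c \<in> U \<and> \<phi> c \<in> W}"
    have "open Z"
    proof -
      have "continuous_on UNIV \<phi>" unfolding \<phi>_def by (intro continuous_intros)
      then have "open (\<phi> -` U)" by (rule open_vimage[OF U(1)])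
      moreover have "continuous_on UNIV (\<lambda>c. g i (\<phi> c))" for i
        unfolding \<phi>_def linear_sum[OF g(1)] linear_scale[OF g(1)] by (intro continuous_intros)
      then have "open {c. 0 < g i (\<phi> c) - (1 - t) * g i x}" "open {c. g i (\<phi> c) - (1 - t) * g i x < t / (real m + 1)}" for i
        by (intro open_Collect_less continuous_intros; simp)+
      then have "open (\<Inter>i\<in>{..<m}. {c. 0 < g i (\<phi> c) - (1 - t) * g i x} \<inter> {c. g i (\<phi> c) - (1 - t) * g i x < t / (real m + 1)})"
        by (intro open_INT open_Int) auto
      moreover have "Z = \<phi> -` U \<inter> (\<Inter>i\<in>{..<m}. {c. 0 < g i (\<phi> c) - (1 - t) * g i x} \<inter> {c. g i (\<phi> c) - (1 - t) * g i x < t / (real m + 1)})"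
        by (auto simp: Z_def W_def)
      ultimately show ?thesis by (simp add: open_Int)
    qed
    define c0 where "c0 i = f i (q t)" for i
    have "\<phi> c0 = q t" unfolding \<phi>_def c0_def by (rule f(3)[OF qV])
    then have "c0 \<in> Z" using qU qW by (simp add: Z_def)
    have "openin (product_topology (\<lambda>i. euclidean) UNIV) Z"
      using \<open>open Z\<close> by (simp add: euclidean_product_topology)
    from product_topology_open_contains_basis[OF this \<open>c0 \<in> Z\<close>]
    obtain X where X: "c0 \<in> (\<Pi>\<^sub>E i\<in>UNIV. X i)" "\<And>i. open (X i)" "(\<Pi>\<^sub>E i\<in>UNIV. X i) \<subseteq> Z" by auto
    have cX: "c0 i \<in> X i" for i using X(1) by auto
    let ?B = "PiE {..<m} X"
    have B: "?B \<subseteq> \<phi> -` (U \<inter> P) \<inter> space ?L"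
    proof
      fix c assume c: "c \<in> ?B"
      let ?c = "\<lambda>i. if i < m then c i else c0 i"
      have "?c \<in> (\<Pi>\<^sub>E i\<in>UNIV. X i)" using c cX by auto
      then have "?c \<in> Z" using X(3) by auto
      moreover have "\<phi> ?c = \<phi> c" by (simp add: \<phi>_def)
      moreover have "\<phi> c \<in> V" unfolding \<phi>_def by (rule basis_of_sum_in[OF b])
      ultimately have "\<phi> c \<in> U" "\<phi> c \<in> P" using WP by (auto simp: Z_def)
      moreover have "c \<in> space ?L" using c by (auto simp: spL PiE_iff)
      ultimately show "c \<in> \<phi> -` (U \<inter> P) \<inter> space ?L" by simp
    qed
    have UP: "U \<inter> P \<in> sets borel" using U(1) Pb by simp
    have "emeasure lborel (X i) > 0" for i
    proof -
      obtain r where r: "r > 0" "cball (c0 i) r \<subseteq> X i" using X(2)[of i] cX[of i] open_contains_cball by metis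
      have "0 < emeasure lborel {c0 i - r..c0 i + r}" using r(1) by (simp add: emeasure_lborel_Icc_eq)
      also have "\<dots> \<le> emeasure lborel (X i)"
        using r X(2)[of i] by (intro emeasure_mono) (auto simp: cball_eq_atLeastAtMost)
      finally show ?thesis .
    qed
    then have "(\<Prod>i<k. emeasure lborel (X i)) > 0" for k
      by (induction k) (auto simp: ennreal_zero_less_mult_iff)
    then have "0 < emeasure ?L ?B" using X(2) by (subst emeasure_PiM) auto
    also have "\<dots> \<le> emeasure ?L (\<phi> -` (U \<inter> P) \<inter> space ?L)"
      by (rule emeasure_mono[OF B]) (rule measurable_sets[OF \<phi> UP])
    also have "\<dots> = emeasure (restrict_space ?D P) (U \<inter> P)" using em[of "U \<inter> P"] UP by simp
    finally show ?thesis .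
  qed
  ultimately show ?thesis unfolding supported_measure_def LR by blast
qed

section \<open>Schur functors on convex bodies\<close>

text \<open>On \<open>P\<^sup>n\<close> the components of the universal map agree with the polynomials \<open>\<tau> i\<close> given by multilinear
  expansion.\<close>

lemma schur_accurate_scheme:
  fixes V P :: "'v::real_normed_vector set"
  assumes lam: "number_partition lam n" "n \<ge> 1" and P: "cc_object V P"
    and mP: "supported_measure P mP" and b: "basis_of r b (schur_module lam V)"
  shows "accurate_scheme lam V P mP r b"
proof -
  have n: "n = sum_list lam" using lam by (simp add: number_partition_def)
  have P': "fin_dim V" "P \<subseteq> V" "compact P" and sV: "subspace V"
    using P by (auto simp: cc_object_def convex_body_def)
  let ?h = "schur_map lam V"
  have m: "multilinear_on n V (schur_module lam V) ?h" using schur_map_exchange(1)[OF sV, of lam] by (simp add: n)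
  obtain f where f: "\<And>i. linear (f i)" "\<And>i j. i < r \<Longrightarrow> j < r \<Longrightarrow> f i (b j) = (if i = j then 1 else 0 :: real)"
    "\<And>x. x \<in> schur_module lam V \<Longrightarrow> (\<Sum>i<r. f i x *\<^sub>R b i) = x"
    "\<And>i x. i < r \<Longrightarrow> x \<in> schur_module lam V \<Longrightarrow> representation (b ` {..<r}) x (b i) = f i x"
    by (rule basis_of_dual[OF b]) (rule that)
  define d where "d = dim V"
  obtain e where "basis_of (dim V) e V" using basis_of_exists[OF P'(1)] .
  then have e: "basis_of d e V" by (simp add: d_def)
  obtain g where g: "\<And>i. linear (g i)" "\<And>x. x \<in> V \<Longrightarrow> (\<Sum>i<d. g i x *\<^sub>R e i) = x"
    by (rule basis_of_dual[OF e]) (rule that)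
  have eV: "e a \<in> V" if "a \<in> {..<d}" for a using e that by (auto simp: basis_of_def intro: span_base)
  define T where "T i v = representation (b ` {..<r}) (?h v) (b i)" for i v
  define \<tau> where "\<tau> i v = (\<Sum>J\<in>tuples n {..<d}. f i (?h (\<lambda>k\<in>{..<n}. e (J k))) * (\<Prod>k<n. g (J k) (v k)))" for i v
  have poly: "poly_function n n (\<tau> i)" for i
    unfolding \<tau>_def by (intro poly_function_sum poly_function_scale poly_function_prod_coord g(1) order_refl)
  have hM: "?h v \<in> schur_module lam V" if "v \<in> tuples n P" for v
    by (rule multilinear_on_in[OF m tuples_mono[OF that P'(2)]])
  have \<tau>: "\<tau> i v = f i (?h v)" if v: "v \<in> tuples n P" for i v
  proof -
    have "?h v = (\<Sum>J\<in>tuples n {..<d}. (\<Prod>k<n. g (J k) (v k)) *\<^sub>R ?h (\<lambda>k\<in>{..<n}. e (J k)))"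
      by (rule multilinear_expansion[OF m sV finite_lessThan eV g(2) tuples_mono[OF v P'(2)]])
    then show ?thesis by (simp add: \<tau>_def linear_sum[OF f(1)] linear_scale[OF f(1)] mult.commute)
  qed
  have T\<tau>: "T i v = \<tau> i v" if "i < r" "v \<in> tuples n P" for i v
    using f(4)[OF that(1) hM[OF that(2)]] \<tau>[OF that(2)] by (simp add: T_def)
  interpret pb: polynomial_body V P mP n r n \<tau> "schur_module lam V" b
    by unfold_locales (use P' mP poly b in auto)
  have Q: "approx_Q n r T mP k = approx_Q n r \<tau> mP k" for k
  proof -
    have "(\<integral>v. (1 + (\<Sum>i<r. l i * T i v)) * (a v)\<^sup>2 \<partial>PiM {..<n} (\<lambda>_. mP)) =
        (\<integral>v. (1 + (\<Sum>i<r. l i * \<tau> i v)) * (a v)\<^sup>2 \<partial>PiM {..<n} (\<lambda>_. mP))" for l a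
      by (rule Bochner_Integration.integral_cong) (auto simp: pb.space_\<mu> T\<tau>)
    then show ?thesis unfolding approx_Q_def by simp
  qed
  have "pb.from_coords (\<lambda>i. \<tau> i v) = ?h v" if "v \<in> tuples n P" for v
    using f(3)[OF hM[OF that]] \<tau>[OF that] by (simp add: pb.from_coords_def)
  then have body: "pb.body = schur_body lam V P"
    by (simp add: pb.body_def schur_body_def n[symmetric])
  have "0 \<in> pb.body" using schur_body_cc_object[OF lam P] by (simp add: body cc_object_def)
  from pb.body_eq_closure[OF this]
  have "schur_body lam V P = closure (\<Union>k. (\<lambda>y. \<Sum>i<r. y i *\<^sub>R b i) ` polar r (approx_Q n r T mP k))"
    unfolding body Q pb.from_coords_def .
  then show ?thesis
    unfolding accurate_scheme_def Let_def n[symmetric] T_def[symmetric]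
    using pb.polar_projected_spectrahedron pb.polar_incseq by (simp add: Q)
qed

theorem theorem7p2:
  fixes lam :: "nat list" and n m :: nat
    and V P :: "'v::real_normed_vector set"
  assumes "number_partition lam n" and "n \<ge> 1"
    and "subspace V" and "fin_dim V" and "dim V = m"
    and "convex_body V P" and "0 \<in> P"
  shows "
    (\<comment> \<open>(1) functor: objects and identities, morphisms, composition\<close>
     (\<forall>(V1 :: 'a::real_normed_vector set) P1. cc_object V1 P1 \<longrightarrow>
        cc_object (schur_module lam V1) (schur_body lam V1 P1) \<and>
        schur_morphism lam V1 P1 V1 (restrict id P1) = restrict id (schur_body lam V1 P1)) \<and>
     (\<forall>(V1 :: 'a set) P1 (V2 :: 'b::real_normed_vector set) P2.
        cc_object V1 P1 \<and> cc_object V2 P2 \<longrightarrow>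
        (\<forall>T\<in>cc_hom V1 P1 V2 P2.
           schur_morphism lam V1 P1 V2 T
             \<in> cc_hom (schur_module lam V1) (schur_body lam V1 P1)
                      (schur_module lam V2) (schur_body lam V2 P2))) \<and>
     (\<forall>(V1 :: 'a set) P1 (V2 :: 'b set) P2 (V3 :: 'c::real_normed_vector set) P3.
        cc_object V1 P1 \<and> cc_object V2 P2 \<and> cc_object V3 P3 \<longrightarrow>
        (\<forall>T1\<in>cc_hom V1 P1 V2 P2. \<forall>T2\<in>cc_hom V2 P2 V3 P3.
           schur_morphism lam V1 P1 V3 (compose P1 T2 T1) =
             compose (schur_body lam V1 P1)
               (schur_morphism lam V2 P2 V3 T2) (schur_morphism lam V1 P1 V2 T1))))
    \<and>
    (\<comment> \<open>(2)\<close>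
     \<forall>(F :: 'w::real_normed_vector set) W T.
       cc_object F W \<and> exchange_map_into lam V P F W T \<longrightarrow>
       (\<exists>!t. t \<in> cc_hom (schur_module lam V) (schur_body lam V P) F W \<and>
             (\<forall>v\<in>tuples n P. t (schur_map lam V v) = T v)))
    \<and>
    (\<comment> \<open>(3)\<close>
     convex_body (schur_module lam V) (schur_body lam V P) \<and>
     dim (affine hull (schur_body lam V P)) = card (semistandard_tableaux lam m) \<and>
     (length lam > 1 \<longrightarrow> uminus ` schur_body lam V P = schur_body lam V P))
    \<and>
    (\<comment> \<open>(4)\<close>
     schur_body lam V P = convex hull (schur_map lam V ` tuples n {x. x extreme_point_of P}) \<and>
     (polytope P \<longrightarrow> polytope (schur_body lam V P)))
    \<and>
    (\<comment> \<open>(5)\<close>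
     (\<forall>mP. supported_measure P mP \<longrightarrow>
        (\<forall>r b. basis_of r b (schur_module lam V) \<longrightarrow> accurate_scheme lam V P mP r b)) \<and>
     (\<forall>b. basis_of m b V \<longrightarrow> supported_measure P (lebesgue_restricted m b P)))"
proof -
  have P: "cc_object V P" using assms by (simp add: cc_object_def)
  have PV: "P \<subseteq> V" "compact P" "convex P" using assms(6) by (auto simp: convex_body_def)
  let ?M = "schur_module lam V" and ?B = "schur_body lam V P" and ?E = "{x. x extreme_point_of P}"
  have B: "convex_body ?M ?B" using schur_body_cc_object[OF assms(1,2) P] by (simp add: cc_object_def)
  have E: "P = convex hull ?E" by (rule minkowski_fin_dim[OF assms(4) PV])
  have EV: "?E \<subseteq> V" using PV(1) by (auto simp: extreme_point_of_def)
  have p1: "\<forall>(V1 :: 'a set) P1. cc_object V1 P1 \<longrightarrow>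
        cc_object (schur_module lam V1) (schur_body lam V1 P1) \<and>
        schur_morphism lam V1 P1 V1 (restrict id P1) = restrict id (schur_body lam V1 P1)"
    by (intro allI impI conjI schur_body_cc_object[OF assms(1,2)] schur_morphism_id[OF assms(1)])
  have p2: "\<forall>(V1 :: 'a set) P1 (V2 :: 'b set) P2. cc_object V1 P1 \<and> cc_object V2 P2 \<longrightarrow>
        (\<forall>T\<in>cc_hom V1 P1 V2 P2. schur_morphism lam V1 P1 V2 T
             \<in> cc_hom (schur_module lam V1) (schur_body lam V1 P1) (schur_module lam V2) (schur_body lam V2 P2))"
    by (intro allI impI ballI schur_morphism_hom[OF assms(1)]) simp_all
  have p3: "\<forall>(V1 :: 'a set) P1 (V2 :: 'b set) P2 (V3 :: 'c set) P3.
        cc_object V1 P1 \<and> cc_object V2 P2 \<and> cc_object V3 P3 \<longrightarrow>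
        (\<forall>T1\<in>cc_hom V1 P1 V2 P2. \<forall>T2\<in>cc_hom V2 P2 V3 P3.
           schur_morphism lam V1 P1 V3 (compose P1 T2 T1) =
             compose (schur_body lam V1 P1) (schur_morphism lam V2 P2 V3 T2) (schur_morphism lam V1 P1 V2 T1))"
    by (intro allI impI ballI schur_morphism_compose[OF assms(1)]) simp_all
  have p4: "\<forall>(F :: 'w set) W T. cc_object F W \<and> exchange_map_into lam V P F W T \<longrightarrow>
       (\<exists>!t. t \<in> cc_hom ?M ?B F W \<and> (\<forall>v\<in>tuples n P. t (schur_map lam V v) = T v))"
    by (intro allI impI schur_body_universal[OF assms(1) P]) simp_all
  have p5: "dim (affine hull ?B) = card (semistandard_tableaux lam m)"
    using B schur_module_dim(2)[OF assms(1,4)] assms(5) by (simp add: convex_body_def)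
  have p6: "length lam > 1 \<longrightarrow> uminus ` ?B = ?B"
    using schur_body_symmetric[OF assms(1,3) PV(1)] by blast
  have p7: "?B = convex hull (schur_map lam V ` tuples n ?E)"
    by (rule schur_body_convex_hull[OF assms(1,3) EV E])
  have p8: "polytope P \<longrightarrow> polytope ?B"
    using schur_body_polytope[OF assms(1,3) PV(1)] by blast
  have p9: "\<forall>mP. supported_measure P mP \<longrightarrow> (\<forall>r b. basis_of r b ?M \<longrightarrow> accurate_scheme lam V P mP r b)"
    by (intro allI impI schur_accurate_scheme[OF assms(1,2) P])
  have p10: "\<forall>b. basis_of m b V \<longrightarrow> supported_measure P (lebesgue_restricted m b P)"
    by (intro allI impI lebesgue_supported[OF assms(6,7)])
  show ?thesis
    using p1 p2 p3 p4 B p5 p6 p7 p8 p9 p10 by (intro conjI)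
qed

end
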